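(* Let $C$ be a cyclic group of prime order $p>0$ and let $A$ be a nontrivial finite group which is quasi-monomial. Let $W=A\wr C$ be the wreath product of $A$ by $C$, with base group $B=A\times\cdots\times A$ ($p$ copies). Assume that for any $\chi\in\mathrm{Irr}(W)$ with $\chi_B=\varphi\times\varphi\times\cdots\times\varphi\in\mathrm{Irr}(B)$, the character $\varphi\in\mathrm{Irr}(A)$ is monomial. Then $W=A\wr C$ is quasi-monomial.
   Context: All groups are finite and all characters are characters of finite-dimensional complex representations. $\mathrm{Irr}(G)$ denotes the set of irreducible characters of $G$. A character $\lambda$ is linear if $\lambda(1)=1$. For $H\leqslant G$, $\chi_H$ denotes the restriction of a character $\chi$ of $G$ to $H$, and $\theta^G$ denotes the character of $G$ induced by a character $\theta$ of $H$. For characters $\varphi_1,\ldots,\varphi_r$ of $A$, $\varphi_1\times\cdots\times\varphi_r$ is the character $(a_1,\ldots,a_r)\mapsto\varphi_1(a_1)\cdots\varphi_r(a_r)$ of $A\times\cdots\times A$. A character $\chi$ of $G$ is monomial if there exist a subgroup $H\leqslant G$ and a linear character $\lambda$ of $H$ with $\lambda^G=\chi$; it is quasi-monomial if there exist a subgroup $H\leqslant G$, a linear character $\lambda$ of $H$ and a positive integer $d$ with $\lambda^G=d\cdot\chi$. A finite group $G$ is quasi-monomial if all its irreducible characters are quasi-monomial. Wreath product: let $A$ be a nontrivial finite group, $r\geq 1$ an integer, and $B=A\times A\times\cdots\times A$ ($r$ copies). Let $f:B\to B$ be the automorphism $f(a_1,\ldots,a_r)=(a_r,a_1,\ldots,a_{r-1})$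 and $T=\langle f\rangle\leqslant\mathrm{Aut}(B)$, which is cyclic of order $r$. The wreath product $A\wr C$ of $A$ by a cyclic group $C$ of order $r$ is the semidirect product of $B$ by $T$ (with $T$ acting naturally on $B$); $B$ is its base group. (If $\chi\in\mathrm{Irr}(W)$ satisfies $\chi_B\in\mathrm{Irr}(B)$, then $\chi_B$ is automatically of the form $\varphi\times\cdots\times\varphi$ with $\varphi\in\mathrm{Irr}(A)$.) *)

theory Defs
  imports
    "Jordan_Normal_Form.VS_Connect"
    "HOL-Algebra.Bij"
    "HOL-Algebra.Product_Groups"
    "HOL-Computational_Algebra.Primes"
begin

section \<open>Complex characters of finite groups\<close>

definition GL_complex :: "nat \<Rightarrow> complex mat monoid" where
  "GL_complex n = units_of (ring_mat TYPE(complex) n ())"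

definition representation :: "('a, 'b) monoid_scheme \<Rightarrow> nat \<Rightarrow> ('a \<Rightarrow> complex mat) \<Rightarrow> bool" where
  "representation G n \<rho> \<longleftrightarrow> \<rho> \<in> hom G (GL_complex n)"

definition irreducible_representation ::
    "('a, 'b) monoid_scheme \<Rightarrow> nat \<Rightarrow> ('a \<Rightarrow> complex mat) \<Rightarrow> bool" where
  "irreducible_representation G n \<rho> \<longleftrightarrow>
     representation G n \<rho> \<and> 0 < n \<and>
     (\<forall>U. subspace class_ring U (module_vec TYPE(complex) n) \<and>
          (\<forall>g\<in>carrier G. \<forall>v\<in>U. \<rho> g *\<^sub>v v \<in> U) \<longrightarrow>
          U = {0\<^sub>v n} \<or> U = carrier_vec n)"

definition mat_trace :: "complex mat \<Rightarrow> complex" where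
  "mat_trace M = (\<Sum>i<dim_row M. M $$ (i, i))"

text \<open>Functions on a group are extensional (\<open>undefined\<close> off the carrier), so that equality
  in HOL is equality on the carrier.\<close>

definition afforded_character ::
    "('a, 'b) monoid_scheme \<Rightarrow> ('a \<Rightarrow> complex mat) \<Rightarrow> 'a \<Rightarrow> complex" where
  "afforded_character G \<rho> = (\<lambda>g\<in>carrier G. mat_trace (\<rho> g))"

definition characters :: "('a, 'b) monoid_scheme \<Rightarrow> ('a \<Rightarrow> complex) set" where
  "characters G = {afforded_character G \<rho> |\<rho> n. representation G n \<rho>}"

definition Irr :: "('a, 'b) monoid_scheme \<Rightarrow> ('a \<Rightarrow> complex) set" where
  "Irr G = {afforded_character G \<rho> |\<rho> n. irreducible_representation G n \<rho>}"

definition linear_characters :: "('a, 'b) monoid_scheme \<Rightarrow> ('a \<Rightarrow> complex) set" where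
  "linear_characters G = {\<mu> \<in> characters G. \<mu> \<one>\<^bsub>G\<^esub> = 1}"

definition induced_character ::
    "('a, 'b) monoid_scheme \<Rightarrow> 'a set \<Rightarrow> ('a \<Rightarrow> complex) \<Rightarrow> 'a \<Rightarrow> complex" where
  "induced_character G H \<theta> =
     (\<lambda>g\<in>carrier G.
        (\<Sum>x\<in>carrier G.
           (let y = x \<otimes>\<^bsub>G\<^esub> g \<otimes>\<^bsub>G\<^esub> inv\<^bsub>G\<^esub> x in if y \<in> H then \<theta> y else 0)) / of_nat (card H))"

definition monomial_character :: "('a, 'b) monoid_scheme \<Rightarrow> ('a \<Rightarrow> complex) \<Rightarrow> bool" where
  "monomial_character G \<chi> \<longleftrightarrow>
     (\<exists>H. subgroup H G \<and>
        (\<exists>\<mu>\<in>linear_characters (G\<lparr>carrier := H\<rparr>). induced_character G H \<mu> = \<chi>))"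

definition quasi_monomial_character :: "('a, 'b) monoid_scheme \<Rightarrow> ('a \<Rightarrow> complex) \<Rightarrow> bool" where
  "quasi_monomial_character G \<chi> \<longleftrightarrow>
     (\<exists>H. subgroup H G \<and>
        (\<exists>\<mu>\<in>linear_characters (G\<lparr>carrier := H\<rparr>). \<exists>d::nat. 0 < d \<and>
           induced_character G H \<mu> = (\<lambda>g\<in>carrier G. of_nat d * \<chi> g)))"

definition quasi_monomial_group :: "('a, 'b) monoid_scheme \<Rightarrow> bool" where
  "quasi_monomial_group G \<longleftrightarrow>
     group G \<and> finite (carrier G) \<and> (\<forall>\<chi>\<in>Irr G. quasi_monomial_character G \<chi>)"


section \<open>The wreath product with a finite cyclic group\<close>

definition direct_power :: "('a, 'b) monoid_scheme \<Rightarrow> nat \<Rightarrow> (nat \<Rightarrow> 'a) monoid" where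
  "direct_power A r = product_group {..<r} (\<lambda>_. A)"

definition outer_product ::
    "('a, 'b) monoid_scheme \<Rightarrow> nat \<Rightarrow> (nat \<Rightarrow> 'a \<Rightarrow> complex) \<Rightarrow> (nat \<Rightarrow> 'a) \<Rightarrow> complex" where
  "outer_product A r \<phi> = (\<lambda>a\<in>carrier (direct_power A r). \<Prod>i<r. \<phi> i (a i))"

text \<open>\<open>(a\<^sub>1, \<dots>, a\<^sub>r) \<mapsto> (a\<^sub>r, a\<^sub>1, \<dots>, a\<^sub>r\<^sub>-\<^sub>1)\<close>, with the coordinates indexed from \<open>0\<close>.\<close>

definition cyclic_shift :: "('a, 'b) monoid_scheme \<Rightarrow> nat \<Rightarrow> (nat \<Rightarrow> 'a) \<Rightarrow> nat \<Rightarrow> 'a" where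
  "cyclic_shift A r =
     (\<lambda>a\<in>carrier (direct_power A r). \<lambda>i\<in>{..<r}. a (if i = 0 then r - 1 else i - 1))"

definition shift_group :: "('a, 'b) monoid_scheme \<Rightarrow> nat \<Rightarrow> ((nat \<Rightarrow> 'a) \<Rightarrow> nat \<Rightarrow> 'a) monoid" where
  "shift_group A r = subgroup_generated (AutoGroup (direct_power A r)) {cyclic_shift A r}"

text \<open>\<open>T\<close> is meant to be a group of automorphisms of \<open>N\<close>, acting by evaluation.\<close>

definition semidirect_product ::
    "('a, 'b) monoid_scheme \<Rightarrow> ('a \<Rightarrow> 'a, 'c) monoid_scheme \<Rightarrow> ('a \<times> ('a \<Rightarrow> 'a)) monoid" where
  "semidirect_product N T =
     \<lparr>carrier = carrier N \<times> carrier T,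
      mult = (\<lambda>(a, s) (b, t). (a \<otimes>\<^bsub>N\<^esub> s b, s \<otimes>\<^bsub>T\<^esub> t)),
      one = (\<one>\<^bsub>N\<^esub>, \<one>\<^bsub>T\<^esub>)\<rparr>"

text \<open>Only the order of the cyclic group \<open>C\<close> enters the construction.\<close>

definition wreath_product ::
    "('a, 'b) monoid_scheme \<Rightarrow> ('c, 'd) monoid_scheme \<Rightarrow>
     ((nat \<Rightarrow> 'a) \<times> ((nat \<Rightarrow> 'a) \<Rightarrow> nat \<Rightarrow> 'a)) monoid" where
  "wreath_product A C = semidirect_product (direct_power A (Coset.order C)) (shift_group A (Coset.order C))"

text \<open>Restriction to the base group, which is identified with the direct power of \<open>A\<close> along
  \<open>a \<mapsto> (a, \<one>)\<close>.\<close>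

definition restrict_base ::
    "('a, 'b) monoid_scheme \<Rightarrow> ('c, 'd) monoid_scheme \<Rightarrow>
     ((nat \<Rightarrow> 'a) \<times> ((nat \<Rightarrow> 'a) \<Rightarrow> nat \<Rightarrow> 'a) \<Rightarrow> complex) \<Rightarrow> (nat \<Rightarrow> 'a) \<Rightarrow> complex" where
  "restrict_base A C \<chi> =
     (\<lambda>a\<in>carrier (direct_power A (Coset.order C)). \<chi> (a, \<one>\<^bsub>shift_group A (Coset.order C)\<^esub>))"

end

theory Submission
  imports
    Defs
    "Jordan_Normal_Form.DL_Rank"
    "Jordan_Normal_Form.Schur_Decomposition"
    "HOL-Algebra.Multiplicative_Group"
begin

text \<open>Let \<open>\<chi> \<in> Irr W\<close>. Since \<open>W / B\<close> is cyclic of prime order, either \<open>\<chi>\<close> restricts irreducibly to \<open>B\<close>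
  or \<open>\<chi>\<close> vanishes off \<open>B\<close>: compare \<open>\<chi>\<close> with its products with the characters of \<open>W / B\<close>.

  If \<open>\<chi>\<close> vanishes off \<open>B\<close>, then \<open>\<chi>\<close> is proportional to \<open>\<theta>\<^sup>W\<close> for every constituent
  \<open>\<theta> = \<phi>\<^sub>1 \<times> \<dots> \<times> \<phi>\<^sub>p\<close> of its restriction to \<open>B\<close>; if \<open>\<lambda>\<^sub>i\<^sup>A = d\<^sub>i \<phi>\<^sub>i\<close> with \<open>\<lambda>\<^sub>i\<close> linear, then
  inducing \<open>\<lambda>\<^sub>1 \<times> \<dots> \<times> \<lambda>\<^sub>p\<close> to \<open>W\<close> gives a multiple of \<open>\<chi>\<close>.

  Otherwise the restriction is \<open>\<phi> \<times> \<dots> \<times> \<phi>\<close> with \<open>\<phi> = \<lambda>\<^sup>A\<close> for a linear character \<open>\<lambda>\<close> of some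
  \<open>H\<close>. One of the extensions of \<open>\<lambda> \<times> \<dots> \<times> \<lambda>\<close> to \<open>H \<wr> C\<close> occurs in \<open>\<chi>\<close>, and
  \<open>|W : H \<wr> C| = |A : H|\<^sup>p = \<chi>(1)\<close>, so inducing that extension gives \<open>\<chi>\<close>.

  Proportionality suffices throughout, because a linear
  character whose induction is a complex multiple \<open>c\<close> of \<open>\<chi>\<close> occurs in \<open>\<chi>\<close> with multiplicity \<open>c\<close>.\<close>

section \<open>Traces and invariant subspaces\<close>

text \<open>The second case asks for \<phi> monomial for a reason of degrees. If the character
  induced from H were only d * \<phi>, then H wr C would have index d^p * \<chi>(1), and the induced
  character, of that degree, could be spread over the p extensions of \<phi> x ... x \<phi> to W.
  With d = 1 the degree leaves room for \<chi> alone. In the vanishing case this ambiguity does not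
  arise: \<chi> is the only constituent of the character induced from \<theta>, so any multiples d_i
  will do. The character theory rests on two facts about the group algebra. A class function acts as
  a scalar on an irreducible representation (\<open>Irr_sum_class_function\<close>); this yields
  proportionality of characters, Clifford's formula and the factorisation over direct powers. An
  idempotent has a natural number as its trace (\<open>convolution_idempotent_Nats\<close>); this is
  where the integrality of multiplicities comes from.\<close>

lemma mat_trace_mult_commute:
  assumes "A \<in> carrier_mat n m" and "B \<in> carrier_mat m n"
  shows "mat_trace (A * B) = mat_trace (B * A)"
proof -
  have "mat_trace (A * B) = (\<Sum>i<n. \<Sum>j<m. A $$ (i, j) * B $$ (j, i))"
    using assms unfolding mat_trace_def
    by (auto simp: scalar_prod_def atLeast0LessThan intro!: sum.cong)
  also have "\<dots> = (\<Sum>j<m. \<Sum>i<n. B $$ (j, i) * A $$ (i, j))"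
    by (subst sum.swap) (simp add: mult.commute)
  also have "\<dots> = mat_trace (B * A)"
    using assms unfolding mat_trace_def
    by (auto simp: scalar_prod_def atLeast0LessThan intro!: sum.cong)
  finally show ?thesis .
qed

lemma mat_trace_conjugate:
  assumes "P \<in> carrier_mat n n" and "B \<in> carrier_mat n n" and "Q \<in> carrier_mat n n"
    and "Q * P = 1\<^sub>m n"
  shows "mat_trace (P * B * Q) = mat_trace B"
proof -
  have "mat_trace (P * B * Q) = mat_trace (Q * (P * B))"
    using assms by (intro mat_trace_mult_commute[of _ n n]) auto
  also have "Q * (P * B) = (Q * P) * B"
    using assoc_mult_mat[OF assms(3,1,2)] by simp
  finally show ?thesis
    using assms by simp
qed

lemma mat_trace_smult: "A \<in> carrier_mat n n \<Longrightarrow> mat_trace (c \<cdot>\<^sub>m A) = c * mat_trace A"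
  by (auto simp: mat_trace_def sum_distrib_left)

lemma mat_trace_one: "mat_trace (1\<^sub>m n) = of_nat n"
  by (simp add: mat_trace_def)

text \<open>All matrix sizes share one type, so an empty sum has no size of its own:
  \<open>n\<close> is passed explicitly and the sum is taken entry by entry.\<close>

definition mat_sum :: "nat \<Rightarrow> ('g \<Rightarrow> complex mat) \<Rightarrow> 'g set \<Rightarrow> complex mat" where
  "mat_sum n F S = mat n n (\<lambda>(i, j). \<Sum>g\<in>S. F g $$ (i, j))"

lemma mat_sum_carrier [simp]: "mat_sum n F S \<in> carrier_mat n n"
  by (simp add: mat_sum_def)

lemma mat_sum_cong:
  assumes "\<And>g. g \<in> S \<Longrightarrow> F g = F' g"
  shows "mat_sum n F S = mat_sum n F' S"
  using assms by (intro eq_matI) (auto simp: mat_sum_def)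

lemma mult_mat_sum:
  assumes "A \<in> carrier_mat n n" and "\<And>g. g \<in> S \<Longrightarrow> F g \<in> carrier_mat n n"
  shows "A * mat_sum n F S = mat_sum n (\<lambda>g. A * F g) S"
proof (rule eq_matI)
  fix i j assume "i < dim_row (mat_sum n (\<lambda>g. A * F g) S)" and "j < dim_col (mat_sum n (\<lambda>g. A * F g) S)"
  then have ij: "i < n" "j < n"
    by (simp_all add: mat_sum_def)
  have "(A * mat_sum n F S) $$ (i, j) = (\<Sum>k<n. A $$ (i, k) * (\<Sum>g\<in>S. F g $$ (k, j)))"
    using assms(1) ij by (auto simp: mat_sum_def scalar_prod_def atLeast0LessThan intro!: sum.cong)
  also have "\<dots> = (\<Sum>g\<in>S. \<Sum>k<n. A $$ (i, k) * F g $$ (k, j))"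
    by (simp add: sum_distrib_left sum.swap[of _ _ S])
  also have "\<dots> = mat_sum n (\<lambda>g. A * F g) S $$ (i, j)"
    using assms ij by (auto simp: mat_sum_def scalar_prod_def atLeast0LessThan carrier_matD[OF assms(2)] intro!: sum.cong)
  finally show "(A * mat_sum n F S) $$ (i, j) = mat_sum n (\<lambda>g. A * F g) S $$ (i, j)" .
qed (use assms in \<open>auto simp: mat_sum_def\<close>)

lemma mat_sum_mult:
  assumes "A \<in> carrier_mat n n" and "\<And>g. g \<in> S \<Longrightarrow> F g \<in> carrier_mat n n"
  shows "mat_sum n F S * A = mat_sum n (\<lambda>g. F g * A) S"
proof (rule eq_matI)
  fix i j assume "i < dim_row (mat_sum n (\<lambda>g. F g * A) S)" and "j < dim_col (mat_sum n (\<lambda>g. F g * A) S)"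
  then have ij: "i < n" "j < n"
    by (simp_all add: mat_sum_def)
  have "(mat_sum n F S * A) $$ (i, j) = (\<Sum>k<n. (\<Sum>g\<in>S. F g $$ (i, k)) * A $$ (k, j))"
    using assms(1) ij by (auto simp: mat_sum_def scalar_prod_def atLeast0LessThan intro!: sum.cong)
  also have "\<dots> = (\<Sum>g\<in>S. \<Sum>k<n. F g $$ (i, k) * A $$ (k, j))"
    by (simp add: sum_distrib_right sum.swap[of _ _ S])
  also have "\<dots> = mat_sum n (\<lambda>g. F g * A) S $$ (i, j)"
    using assms ij by (auto simp: mat_sum_def scalar_prod_def atLeast0LessThan carrier_matD[OF assms(2)] intro!: sum.cong)
  finally show "(mat_sum n F S * A) $$ (i, j) = mat_sum n (\<lambda>g. F g * A) S $$ (i, j)" .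
qed (use assms in \<open>auto simp: mat_sum_def\<close>)

lemma mat_trace_mat_sum:
  assumes "\<And>g. g \<in> S \<Longrightarrow> F g \<in> carrier_mat n n"
  shows "mat_trace (mat_sum n F S) = (\<Sum>g\<in>S. mat_trace (F g))"
proof -
  have "mat_trace (mat_sum n F S) = (\<Sum>g\<in>S. \<Sum>i<n. F g $$ (i, i))"
    by (simp add: mat_trace_def mat_sum_def sum.swap[of _ _ S])
  also have "\<dots> = (\<Sum>g\<in>S. mat_trace (F g))"
    using carrier_matD(1)[OF assms] by (auto simp: mat_trace_def intro!: sum.cong)
  finally show ?thesis .
qed

section \<open>Triangular form and eigenvalues\<close>

lemma upper_triangular_mult:
  assumes "A \<in> carrier_mat n n" "B \<in> carrier_mat n n" "upper_triangular A" "upper_triangular B"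
  shows "upper_triangular (A * B)" and "i < n \<Longrightarrow> (A * B) $$ (i, i) = A $$ (i, i) * B $$ (i, i)"
proof -
  show "upper_triangular (A * B)"
  proof (rule upper_triangularI)
    fix i j assume ij: "j < i" "i < dim_row (A * B)"
    have "A $$ (i, k) * B $$ (k, j) = 0" if "k < n" for k
      using upper_triangularD[OF assms(3), of k i] upper_triangularD[OF assms(4), of j k] ij that assms(1,2)
      by (cases "k < i") auto
    then show "(A * B) $$ (i, j) = 0"
      using ij assms(1,2) by (auto simp: scalar_prod_def intro!: sum.neutral)
  qed
  assume i: "i < n"
  have "A $$ (i, k) * B $$ (k, i) = 0" if "k < n" "k \<noteq> i" for k
    using upper_triangularD[OF assms(3), of k i] upper_triangularD[OF assms(4), of i k] i that assms(1,2)
    by (cases "k < i") auto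
  then have "(\<Sum>k = 0..<n. A $$ (i, k) * B $$ (k, i)) = (\<Sum>k = 0..<n. if k = i then A $$ (i, i) * B $$ (i, i) else 0)"
    by (intro sum.cong) auto
  then show "(A * B) $$ (i, i) = A $$ (i, i) * B $$ (i, i)"
    using i assms(1,2) by (simp add: scalar_prod_def)
qed

lemma upper_triangular_pow:
  assumes "A \<in> carrier_mat n n" "upper_triangular (A :: complex mat)"
  shows "upper_triangular (A ^\<^sub>m k) \<and> (\<forall>i<n. (A ^\<^sub>m k) $$ (i, i) = A $$ (i, i) ^ k)"
proof (induction k)
  case (Suc k)
  then show ?case
    using upper_triangular_mult[OF pow_carrier_mat[OF assms(1)] assms(1) _ assms(2), of k]
    by (simp add: mult.commute)
qed (use assms in auto)

lemma complex_mat_triangularizable: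
  assumes "A \<in> carrier_mat n n"
  obtains B P Q where "similar_mat_wit (A :: complex mat) B P Q" "upper_triangular B" "B \<in> carrier_mat n n"
proof -
  obtain es where es: "char_poly A = (\<Prod>e\<leftarrow>es. [:- e, 1:])"
    using char_poly_factorized[OF assms] by blast
  obtain B P Q where "schur_decomposition A es = (B, P, Q)"
    by (metis prod_cases3)
  with schur_decomposition[OF assms es this] show thesis
    using that similar_mat_witD2(5)[OF assms] by blast
qed

lemma mat_trace_similar:
  assumes "A \<in> carrier_mat n n" "similar_mat_wit A B P Q"
  shows "mat_trace A = mat_trace B"
  using similar_mat_witD2[OF assms] by (metis mat_trace_conjugate)

lemma sum_in_Nats:
  fixes f :: "'a \<Rightarrow> complex"
  shows "(\<And>x. x \<in> S \<Longrightarrow> f x \<in> \<nat>) \<Longrightarrow> sum f S \<in> \<nat>"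
  by (induction S rule: infinite_finite_induct) auto

text \<open>The diagonal entries of a triangular form square to themselves, so each of them is 0 or
  1.\<close>

lemma mat_trace_idempotent:
  assumes "A \<in> carrier_mat n n" "A * A = A"
  shows "mat_trace A \<in> \<nat>"
proof -
  obtain B P Q where w: "similar_mat_wit A B P Q" "upper_triangular B" and B: "B \<in> carrier_mat n n"
    using complex_mat_triangularizable[OF assms(1)] .
  note W = similar_mat_witD2[OF assms(1) w(1)]
  have BQ: "B = Q * A * P"
    using similar_mat_witD2(3)[OF B similar_mat_wit_sym[OF w(1)]] .
  have "B * B = Q * (A * ((P * Q) * A)) * P"
    unfolding BQ using W(5-7) assms(1) by (simp add: assoc_mult_mat[of _ n n _ n _ n])
  also have "\<dots> = B"
    using W(1) assms by (simp add: BQ)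
  finally have "B $$ (i, i) * B $$ (i, i) = B $$ (i, i)" if "i < n" for i
    using upper_triangular_mult(2)[OF B B w(2) w(2) that] by simp
  then have "B $$ (i, i) \<in> \<nat>" if "i < n" for i
    using that by (metis Nats_0 Nats_1 mult_cancel_left2)
  then have "mat_trace B \<in> \<nat>"
    using B unfolding mat_trace_def by (intro sum_in_Nats) auto
  then show ?thesis
    using mat_trace_similar[OF assms(1) w(1)] by simp
qed

text \<open>The eigenvalues of a matrix of finite order are roots of unity, whose inverses are their
  conjugates. The inverse matrix is written as the power \<open>k\<close>, with \<open>Suc k\<close>
  a multiple of the order.\<close>

lemma mat_trace_pow_cnj:
  assumes A: "A \<in> carrier_mat n n" and "A ^\<^sub>m Suc k = 1\<^sub>m n"
  shows "mat_trace (A ^\<^sub>m k) = cnj (mat_trace A)"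
proof -
  obtain B P Q where w: "similar_mat_wit A B P Q" "upper_triangular B" and B: "B \<in> carrier_mat n n"
    using complex_mat_triangularizable[OF A] .
  have "similar_mat_wit (A ^\<^sub>m Suc k) (B ^\<^sub>m Suc k) P Q"
    using similar_mat_wit_pow[OF w(1)] .
  then have "similar_mat_wit (B ^\<^sub>m Suc k) (1\<^sub>m n) Q P"
    using similar_mat_wit_sym assms(2) by metis
  note W = similar_mat_witD2[OF pow_carrier_mat[OF B] this]
  have one: "B ^\<^sub>m Suc k = 1\<^sub>m n"
    using W(1,3) right_mult_one_mat[OF W(6)] by metis
  have "B $$ (i, i) ^ k = cnj (B $$ (i, i))" if "i < n" for i
  proof -
    have 1: "B $$ (i, i) ^ Suc k = 1"
      using upper_triangular_pow[OF B w(2), of "Suc k"] that one by (metis index_one_mat(1))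
    have "norm (B $$ (i, i) ^ Suc k) = 1"
      unfolding 1 by simp
    then have "norm (B $$ (i, i)) ^ Suc k = 1"
      by (simp only: norm_power)
    then have "norm (B $$ (i, i)) = 1"
      using power_eq_imp_eq_base[of "norm (B $$ (i, i))" "Suc k" 1] by (simp del: power_Suc)
    then have "complex_of_real ((norm (B $$ (i, i)))\<^sup>2) = 1"
      by simp
    then have "B $$ (i, i) * cnj (B $$ (i, i)) = 1"
      by (simp only: complex_norm_square)
    moreover have "B $$ (i, i) * B $$ (i, i) ^ k = 1"
      using 1 by simp
    ultimately show ?thesis
      by (metis mult_cancel_left mult_zero_left zero_neq_one)
  qed
  then have "mat_trace (B ^\<^sub>m k) = cnj (mat_trace B)"
    using upper_triangular_pow[OF B w(2), of k] B by (auto simp: mat_trace_def intro!: sum.cong)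
  then show ?thesis
    using mat_trace_similar[OF A w(1)] mat_trace_similar[OF pow_carrier_mat[OF A] similar_mat_wit_pow[OF w(1)]]
    by simp
qed

text \<open>A basis of \<open>U\<close>, found as a maximal independent subset, is completed to a
  basis of the whole space by exchange with the unit vectors. The columns of \<open>S\<close> are
  this basis, with the vectors of \<open>U\<close> first; \<open>S'\<close> therefore computes
  coordinates, and those from \<open>d\<close> on vanish on \<open>U\<close>.\<close>

lemma subspace_adapted_basis:
  assumes "VectorSpace.subspace class_ring U (module_vec TYPE(complex) n)"
  obtains d S S' where "d \<le> n" "S \<in> carrier_mat n n" "S' \<in> carrier_mat n n"
    "S * S' = 1\<^sub>m n" "S' * S = 1\<^sub>m n" "\<And>j. j < d \<Longrightarrow> col S j \<in> U"
    "\<And>v i. v \<in> U \<Longrightarrow> d \<le> i \<Longrightarrow> i < n \<Longrightarrow> (S' *\<^sub>v v) $ i = 0"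
    "d = n \<Longrightarrow> U = carrier_vec n"
proof -
  interpret vec_space "TYPE(complex)" n .
  have U: "U \<subseteq> carrier_vec n"
    using assms by (auto simp: VectorSpace.subspace_def submodule_def module_vec_simps)
  have "\<exists>B. finite B \<and> maximal B (\<lambda>T. T \<subseteq> U \<and> lin_indpt T)"
  proof (rule maximal_exists[where N = n and B = "{}"])
    fix T assume "T \<subseteq> U \<and> lin_indpt T"
    then show "finite T \<and> card T \<le> n"
      using li_le_dim[OF fin_dim, of T] U by (auto simp: dim_is_n)
  next
    show "{} \<subseteq> U \<and> lin_indpt {}"
      by (simp add: finite_lin_indpt2)
  qed
  then obtain B where fB: "finite B" and maxB: "maximal B (\<lambda>T. T \<subseteq> U \<and> lin_indpt T)"
    by blast
  have BU: "B \<subseteq> U" and liB: "lin_indpt B"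
    using maxB by (auto simp: maximal_def)
  have span: "v \<in> span B" if "v \<in> U" for v
  proof (cases "v \<in> B")
    case True
    then show ?thesis
      using in_own_span BU U by blast
  next
    case False
    have "lin_dep (B \<union> {v})"
      using maxB False that unfolding maximal_def by blast
    then show ?thesis
      using lin_dep_iff_in_span[OF _ liB _ False] BU U that by blast
  qed
  obtain C where C: "finite C" "C \<subseteq> carrier_vec n" "C \<inter> B = {}"
      "int (card C) \<le> int (card (set (unit_vecs n :: complex vec list))) - int (card B)"
      "span (B \<union> C) = span (set (unit_vecs n))"
    using replacement[OF fB _ _ liB, of "set (unit_vecs n)"] BU U span_unit_vecs_is_carrier
    by (auto simp: unit_vecs_carrier)
  have "card (set (unit_vecs n :: complex vec list)) = n"
    using distinct_card[OF unit_vecs_distinct] unit_vecs_length by metis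
  then have card: "card (B \<union> C) \<le> n"
    using C(3,4) fB C(1)
    by (simp add: card_Un_disjoint Int_commute)
  \<comment> \<open>A generating set with no more elements than the dimension is a basis.\<close>
  have "basis (B \<union> C)"
    using dim_gen_is_basis[of "B \<union> C"] C U BU fB card span_unit_vecs_is_carrier
    by (auto simp: dim_is_n)
  then have li: "lin_indpt (B \<union> C)"
    by (simp add: basis_def)
  have cardn: "card (B \<union> C) = n"
    using dim_basis[OF _ \<open>basis (B \<union> C)\<close>] fB C(1) dim_is_n by simp
  obtain xs where xs: "set xs = B" "distinct xs"
    using finite_distinct_list[OF fB] by blast
  obtain ys where ys: "set ys = C" "distinct ys"
    using finite_distinct_list[OF C(1)] by blast
  define zs where "zs = xs @ ys"
  have zs: "distinct zs" "set zs = B \<union> C" "set zs \<subseteq> carrier_vec n"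
    using xs ys C BU U by (auto simp: zs_def)
  have len: "length zs = n"
    using zs cardn distinct_card by metis
  define d where "d = length xs"
  define S where "S = mat_of_cols n zs"
  define M where "M = mat_of_cols n xs"
  have S: "S \<in> carrier_mat n n" and cS: "cols S = zs"
    using len zs(3) by (auto simp: S_def intro: cols_mat_of_cols)
  have M: "M \<in> carrier_mat n d" and cM: "cols M = xs"
    using xs BU U by (auto simp: M_def d_def intro: cols_mat_of_cols)
  have "det S \<noteq> 0"
    using lin_indpt_full_rank[OF S] det_rank_iff[OF S] cS zs li by metis
  then obtain S' where S': "S' \<in> carrier_mat n n" "S * S' = 1\<^sub>m n" "S' * S = 1\<^sub>m n"
    using det_non_zero_imp_unit[OF S, of undefined] by (auto simp: Units_def ring_mat_simps)
  have dn: "d \<le> n"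
    using len by (simp add: d_def zs_def)
  show thesis
  proof
    show "d \<le> n" "S \<in> carrier_mat n n" "S' \<in> carrier_mat n n" "S * S' = 1\<^sub>m n" "S' * S = 1\<^sub>m n"
      by (fact dn S S')+
    show "col S j \<in> U" if "j < d" for j
    proof -
      have "col S j = zs ! j"
        using that dn S cS by (metis carrier_matD(2) cols_nth order_less_le_trans)
      also have "\<dots> = xs ! j"
        using that by (simp add: zs_def d_def nth_append)
      finally show ?thesis
        using that xs BU by (auto simp: d_def)
    qed
    show "(S' *\<^sub>v v) $ i = 0" if vi: "v \<in> U" "d \<le> i" "i < n" for v i
    proof -
      obtain a where "v = lincomb a B"
        using finite_in_span[OF fB, of v] span[OF vi(1)] BU U by blast
      then have v: "v = M *\<^sub>v vec d (\<lambda>i. a (col M i))"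
        using mat_mult_eq_lincomb[OF M, of a] xs cM by simp
      \<comment> \<open>The coordinates of \<open>v\<close> in the full basis: those in the basis of
        \<open>U\<close>, padded with zeros.\<close>
      define w where "w = vec n (\<lambda>i. if i < d then a (col M i) else 0)"
      have "v = S *\<^sub>v w"
      proof (rule eq_vecI)
        show "dim_vec v = dim_vec (S *\<^sub>v w)"
          using v M S by simp
        fix k assume "k < dim_vec (S *\<^sub>v w)"
        then have k: "k < n"
          using S by simp
        have "(S *\<^sub>v w) $ k = (\<Sum>j<n. S $$ (k, j) * (if j < d then a (col M j) else 0))"
          using S k by (auto simp: w_def scalar_prod_def atLeast0LessThan intro!: sum.cong)
        also have "\<dots> = (\<Sum>j<d. S $$ (k, j) * a (col M j))"
          using dn by (intro sum.mono_neutral_cong_right) auto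
        also have "\<dots> = (\<Sum>j<d. M $$ (k, j) * a (col M j))"
          using k dn len by (intro sum.cong) (auto simp: S_def M_def mat_of_cols_def zs_def d_def nth_append)
        also have "\<dots> = v $ k"
          unfolding v using M k by (auto simp: scalar_prod_def atLeast0LessThan intro!: sum.cong)
        finally show "v $ k = (S *\<^sub>v w) $ k" by simp
      qed
      then have "S' *\<^sub>v v = w"
        using assoc_mult_mat_vec[OF S'(1) S, of w] S'(3) by (simp add: w_def)
      then show ?thesis
        using vi by (simp add: w_def)
    qed
    show "U = carrier_vec n" if "d = n"
    proof -
      have "ys = []"
        using that len by (simp add: zs_def d_def)
      then have "span B = carrier_vec n"
        using C(5) ys span_unit_vecs_is_carrier by simp
      moreover have "span B \<subseteq> U"
        using span_is_subset[OF BU] assms by (simp add: VectorSpace.subspace_def)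
      ultimately show ?thesis
        using U by blast
    qed
  qed
qed

section \<open>Representations and Schur's lemma\<close>

lemma index_mult_mat_sum:
  assumes "A \<in> carrier_mat n m" "B \<in> carrier_mat m l" "i < n" "j < l"
  shows "(A * B) $$ (i, j) = (\<Sum>k<m. A $$ (i, k) * B $$ (k, j))"
  using assms by (auto simp: scalar_prod_def atLeast0LessThan intro!: sum.cong)

lemma smult_mult_smult_mat:
  fixes a b :: complex
  assumes "A \<in> carrier_mat n n" "B \<in> carrier_mat n n"
  shows "(a \<cdot>\<^sub>m A) * (b \<cdot>\<^sub>m B) = (a * b) \<cdot>\<^sub>m (A * B)"
  using assms
  by (intro eq_matI) (auto simp: index_mult_mat_sum[of _ n n _ n] sum_distrib_left mult.assoc
      mult.left_commute simp del: index_mult_mat(1))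

locale finite_group = group G for G (structure) +
  assumes fin: "finite (carrier G)"
begin

lemma order_pos: "card (carrier G) > 0"
  using fin by (auto simp: card_gt_0_iff)

lemma sum_left_translate:
  "a \<in> carrier G \<Longrightarrow> (\<Sum>x\<in>carrier G. f (a \<otimes> x)) = (\<Sum>x\<in>carrier G. f x)"
  by (rule sum.reindex_bij_witness[of _ "\<lambda>x. inv a \<otimes> x" "\<lambda>x. a \<otimes> x"])
    (auto simp: m_assoc[symmetric])

lemma sum_right_translate:
  "a \<in> carrier G \<Longrightarrow> (\<Sum>x\<in>carrier G. f (x \<otimes> a)) = (\<Sum>x\<in>carrier G. f x)"
  by (rule sum.reindex_bij_witness[of _ "\<lambda>x. x \<otimes> inv a" "\<lambda>x. x \<otimes> a"])
    (auto simp: m_assoc)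

lemma sum_inv: "(\<Sum>x\<in>carrier G. f (inv x)) = (\<Sum>x\<in>carrier G. f x)"
  by (rule sum.reindex_bij_witness[of _ "\<lambda>x. inv x" "\<lambda>x. inv x"]) auto

lemma representationD:
  assumes "representation G n \<rho>"
  shows "g \<in> carrier G \<Longrightarrow> \<rho> g \<in> carrier_mat n n"
    and "g \<in> carrier G \<Longrightarrow> h \<in> carrier G \<Longrightarrow> \<rho> (g \<otimes> h) = \<rho> g * \<rho> h"
    and "\<rho> \<one> = 1\<^sub>m n"
proof -
  let ?R = "ring_mat TYPE(complex) n ()"
  interpret R: ring ?R by (rule ring_mat)
  have hom: "\<rho> \<in> hom G (units_of ?R)"
    using assms by (simp add: representation_def GL_complex_def)
  show "g \<in> carrier G \<Longrightarrow> \<rho> g \<in> carrier_mat n n"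
    using hom by (auto simp: hom_def units_of_def Units_def ring_mat_simps)
  show "g \<in> carrier G \<Longrightarrow> h \<in> carrier G \<Longrightarrow> \<rho> (g \<otimes> h) = \<rho> g * \<rho> h"
    using hom by (simp add: hom_def units_of_def ring_mat_simps)
  show "\<rho> \<one> = 1\<^sub>m n"
    using hom_one[OF hom group_axioms R.units_group] by (simp add: units_of_def ring_mat_simps)
qed

text \<open>Membership in the general linear group comes from multiplicativity, since
  \<open>\<rho> (inv g)\<close> is inverse to \<open>\<rho> g\<close>.\<close>

lemma representationI:
  assumes "\<And>g. g \<in> carrier G \<Longrightarrow> \<rho> g \<in> carrier_mat n n"
    and "\<And>g h. g \<in> carrier G \<Longrightarrow> h \<in> carrier G \<Longrightarrow> \<rho> (g \<otimes> h) = \<rho> g * \<rho> h"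
    and "\<rho> \<one> = 1\<^sub>m n"
  shows "representation G n \<rho>"
proof -
  have "\<rho> g * \<rho> (inv g) = 1\<^sub>m n \<and> \<rho> (inv g) * \<rho> g = 1\<^sub>m n" if "g \<in> carrier G" for g
    using that assms(3) by (simp flip: assms(2))
  then have "\<rho> g \<in> Units (ring_mat TYPE(complex) n ())" if "g \<in> carrier G" for g
    using assms(1) that inv_closed[OF that] unfolding Units_def ring_mat_simps by blast
  then show ?thesis
    using assms(2) by (simp add: representation_def GL_complex_def hom_def units_of_def ring_mat_simps)
qed

lemma representation_inv:
  assumes "representation G n \<rho>" "g \<in> carrier G"
  shows "\<rho> g * \<rho> (inv g) = 1\<^sub>m n" "\<rho> (inv g) * \<rho> g = 1\<^sub>m n"
  using assms representationD(3)[OF assms(1)]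
  by (simp_all flip: representationD(2)[OF assms(1)])

lemma characters_obtain:
  assumes "\<chi> \<in> characters G"
  obtains n \<rho> where "representation G n \<rho>"
    "\<forall>g\<in>carrier G. \<chi> g = mat_trace (\<rho> g)" "\<chi> \<one> = of_nat n"
proof -
  obtain n \<rho> where *: "representation G n \<rho>" "\<chi> = afforded_character G \<rho>"
    using assms by (auto simp: characters_def)
  show thesis
    by (rule that[OF *(1)]) (auto simp: * afforded_character_def representationD[OF *(1)] mat_trace_one)
qed

lemma Irr_subset: "Irr G \<subseteq> characters G"
  by (auto simp: Irr_def characters_def irreducible_representation_def)

lemma Irr_obtain:
  assumes "\<chi> \<in> Irr G"
  obtains n \<rho> where "irreducible_representation G n \<rho>" "representation G n \<rho>" "0 < n"
    "\<forall>g\<in>carrier G. \<chi> g = mat_trace (\<rho> g)" "\<chi> \<one> = of_nat n"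
proof -
  obtain n \<rho> where *: "irreducible_representation G n \<rho>" "\<chi> = afforded_character G \<rho>"
    using assms by (auto simp: Irr_def)
  then have r: "representation G n \<rho>" "0 < n"
    by (auto simp: irreducible_representation_def)
  show thesis
    by (rule that[OF *(1) r]) (auto simp: * afforded_character_def representationD[OF r(1)] mat_trace_one)
qed

lemma character_extensional: "\<chi> \<in> characters G \<Longrightarrow> \<chi> \<in> extensional (carrier G)"
  by (auto simp: characters_def afforded_character_def)

lemma character_commute:
  assumes "\<chi> \<in> characters G" "x \<in> carrier G" "y \<in> carrier G"
  shows "\<chi> (x \<otimes> y) = \<chi> (y \<otimes> x)"
proof -
  obtain n \<rho> where r: "representation G n \<rho>" "\<forall>g\<in>carrier G. \<chi> g = mat_trace (\<rho> g)"
    "\<chi> \<one> = of_nat n"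
    using characters_obtain[OF assms(1)] by metis
  show ?thesis
    using assms(2,3) representationD[OF r(1)] mat_trace_mult_commute[of "\<rho> x" n n "\<rho> y"]
    by (simp add: r(2))
qed

lemma character_conj:
  assumes "\<chi> \<in> characters G" "x \<in> carrier G" "g \<in> carrier G"
  shows "\<chi> (x \<otimes> g \<otimes> inv x) = \<chi> g"
  using character_commute[OF assms(1), of "x \<otimes> g" "inv x"] assms(2,3) by (simp add: m_assoc[symmetric])

text \<open>With group order \<open>Suc k\<close>, the inverse of \<open>g\<close> is its power
  \<open>k\<close>, and \<open>mat_trace_pow_cnj\<close> applies.\<close>

lemma character_inv:
  assumes "\<chi> \<in> characters G" "g \<in> carrier G"
  shows "\<chi> (inv g) = cnj (\<chi> g)"
proof -
  obtain n \<rho> where r: "representation G n \<rho>" "\<forall>g\<in>carrier G. \<chi> g = mat_trace (\<rho> g)"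
    "\<chi> \<one> = of_nat n"
    using characters_obtain[OF assms(1)] by metis
  have pow: "\<rho> (g [^] k) = \<rho> g ^\<^sub>m k" for k
    by (induction k) (use assms(2) representationD[OF r(1)] in auto)
  obtain k where k: "Coset.order G = Suc k"
    using order_pos by (metis Coset.order_def gr0_implies_Suc)
  have gk: "g [^] Suc k = \<one>"
    using pow_order_eq_1[OF assms(2)] k by simp
  then have "inv g = g [^] k"
    using assms(2) by (metis inv_equality nat_pow_Suc nat_pow_Suc2 nat_pow_closed)
  then have "\<chi> (inv g) = mat_trace (\<rho> g ^\<^sub>m k)"
    using assms(2) by (simp add: r(2) pow)
  also have "\<dots> = cnj (mat_trace (\<rho> g))"
  proof (rule mat_trace_pow_cnj)
    show "\<rho> g ^\<^sub>m Suc k = 1\<^sub>m n"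
      using pow[of "Suc k"] gk representationD(3)[OF r(1)] by simp
  qed (use representationD(1)[OF r(1) assms(2)] in simp)
  finally show ?thesis
    using assms(2) by (simp add: r(2))
qed

text \<open>A function that is idempotent under convolution acts by an idempotent matrix.\<close>

lemma convolution_idempotent_Nats:
  assumes "\<chi> \<in> characters G"
    and f: "\<And>h. h \<in> carrier G \<Longrightarrow> (\<Sum>k\<in>carrier G. f k * f (inv k \<otimes> h)) = f h"
  shows "(\<Sum>h\<in>carrier G. f h * \<chi> h) \<in> \<nat>"
proof -
  obtain n \<rho> where r: "representation G n \<rho>" "\<forall>g\<in>carrier G. \<chi> g = mat_trace (\<rho> g)"
    "\<chi> \<one> = of_nat n"
    using characters_obtain[OF assms(1)] by metis
  note R = representationD[OF r(1)]
  define P where "P = mat_sum n (\<lambda>h. f h \<cdot>\<^sub>m \<rho> h) (carrier G)"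
  have P: "P \<in> carrier_mat n n"
    by (simp add: P_def)
  have 1: "(f k \<cdot>\<^sub>m \<rho> k) * P = mat_sum n (\<lambda>h. (f k * f (inv k \<otimes> h)) \<cdot>\<^sub>m \<rho> h) (carrier G)"
    if k: "k \<in> carrier G" for k
  proof -
    have "(f k \<cdot>\<^sub>m \<rho> k) * P = mat_sum n (\<lambda>h. (f k \<cdot>\<^sub>m \<rho> k) * (f h \<cdot>\<^sub>m \<rho> h)) (carrier G)"
      unfolding P_def using R(1) k by (intro mult_mat_sum) auto
    also have "\<dots> = mat_sum n (\<lambda>h. (f k * f (inv k \<otimes> (k \<otimes> h))) \<cdot>\<^sub>m \<rho> (k \<otimes> h)) (carrier G)"
    proof (rule mat_sum_cong)
      fix h assume h: "h \<in> carrier G"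
      then show "(f k \<cdot>\<^sub>m \<rho> k) * (f h \<cdot>\<^sub>m \<rho> h) = (f k * f (inv k \<otimes> (k \<otimes> h))) \<cdot>\<^sub>m \<rho> (k \<otimes> h)"
        using k by (simp add: R(2) m_assoc[symmetric] smult_mult_smult_mat[OF R(1)[OF k] R(1)[OF h]])
    qed
    also have "\<dots> = mat_sum n (\<lambda>h. (f k * f (inv k \<otimes> h)) \<cdot>\<^sub>m \<rho> h) (carrier G)"
      unfolding mat_sum_def
      by (rule cong_mat)
        (auto intro!: sum_left_translate[OF k, where f = "\<lambda>h. ((f k * f (inv k \<otimes> h)) \<cdot>\<^sub>m \<rho> h) $$ _"])
    finally show ?thesis .
  qed
  \<comment> \<open>The coefficient of \<open>\<rho> h\<close> in \<open>P * P\<close> is the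
    convolution of \<open>f\<close> with itself at \<open>h\<close>.\<close>
  have "P * P = mat_sum n (\<lambda>k. (f k \<cdot>\<^sub>m \<rho> k) * P) (carrier G)"
    unfolding P_def using R(1) by (intro mat_sum_mult) auto
  also have "\<dots> = P"
  proof (rule eq_matI)
    fix i j assume "i < dim_row P" "j < dim_col P"
    then have ij: "i < n" "j < n"
      using P by auto
    have "mat_sum n (\<lambda>k. (f k \<cdot>\<^sub>m \<rho> k) * P) (carrier G) $$ (i, j) =
        (\<Sum>k\<in>carrier G. \<Sum>h\<in>carrier G. (f k * f (inv k \<otimes> h)) * \<rho> h $$ (i, j))"
      using ij R(1) by (simp add: mat_sum_def 1 carrier_matD[OF R(1)])
    also have "\<dots> = (\<Sum>h\<in>carrier G. f h * \<rho> h $$ (i, j))"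
      by (subst sum.swap) (simp add: f flip: sum_distrib_right)
    also have "\<dots> = P $$ (i, j)"
      using ij by (simp add: P_def mat_sum_def carrier_matD[OF R(1)])
    finally show "mat_sum n (\<lambda>k. (f k \<cdot>\<^sub>m \<rho> k) * P) (carrier G) $$ (i, j) = P $$ (i, j)" .
  qed (use P in \<open>auto simp: mat_sum_def\<close>)
  finally have "mat_trace P \<in> \<nat>"
    using mat_trace_idempotent[OF P] by simp
  moreover have "mat_trace P = (\<Sum>h\<in>carrier G. f h * \<chi> h)"
    unfolding P_def using R(1) by (subst mat_trace_mat_sum) (auto simp: mat_trace_smult[OF R(1)] r(2))
  ultimately show ?thesis
    by simp
qed

text \<open>An eigenspace of \<open>M\<close> is invariant under all matrices commuting with
  \<open>M\<close>, and over the complex numbers a nonzero one exists. Irreducibility makes it the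
  whole space.\<close>

lemma schur_scalar:
  assumes "irreducible_representation G n \<rho>" and M: "M \<in> carrier_mat n n"
    and comm: "\<And>g. g \<in> carrier G \<Longrightarrow> \<rho> g * M = M * \<rho> g"
  obtains c where "M = c \<cdot>\<^sub>m 1\<^sub>m n"
proof -
  have r: "representation G n \<rho>" "0 < n"
    using assms(1) by (auto simp: irreducible_representation_def)
  note R = representationD[OF r(1)]
  obtain es where es: "char_poly M = (\<Prod>e\<leftarrow>es. [:- e, 1:])" "length es = n"
    using char_poly_factorized[OF M] by blast
  then obtain c es' where "es = c # es'"
    using r(2) by (cases es) auto
  then have "poly (char_poly M) c = 0"
    using es by simp
  then obtain v where v: "v \<in> carrier_vec n" "v \<noteq> 0\<^sub>v n" "M *\<^sub>v v = c \<cdot>\<^sub>v v"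
    using eigenvalue_root_char_poly[OF M] M unfolding eigenvalue_def eigenvector_def by auto
  define U where "U = {v \<in> carrier_vec n. M *\<^sub>v v = c \<cdot>\<^sub>v v}"
  interpret vec_space "TYPE(complex)" n .
  have "VectorSpace.subspace class_ring U (module_vec TYPE(complex) n)"
  proof -
    have "M *\<^sub>v (x + y) = c \<cdot>\<^sub>v (x + y)" if "x \<in> U" "y \<in> U" for x y
      using that M by (simp add: U_def mult_add_distrib_mat_vec[of _ n n] smult_add_distrib_vec[of _ n])
    moreover have "M *\<^sub>v (a \<cdot>\<^sub>v x) = c \<cdot>\<^sub>v (a \<cdot>\<^sub>v x)" if "x \<in> U" for x a
      using that M by (simp add: U_def mult_mat_vec[of _ n n] smult_smult_assoc mult.commute)
    ultimately show ?thesis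
      unfolding VectorSpace.subspace_def submodule_def using M
      by (auto simp: vec_vs vec_module module_vec_simps U_def)
  qed
  moreover have "\<rho> g *\<^sub>v x \<in> U" if "g \<in> carrier G" "x \<in> U" for g x
  proof -
    have x: "x \<in> carrier_vec n"
      using that by (simp add: U_def)
    have "M *\<^sub>v (\<rho> g *\<^sub>v x) = \<rho> g *\<^sub>v (M *\<^sub>v x)"
      using assoc_mult_mat_vec[OF M R(1)[OF that(1)] x] assoc_mult_mat_vec[OF R(1)[OF that(1)] M x]
        comm[OF that(1)] by simp
    then show ?thesis
      using that R(1)[OF that(1)] by (simp add: U_def mult_mat_vec[of _ n n])
  qed
  ultimately have "U = {0\<^sub>v n} \<or> U = carrier_vec n"
    using assms(1) by (auto simp: irreducible_representation_def)
  then have U: "U = carrier_vec n"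
    using v by (auto simp: U_def)
  have "M = c \<cdot>\<^sub>m 1\<^sub>m n"
  proof (rule eq_matI)
    fix i j assume "i < dim_row (c \<cdot>\<^sub>m 1\<^sub>m n)" "j < dim_col (c \<cdot>\<^sub>m 1\<^sub>m n)"
    then have ij: "i < n" "j < n" by auto
    have "M *\<^sub>v unit_vec n j = c \<cdot>\<^sub>v unit_vec n j"
      using U ij unfolding U_def by (metis (mono_tags, lifting) mem_Collect_eq unit_vec_carrier)
    then have "(M *\<^sub>v unit_vec n j) $ i = (c \<cdot>\<^sub>v unit_vec n j) $ i" by simp
    then show "M $$ (i, j) = (c \<cdot>\<^sub>m 1\<^sub>m n) $$ (i, j)"
      using ij M by auto
  qed (use M in auto)
  then show thesis
    by (rule that)
qed

text \<open>Averaging over conjugates produces a matrix that commutes with the representation, hence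
  a scalar; comparing traces determines it.\<close>

lemma schur_average:
  assumes "irreducible_representation G n \<rho>" and X: "X \<in> carrier_mat n n"
  shows "mat_sum n (\<lambda>x. \<rho> x * X * \<rho> (inv x)) (carrier G)
    = (of_nat (card (carrier G)) * mat_trace X / of_nat n) \<cdot>\<^sub>m 1\<^sub>m n" (is "?M = _")
proof -
  have r: "representation G n \<rho>" "0 < n"
    using assms(1) by (auto simp: irreducible_representation_def)
  note R = representationD[OF r(1)]
  have F: "\<rho> x * X * \<rho> (inv x) \<in> carrier_mat n n" if "x \<in> carrier G" for x
    using R(1)[OF that] R(1)[OF inv_closed[OF that]] X by simp
  have "\<rho> g * ?M = ?M * \<rho> g" if g: "g \<in> carrier G" for g
  proof -
    have "\<rho> g * ?M = mat_sum n (\<lambda>x. \<rho> (g \<otimes> x) * X * \<rho> (inv (g \<otimes> x)) * \<rho> g) (carrier G)"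
    proof (subst mult_mat_sum[OF R(1)[OF g] F], simp, rule mat_sum_cong)
      fix x assume x: "x \<in> carrier G"
      have "\<rho> (inv (g \<otimes> x)) * \<rho> g = \<rho> (inv x)"
        using x g by (simp add: inv_mult_group m_assoc flip: R(2))
      then show "\<rho> g * (\<rho> x * X * \<rho> (inv x)) = \<rho> (g \<otimes> x) * X * \<rho> (inv (g \<otimes> x)) * \<rho> g"
        using x g X R(1)[of x] R(1)[of g] R(1)[of "inv (g \<otimes> x)"] R(1)[of "inv x"]
        by (simp add: R(2) assoc_mult_mat[of _ n n _ n _ n])
    qed
    also have "\<dots> = mat_sum n (\<lambda>x. \<rho> x * X * \<rho> (inv x) * \<rho> g) (carrier G)"
      unfolding mat_sum_def
      by (rule cong_mat)
        (auto intro!: sum_left_translate[OF g, where f = "\<lambda>x. (\<rho> x * X * \<rho> (inv x) * \<rho> g) $$ _"])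
    also have "\<dots> = ?M * \<rho> g"
      by (rule mat_sum_mult[OF R(1)[OF g] F, symmetric])
    finally show ?thesis .
  qed
  then obtain c where c: "?M = c \<cdot>\<^sub>m 1\<^sub>m n"
    using schur_scalar[OF assms(1) mat_sum_carrier, of "\<lambda>x. \<rho> x * X * \<rho> (inv x)" "carrier G"] by blast
  have "mat_trace (\<rho> x * X * \<rho> (inv x)) = mat_trace X" if "x \<in> carrier G" for x
    using mat_trace_conjugate[OF R(1)[OF that] X R(1)[OF inv_closed[OF that]]]
      representation_inv(2)[OF r(1) that] by simp
  then have "mat_trace ?M = of_nat (card (carrier G)) * mat_trace X"
    by (subst mat_trace_mat_sum[OF F]) auto
  moreover have "mat_trace ?M = c * of_nat n"
    unfolding c by (simp add: mat_trace_smult[OF one_carrier_mat] mat_trace_one)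
  ultimately show ?thesis
    using c r(2) by (simp add: field_simps)
qed

text \<open>By \<open>schur_average\<close> the conjugates of \<open>\<rho> g\<close> add up to a
  scalar matrix; multiplying it by \<open>\<rho> k\<close> and taking the trace gives the
  identity.\<close>

lemma Irr_functional_equation:
  assumes "\<chi> \<in> Irr G" "g \<in> carrier G" "k \<in> carrier G"
  shows "(\<Sum>x\<in>carrier G. \<chi> (x \<otimes> g \<otimes> inv x \<otimes> k)) = of_nat (card (carrier G)) * \<chi> g * \<chi> k / \<chi> \<one>"
proof -
  obtain n \<rho> where r: "irreducible_representation G n \<rho>" "representation G n \<rho>" "0 < n"
    "\<forall>g\<in>carrier G. \<chi> g = mat_trace (\<rho> g)" "\<chi> \<one> = of_nat n"
    using Irr_obtain[OF assms(1)] by metis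
  note R = representationD[OF r(2)]
  have F: "\<rho> x * \<rho> g * \<rho> (inv x) \<in> carrier_mat n n" if "x \<in> carrier G" for x
    using R(1)[OF that] R(1)[OF assms(2)] R(1)[OF inv_closed[OF that]] by simp
  have "(\<Sum>x\<in>carrier G. \<chi> (x \<otimes> g \<otimes> inv x \<otimes> k))
      = (\<Sum>x\<in>carrier G. mat_trace (\<rho> x * \<rho> g * \<rho> (inv x) * \<rho> k))"
    using assms by (intro sum.cong) (auto simp: r(4) R(2))
  also have "\<dots> = mat_trace (mat_sum n (\<lambda>x. \<rho> x * \<rho> g * \<rho> (inv x) * \<rho> k) (carrier G))"
    by (rule mat_trace_mat_sum[symmetric]) (rule mult_carrier_mat[OF F R(1)[OF assms(3)]])
  also have "mat_sum n (\<lambda>x. \<rho> x * \<rho> g * \<rho> (inv x) * \<rho> k) (carrier G)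
      = mat_sum n (\<lambda>x. \<rho> x * \<rho> g * \<rho> (inv x)) (carrier G) * \<rho> k"
    by (rule mat_sum_mult[OF R(1)[OF assms(3)] F, symmetric])
  also have "\<dots> = (of_nat (card (carrier G)) * mat_trace (\<rho> g) / of_nat n) \<cdot>\<^sub>m \<rho> k"
    unfolding schur_average[OF r(1) R(1)[OF assms(2)]]
    using R(1)[OF assms(3)] by (simp add: mult_smult_assoc_mat[of _ n n _ n])
  finally show ?thesis
    using assms(2,3) by (simp add: mat_trace_smult[OF R(1)] r(4,5))
qed

text \<open>Orthogonality of matrix coefficients: the entry \<open>(j, k)\<close> of the average of
  the matrix unit \<open>E j k\<close> is a sum of products of diagonal coefficients, and it is
  nonzero only for \<open>j = k\<close>. Inner products are written with
  \<open>\<chi> (inv x)\<close>, which is \<open>cnj (\<chi> x)\<close> by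
  \<open>character_inv\<close>.\<close>

lemma Irr_norm:
  assumes "\<chi> \<in> Irr G"
  shows "(\<Sum>x\<in>carrier G. \<chi> x * \<chi> (inv x)) = of_nat (card (carrier G))"
proof -
  obtain n \<rho> where r: "irreducible_representation G n \<rho>" "representation G n \<rho>" "0 < n"
    "\<forall>g\<in>carrier G. \<chi> g = mat_trace (\<rho> g)" "\<chi> \<one> = of_nat n"
    using Irr_obtain[OF assms] by metis
  note R = representationD[OF r(2)]
  let ?N = "of_nat (card (carrier G)) :: complex"
  define E where "E j k = (mat n n (\<lambda>(a, b). if a = j \<and> b = k then 1 else 0) :: complex mat)" for j k
  have E: "E j k \<in> carrier_mat n n" for j k
    by (simp add: E_def)
  have trE: "mat_trace (E j k) = (if j = k then 1 else 0)" if "j < n" "k < n" for j k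
    using that by (auto simp: mat_trace_def E_def)
  have entry: "(A * E j k * B) $$ (j, k) = A $$ (j, j) * B $$ (k, k)"
    if "A \<in> carrier_mat n n" "B \<in> carrier_mat n n" "j < n" "k < n" for A B j k
  proof -
    have AE: "(A * E j k) $$ (j, b) = (if b = k then A $$ (j, j) else 0)" if "b < n" for b
    proof -
      note that = \<open>A \<in> carrier_mat n n\<close> \<open>b < n\<close>
      have "(A * E j k) $$ (j, b) = (\<Sum>a<n. A $$ (j, a) * (if a = j \<and> b = k then 1 else 0))"
        unfolding index_mult_mat_sum[OF that(1) E \<open>j < n\<close> \<open>b < n\<close>]
        using \<open>b < n\<close> by (intro sum.cong) (auto simp: E_def)
      also have "\<dots> = (\<Sum>a<n. if a = j then (if b = k then A $$ (j, j) else 0) else 0)"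
        by (intro sum.cong) auto
      finally show ?thesis
        using \<open>j < n\<close> by simp
    qed
    have "(A * E j k * B) $$ (j, k) = (\<Sum>b<n. (A * E j k) $$ (j, b) * B $$ (b, k))"
      using that by (intro index_mult_mat_sum[OF mult_carrier_mat[OF _ E]])
    also have "\<dots> = (\<Sum>b<n. if b = k then A $$ (j, j) * B $$ (k, k) else 0)"
      by (intro sum.cong) (auto simp: AE)
    finally show ?thesis
      using \<open>k < n\<close> by simp
  qed
  have avg: "(\<Sum>x\<in>carrier G. \<rho> x $$ (j, j) * \<rho> (inv x) $$ (k, k)) = (if j = k then ?N / of_nat n else 0)"
    if "j < n" "k < n" for j k
  proof -
    have "(\<Sum>x\<in>carrier G. \<rho> x $$ (j, j) * \<rho> (inv x) $$ (k, k))
        = (\<Sum>x\<in>carrier G. (\<rho> x * E j k * \<rho> (inv x)) $$ (j, k))"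
      using R(1) that by (intro sum.cong) (auto simp: entry)
    also have "\<dots> = mat_sum n (\<lambda>x. \<rho> x * E j k * \<rho> (inv x)) (carrier G) $$ (j, k)"
      using that by (simp add: mat_sum_def)
    also have "\<dots> = (if j = k then ?N / of_nat n else 0)"
      unfolding schur_average[OF r(1) E] using that by (simp add: trE)
    finally show ?thesis .
  qed
  have "(\<Sum>x\<in>carrier G. \<chi> x * \<chi> (inv x))
      = (\<Sum>x\<in>carrier G. \<Sum>j<n. \<Sum>k<n. \<rho> x $$ (j, j) * \<rho> (inv x) $$ (k, k))"
    by (intro sum.cong) (auto simp: r(4) mat_trace_def carrier_matD[OF R(1)] sum_product)
  also have "\<dots> = (\<Sum>j<n. \<Sum>x\<in>carrier G. \<Sum>k<n. \<rho> x $$ (j, j) * \<rho> (inv x) $$ (k, k))"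
    by (rule sum.swap)
  also have "\<dots> = (\<Sum>j<n. \<Sum>k<n. \<Sum>x\<in>carrier G. \<rho> x $$ (j, j) * \<rho> (inv x) $$ (k, k))"
    by (intro sum.cong refl sum.swap)
  also have "\<dots> = (\<Sum>j<n. \<Sum>k<n. if j = k then ?N / of_nat n else 0)"
    by (intro sum.cong) (auto simp: avg)
  also have "\<dots> = ?N"
    using r(3) by simp
  finally show ?thesis .
qed

lemma Irr_degree:
  assumes "\<chi> \<in> Irr G"
  obtains n where "0 < n" "\<chi> \<one> = of_nat n"
  using Irr_obtain[OF assms] by metis

end

lemma sum_lessThan_add:
  fixes f :: "nat \<Rightarrow> 'a::comm_monoid_add"
  shows "(\<Sum>k<d + m. f k) = (\<Sum>k<d. f k) + (\<Sum>k<m. f (d + k))"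
  by (induction m) (simp_all add: add.assoc)

section \<open>Linear characters, class functions and multiplicities\<close>

context finite_group
begin

text \<open>Serves for restriction to a subgroup, for the factors of a direct power and for
  transport along an isomorphism.\<close>

lemma character_pullback:
  assumes "finite_group H" "\<iota> \<in> hom H G" "\<chi> \<in> characters G"
  shows "(\<lambda>h\<in>carrier H. \<chi> (\<iota> h)) \<in> characters H"
proof -
  interpret H: finite_group H by fact
  obtain n \<rho> where r: "representation G n \<rho>" "\<forall>g\<in>carrier G. \<chi> g = mat_trace (\<rho> g)"
    using characters_obtain[OF assms(3)] by metis
  note R = representationD[OF r(1)]
  have \<iota>: "\<iota> h \<in> carrier G" if "h \<in> carrier H" for h
    using assms(2) that by (auto simp: hom_def)
  have "representation H n (\<lambda>h. \<rho> (\<iota> h))"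
    using \<iota> R hom_one[OF assms(2) H.group_axioms group_axioms] hom_mult[OF assms(2)]
    by (intro H.representationI) auto
  moreover have "(\<lambda>h\<in>carrier H. \<chi> (\<iota> h)) = afforded_character H (\<lambda>h. \<rho> (\<iota> h))"
    using \<iota> r(2) by (auto simp: afforded_character_def)
  ultimately show ?thesis
    unfolding characters_def by blast
qed

lemma linear_charactersI:
  assumes "\<mu> \<in> extensional (carrier G)" "\<mu> \<one> = 1"
    and "\<And>g h. g \<in> carrier G \<Longrightarrow> h \<in> carrier G \<Longrightarrow> \<mu> (g \<otimes> h) = \<mu> g * \<mu> h"
  shows "\<mu> \<in> linear_characters G"
proof -
  let ?\<rho> = "\<lambda>g. mat 1 1 (\<lambda>_. \<mu> g)"
  have "representation G 1 ?\<rho>"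
    by (intro representationI eq_matI) (auto simp: assms scalar_prod_def)
  moreover have "\<mu> = afforded_character G ?\<rho>"
    using assms(1) by (auto simp: afforded_character_def mat_trace_def extensional_def)
  ultimately show ?thesis
    using assms(2) by (auto simp: linear_characters_def characters_def)
qed

lemma linear_charactersD:
  assumes "\<mu> \<in> linear_characters G"
  shows "\<mu> \<one> = 1" and "\<mu> \<in> characters G"
    and "g \<in> carrier G \<Longrightarrow> h \<in> carrier G \<Longrightarrow> \<mu> (g \<otimes> h) = \<mu> g * \<mu> h"
    and "g \<in> carrier G \<Longrightarrow> \<mu> g * \<mu> (inv g) = 1"
proof -
  show 1: "\<mu> \<one> = 1" "\<mu> \<in> characters G"
    using assms by (auto simp: linear_characters_def)
  obtain n \<rho> where r: "representation G n \<rho>" "\<forall>g\<in>carrier G. \<mu> g = mat_trace (\<rho> g)" "\<mu> \<one> = of_nat n"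
    using characters_obtain[OF 1(2)] by metis
  have n: "n = 1"
    using r(3) 1(1) by simp
  note R = representationD[OF r(1)[unfolded n]]
  have tr: "mat_trace A = A $$ (0, 0)" if "A \<in> carrier_mat 1 1" for A
    using that by (auto simp: mat_trace_def)
  show mult: "\<mu> (g \<otimes> h) = \<mu> g * \<mu> h" if "g \<in> carrier G" "h \<in> carrier G" for g h
    using that R(1)[OF that(1)] R(1)[OF that(2)]
    by (simp add: r(2) R(2) tr index_mult_mat_sum[of _ 1 1 _ 1] del: index_mult_mat(1))
  show "g \<in> carrier G \<Longrightarrow> \<mu> g * \<mu> (inv g) = 1"
    using mult[of g "inv g"] 1(1) by simp
qed

lemma character_mult_linear:
  assumes "\<chi> \<in> characters G" "\<mu> \<in> linear_characters G"
  shows "(\<lambda>g\<in>carrier G. \<chi> g * \<mu> g) \<in> characters G"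
proof -
  obtain n \<rho> where r: "representation G n \<rho>" "\<forall>g\<in>carrier G. \<chi> g = mat_trace (\<rho> g)"
    using characters_obtain[OF assms(1)] by metis
  note R = representationD[OF r(1)] and L = linear_charactersD[OF assms(2)]
  have "representation G n (\<lambda>g. \<mu> g \<cdot>\<^sub>m \<rho> g)"
    using R by (intro representationI) (auto simp: L smult_mult_smult_mat[OF R(1) R(1)] R(2))
  moreover have "(\<lambda>g\<in>carrier G. \<chi> g * \<mu> g) = afforded_character G (\<lambda>g. \<mu> g \<cdot>\<^sub>m \<rho> g)"
    using r(2) by (auto simp: afforded_character_def mat_trace_smult[OF R(1)] mult.commute)
  ultimately show ?thesis
    unfolding characters_def by blast
qed

lemma sum_conj: "x \<in> carrier G \<Longrightarrow> (\<Sum>y\<in>carrier G. f (x \<otimes> y \<otimes> inv x)) = (\<Sum>y\<in>carrier G. f y)"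
  using sum_left_translate[of x "\<lambda>z. f (z \<otimes> inv x)"] sum_right_translate[of "inv x" f] by simp

text \<open>The element of the group algebra with coefficients \<open>c\<close> is central and acts
  as a scalar. In terms of characters: average over all conjugates of \<open>y\<close> and apply
  \<open>Irr_functional_equation\<close>.\<close>

lemma Irr_sum_class_function:
  assumes \<chi>: "\<chi> \<in> Irr G" and g: "g \<in> carrier G"
    and c: "\<And>x y. x \<in> carrier G \<Longrightarrow> y \<in> carrier G \<Longrightarrow> c (x \<otimes> y \<otimes> inv x) = c y"
  shows "(\<Sum>y\<in>carrier G. c y * \<chi> (g \<otimes> y)) * \<chi> \<one> = (\<Sum>y\<in>carrier G. c y * \<chi> y) * \<chi> g"
proof -
  let ?N = "of_nat (card (carrier G)) :: complex"
  have ch: "\<chi> \<in> characters G"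
    using Irr_subset \<chi> by blast
  have nz: "\<chi> \<one> \<noteq> 0"
    using Irr_degree[OF \<chi>] by (metis of_nat_eq_0_iff less_irrefl)
  have "?N * (\<Sum>y\<in>carrier G. c y * \<chi> (g \<otimes> y))
      = (\<Sum>x\<in>carrier G. \<Sum>y\<in>carrier G. c (x \<otimes> y \<otimes> inv x) * \<chi> (g \<otimes> (x \<otimes> y \<otimes> inv x)))"
    by (simp add: sum_conj[where f = "\<lambda>y. c y * \<chi> (g \<otimes> y)"])
  also have "\<dots> = (\<Sum>x\<in>carrier G. \<Sum>y\<in>carrier G. c y * \<chi> (x \<otimes> y \<otimes> inv x \<otimes> g))"
    using g by (intro sum.cong refl) (simp add: c character_commute[OF ch g])
  also have "\<dots> = (\<Sum>y\<in>carrier G. c y * (\<Sum>x\<in>carrier G. \<chi> (x \<otimes> y \<otimes> inv x \<otimes> g)))"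
    by (subst sum.swap) (simp add: sum_distrib_left)
  also have "\<dots> = (\<Sum>y\<in>carrier G. c y * (?N * \<chi> y * \<chi> g / \<chi> \<one>))"
    using g by (intro sum.cong refl) (simp add: Irr_functional_equation[OF \<chi>])
  also have "\<dots> = ?N * ((\<Sum>y\<in>carrier G. c y * \<chi> y) * \<chi> g / \<chi> \<one>)"
    by (simp add: sum_distrib_left sum_distrib_right sum_divide_distrib mult_ac)
  finally show ?thesis
    using nz order_pos by (simp add: field_simps)
qed

text \<open>The function \<open>f\<close> below lists the coefficients of the central idempotent
  attached to \<open>\<theta>\<close>. Its trace in a representation affording \<open>\<chi>\<close>
  is the number \<open>m\<close>: the multiplicity of \<open>\<theta>\<close> in
  \<open>\<chi>\<close> times the degree of \<open>\<theta>\<close>, hence the multiplicity itself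
  when \<open>\<theta>\<close> is linear.\<close>

lemma character_inner_Irr_Nats:
  assumes "\<chi> \<in> characters G" "\<theta> \<in> Irr G"
  obtains m :: nat where
    "(\<Sum>g\<in>carrier G. \<chi> g * \<theta> (inv g)) * \<theta> \<one> = of_nat (m * card (carrier G))"
proof -
  let ?N = "of_nat (card (carrier G)) :: complex"
  have ch: "\<theta> \<in> characters G"
    using Irr_subset assms(2) by blast
  define f where "f h = \<theta> \<one> / ?N * \<theta> (inv h)" for h
  have "(\<Sum>k\<in>carrier G. f k * f (inv k \<otimes> h)) = f h" if h: "h \<in> carrier G" for h
  proof -
    have "(\<Sum>y\<in>carrier G. \<theta> (inv y) * \<theta> (inv h \<otimes> y)) * \<theta> \<one>
        = (\<Sum>y\<in>carrier G. \<theta> (inv y) * \<theta> y) * \<theta> (inv h)"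
    proof (rule Irr_sum_class_function[OF assms(2)])
      fix x y assume "x \<in> carrier G" "y \<in> carrier G"
      then show "\<theta> (inv (x \<otimes> y \<otimes> inv x)) = \<theta> (inv y)"
        using character_conj[OF ch, of x "inv y"] by (simp add: inv_mult_group m_assoc)
    qed (use h in simp)
    also have "(\<Sum>y\<in>carrier G. \<theta> (inv y) * \<theta> y) = ?N"
      using Irr_norm[OF assms(2)] by (simp add: mult.commute)
    finally have *: "(\<Sum>y\<in>carrier G. \<theta> (inv y) * \<theta> (inv h \<otimes> y)) * \<theta> \<one> = ?N * \<theta> (inv h)" .
    have "(\<Sum>k\<in>carrier G. f k * f (inv k \<otimes> h))
        = (\<Sum>k\<in>carrier G. (\<theta> \<one> / ?N)\<^sup>2 * (\<theta> (inv k) * \<theta> (inv h \<otimes> k)))"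
      using h by (intro sum.cong) (auto simp: f_def inv_mult_group power2_eq_square)
    also have "\<dots> = \<theta> \<one> / ?N\<^sup>2 * ((\<Sum>y\<in>carrier G. \<theta> (inv y) * \<theta> (inv h \<otimes> y)) * \<theta> \<one>)"
      by (simp add: sum_distrib_left sum_distrib_right power2_eq_square sum_divide_distrib mult_ac)
    also have "\<dots> = f h"
      unfolding * using order_pos by (simp add: f_def power2_eq_square)
    finally show ?thesis .
  qed
  then have "(\<Sum>h\<in>carrier G. f h * \<chi> h) \<in> \<nat>"
    by (rule convolution_idempotent_Nats[OF assms(1)])
  then obtain m where "(\<Sum>h\<in>carrier G. f h * \<chi> h) = of_nat m"
    by (auto simp: Nats_def)
  moreover have "(\<Sum>h\<in>carrier G. f h * \<chi> h) = (\<Sum>g\<in>carrier G. \<chi> g * \<theta> (inv g)) * \<theta> \<one> / ?N"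
    by (simp add: f_def sum_distrib_left sum_distrib_right sum_divide_distrib mult_ac)
  ultimately have "(\<Sum>g\<in>carrier G. \<chi> g * \<theta> (inv g)) * \<theta> \<one> = of_nat (m * card (carrier G))"
    using order_pos by (simp add: field_simps)
  then show thesis
    by (rule that)
qed

text \<open>Dividing by the degree of \<open>\<theta>\<close> keeps the sign, which is what the norm
  estimates for sums of irreducible characters use.\<close>

lemma character_inner_Irr_nonneg:
  assumes "\<chi> \<in> characters G" "\<theta> \<in> Irr G"
  shows "0 \<le> Re (\<Sum>g\<in>carrier G. \<chi> g * \<theta> (inv g))"
proof -
  obtain n where n: "0 < n" "\<theta> \<one> = of_nat n"
    using Irr_degree[OF assms(2)] .
  obtain m :: nat where "(\<Sum>g\<in>carrier G. \<chi> g * \<theta> (inv g)) * \<theta> \<one> = of_nat (m * card (carrier G))"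
    using character_inner_Irr_Nats[OF assms] .
  then have "(\<Sum>g\<in>carrier G. \<chi> g * \<theta> (inv g)) = of_real (real (m * card (carrier G)) / real n)"
    using n by (simp add: field_simps)
  then have "Re (\<Sum>g\<in>carrier G. \<chi> g * \<theta> (inv g)) = real (m * card (carrier G)) / real n"
    by (simp only: Re_complex_of_real)
  then show ?thesis
    by simp
qed

text \<open>In a basis adapted to an invariant subspace all matrices are block upper triangular. The
  two diagonal blocks are again representations, and their traces add up to the original
  trace.\<close>

lemma representation_split:
  assumes r: "representation G n \<rho>" "0 < n" "\<not> irreducible_representation G n \<rho>"
  obtains d \<rho>1 \<rho>2 where "0 < d" "d < n" "representation G d \<rho>1" "representation G (n - d) \<rho>2"
    "\<forall>g\<in>carrier G. mat_trace (\<rho> g) = mat_trace (\<rho>1 g) + mat_trace (\<rho>2 g)"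
proof -
  note R = representationD[OF r(1)]
  obtain U where U: "VectorSpace.subspace class_ring U (module_vec TYPE(complex) n)"
    "\<And>g v. g \<in> carrier G \<Longrightarrow> v \<in> U \<Longrightarrow> \<rho> g *\<^sub>v v \<in> U" "U \<noteq> {0\<^sub>v n}" "U \<noteq> carrier_vec n"
    using r unfolding irreducible_representation_def by blast
  have Uc: "U \<subseteq> carrier_vec n" "0\<^sub>v n \<in> U"
    using U(1) by (auto simp: VectorSpace.subspace_def submodule_def module_vec_simps)
  obtain d S S' where S: "d \<le> n" "S \<in> carrier_mat n n" "S' \<in> carrier_mat n n"
    "S * S' = 1\<^sub>m n" "S' * S = 1\<^sub>m n" "\<And>j. j < d \<Longrightarrow> col S j \<in> U"
    "\<And>v i. v \<in> U \<Longrightarrow> d \<le> i \<Longrightarrow> i < n \<Longrightarrow> (S' *\<^sub>v v) $ i = 0" "d = n \<Longrightarrow> U = carrier_vec n"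
    using subspace_adapted_basis[OF U(1)] by blast
  \<comment> \<open>For \<open>d = 0\<close> all coordinates of every vector of \<open>U\<close>
    would vanish, so \<open>U\<close> would be zero.\<close>
  have "0 < d"
  proof (rule ccontr)
    assume "\<not> 0 < d"
    have "v = 0\<^sub>v n" if v: "v \<in> U" for v
    proof -
      have vc: "v \<in> carrier_vec n"
        using Uc v by blast
      have "S' *\<^sub>v v = 0\<^sub>v n"
        using S(3) S(7)[OF v] \<open>\<not> 0 < d\<close> by (intro eq_vecI) (auto simp del: index_mult_mat_vec)
      then have "(S * S') *\<^sub>v v = 0\<^sub>v n"
        using assoc_mult_mat_vec[OF S(2,3) vc] S(2) by (simp add: mult_mat_vec_def scalar_prod_def zero_vec_def)
      then show ?thesis
        using S(4) vc by simp
    qed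
    then show False
      using U(3) Uc(2) by blast
  qed
  have "d < n"
    using S(1,8) U(4) by (cases "d = n") auto
  define \<tau> where "\<tau> g = S' * (\<rho> g * S)" for g
  have \<tau>: "\<tau> g \<in> carrier_mat n n" if "g \<in> carrier G" for g
    using R(1)[OF that] S by (simp add: \<tau>_def)
  have \<tau>_mult: "\<tau> (g \<otimes> h) = \<tau> g * \<tau> h" if g: "g \<in> carrier G" and h: "h \<in> carrier G" for g h
  proof -
    note C = R(1)[OF g] R(1)[OF h] S(2,3)
    have "\<tau> g * \<tau> h = S' * (\<rho> g * ((S * S') * (\<rho> h * S)))"
      unfolding \<tau>_def using C by (simp add: assoc_mult_mat[of _ n n _ n _ n])
    also have "\<dots> = \<tau> (g \<otimes> h)"
      unfolding \<tau>_def S(4) R(2)[OF g h] using C by (simp add: assoc_mult_mat[of _ n n _ n _ n])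
    finally show ?thesis by simp
  qed
  have \<tau>_one: "\<tau> \<one> = 1\<^sub>m n"
    unfolding \<tau>_def R(3) using S by simp
  \<comment> \<open>The lower left block: column \<open>j\<close> of \<open>S\<close> lies in
    \<open>U\<close>, so does its image under \<open>\<rho> g\<close>, and the coordinates of that
    image from \<open>d\<close> on are zero.\<close>
  have \<tau>_zero: "\<tau> g $$ (i, j) = 0" if g: "g \<in> carrier G" and ij: "d \<le> i" "i < n" "j < d" for g i j
  proof -
    have jn: "j < n"
      using ij S(1) by simp
    have "\<tau> g $$ (i, j) = row S' i \<bullet> col (\<rho> g * S) j"
      unfolding \<tau>_def using R(1)[OF g] S(2,3) ij jn by (intro index_mult_mat(1)) auto
    also have "col (\<rho> g * S) j = \<rho> g *\<^sub>v col S j"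
      by (rule col_mult2[OF R(1)[OF g] S(2) jn])
    also have "row S' i \<bullet> (\<rho> g *\<^sub>v col S j) = (S' *\<^sub>v (\<rho> g *\<^sub>v col S j)) $ i"
      using S(3) ij by (intro index_mult_mat_vec[symmetric]) auto
    also have "\<dots> = 0"
      using S(6,7) U(2) g ij by blast
    finally show ?thesis .
  qed
  have \<tau>_tr: "mat_trace (\<tau> g) = mat_trace (\<rho> g)" if g: "g \<in> carrier G" for g
  proof -
    have "\<tau> g = S' * \<rho> g * S"
      unfolding \<tau>_def using R(1)[OF g] S(2,3) by (simp add: assoc_mult_mat[of _ n n _ n _ n])
    then show ?thesis
      using mat_trace_conjugate[OF S(3) R(1)[OF g] S(2,4)] by simp
  qed
  define \<rho>1 where "\<rho>1 g = mat d d (\<lambda>(i, j). \<tau> g $$ (i, j))" for g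
  define \<rho>2 where "\<rho>2 g = mat (n - d) (n - d) (\<lambda>(i, j). \<tau> g $$ (d + i, d + j))" for g
  have entry: "\<tau> (g \<otimes> h) $$ (i, j) = (\<Sum>k<d. \<tau> g $$ (i, k) * \<tau> h $$ (k, j))
      + (\<Sum>k<n - d. \<tau> g $$ (i, d + k) * \<tau> h $$ (d + k, j))"
    if "g \<in> carrier G" "h \<in> carrier G" "i < n" "j < n" for g h i j
  proof -
    have "\<tau> (g \<otimes> h) $$ (i, j) = (\<Sum>k<d + (n - d). \<tau> g $$ (i, k) * \<tau> h $$ (k, j))"
      unfolding \<tau>_mult[OF that(1,2)] using index_mult_mat_sum[OF \<tau> \<tau>, OF that] \<open>d < n\<close> by simp
    then show ?thesis
      by (simp add: sum_lessThan_add)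
  qed
  have rep1: "representation G d \<rho>1"
  proof (rule representationI)
    fix g h assume gh: "g \<in> carrier G" "h \<in> carrier G"
    show "\<rho>1 (g \<otimes> h) = \<rho>1 g * \<rho>1 h"
    proof (rule eq_matI)
      fix i j assume "i < dim_row (\<rho>1 g * \<rho>1 h)" "j < dim_col (\<rho>1 g * \<rho>1 h)"
      then have ij: "i < d" "j < d"
        by (simp_all add: \<rho>1_def)
      then have "\<rho>1 (g \<otimes> h) $$ (i, j) = (\<Sum>k<d. \<tau> g $$ (i, k) * \<tau> h $$ (k, j))"
        using entry[OF gh, of i j] \<open>d < n\<close> \<tau>_zero[OF gh(2)] by (simp add: \<rho>1_def)
      also have "\<dots> = (\<rho>1 g * \<rho>1 h) $$ (i, j)"
        using ij by (subst index_mult_mat_sum[of _ d d _ d]) (auto simp: \<rho>1_def)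
      finally show "\<rho>1 (g \<otimes> h) $$ (i, j) = (\<rho>1 g * \<rho>1 h) $$ (i, j)" .
    qed (auto simp: \<rho>1_def)
  qed (use \<open>d < n\<close> in \<open>auto simp: \<rho>1_def \<tau>_one intro!: eq_matI\<close>)
  have rep2: "representation G (n - d) \<rho>2"
  proof (rule representationI)
    fix g h assume gh: "g \<in> carrier G" "h \<in> carrier G"
    show "\<rho>2 (g \<otimes> h) = \<rho>2 g * \<rho>2 h"
    proof (rule eq_matI)
      fix i j assume "i < dim_row (\<rho>2 g * \<rho>2 h)" "j < dim_col (\<rho>2 g * \<rho>2 h)"
      then have ij: "i < n - d" "j < n - d"
        by (simp_all add: \<rho>2_def)
      then have "\<rho>2 (g \<otimes> h) $$ (i, j) = (\<Sum>k<n - d. \<tau> g $$ (d + i, d + k) * \<tau> h $$ (d + k, d + j))"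
        using entry[OF gh, of "d + i" "d + j"] \<open>d < n\<close> \<tau>_zero[OF gh(1)] by (simp add: \<rho>2_def)
      also have "\<dots> = (\<rho>2 g * \<rho>2 h) $$ (i, j)"
        using ij by (subst index_mult_mat_sum[of _ "n - d" "n - d" _ "n - d"]) (auto simp: \<rho>2_def)
      finally show "\<rho>2 (g \<otimes> h) $$ (i, j) = (\<rho>2 g * \<rho>2 h) $$ (i, j)" .
    qed (auto simp: \<rho>2_def)
  qed (use \<open>d < n\<close> in \<open>auto simp: \<rho>2_def \<tau>_one intro!: eq_matI\<close>)
  have "mat_trace (\<rho> g) = mat_trace (\<rho>1 g) + mat_trace (\<rho>2 g)" if g: "g \<in> carrier G" for g
  proof -
    have "mat_trace (\<rho> g) = (\<Sum>i<d + (n - d). \<tau> g $$ (i, i))"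
      using \<tau>[OF g] \<open>d < n\<close> \<tau>_tr[OF g] by (simp add: mat_trace_def)
    then show ?thesis
      by (simp add: mat_trace_def \<rho>1_def \<rho>2_def sum_lessThan_add)
  qed
  then show thesis
    using that[OF \<open>0 < d\<close> \<open>d < n\<close> rep1 rep2] by blast
qed

end

section \<open>Decomposition into irreducible characters\<close>

context finite_group
begin

text \<open>The constituents form a list, so that multiplicities are recorded; degree 0 corresponds
  to the empty list.\<close>

lemma representation_decomposition:
  assumes "representation G n \<rho>"
  shows "\<exists>\<theta>s. set \<theta>s \<subseteq> Irr G \<and> (\<forall>g\<in>carrier G. mat_trace (\<rho> g) = (\<Sum>\<theta>\<leftarrow>\<theta>s. \<theta> g))"
  using assms
proof (induction n arbitrary: \<rho> rule: less_induct)
  case (less n)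
  consider "n = 0" | "irreducible_representation G n \<rho>" | "0 < n" "\<not> irreducible_representation G n \<rho>"
    by blast
  then show ?case
  proof cases
    case 1
    then have "\<forall>g\<in>carrier G. mat_trace (\<rho> g) = (\<Sum>\<theta>\<leftarrow>[]. \<theta> g)"
      using carrier_matD(1)[OF representationD(1)[OF less.prems]] by (simp add: mat_trace_def)
    then show ?thesis
      by (intro exI[of _ "[]"]) simp
  next
    case 2
    then show ?thesis
      by (intro exI[of _ "[afforded_character G \<rho>]"]) (auto simp: Irr_def afforded_character_def)
  next
    case 3
    obtain d \<rho>1 \<rho>2 where *: "0 < d" "d < n" "representation G d \<rho>1" "representation G (n - d) \<rho>2"
      "\<forall>g\<in>carrier G. mat_trace (\<rho> g) = mat_trace (\<rho>1 g) + mat_trace (\<rho>2 g)"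
      using representation_split[OF less.prems 3] .
    obtain \<theta>s \<theta>s' where "set \<theta>s \<subseteq> Irr G" "\<forall>g\<in>carrier G. mat_trace (\<rho>1 g) = (\<Sum>\<theta>\<leftarrow>\<theta>s. \<theta> g)"
      "set \<theta>s' \<subseteq> Irr G" "\<forall>g\<in>carrier G. mat_trace (\<rho>2 g) = (\<Sum>\<theta>\<leftarrow>\<theta>s'. \<theta> g)"
      using less.IH[OF *(2,3)] less.IH[OF _ *(4)] *(1,2) by fastforce
    then show ?thesis
      using *(5) by (intro exI[of _ "\<theta>s @ \<theta>s'"]) auto
  qed
qed

lemma character_decomposition:
  assumes "\<chi> \<in> characters G"
  obtains \<theta>s where "set \<theta>s \<subseteq> Irr G" "\<forall>g\<in>carrier G. \<chi> g = (\<Sum>\<theta>\<leftarrow>\<theta>s. \<theta> g)"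
proof -
  obtain n \<rho> where "representation G n \<rho>" "\<forall>g\<in>carrier G. \<chi> g = mat_trace (\<rho> g)"
    using characters_obtain[OF assms] by metis
  then show thesis
    using representation_decomposition that by metis
qed

lemma Irr_list_inner_nonneg:
  assumes "set \<theta>s \<subseteq> Irr G" "\<chi> \<in> Irr G"
  shows "0 \<le> Re (\<Sum>g\<in>carrier G. (\<Sum>\<theta>\<leftarrow>\<theta>s. \<theta> g) * \<chi> (inv g))"
  using assms(1)
proof (induction \<theta>s)
  case (Cons \<theta> \<theta>s)
  then have "0 \<le> Re (\<Sum>g\<in>carrier G. \<theta> g * \<chi> (inv g))"
    using character_inner_Irr_nonneg[OF _ assms(2)] Irr_subset by auto
  then show ?case
    using Cons by (simp add: ring_distribs sum.distrib)
qed simp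

text \<open>Each constituent contributes the group order through its own norm, and all cross terms
  have nonnegative real part.\<close>

lemma Irr_list_norm:
  assumes "set \<theta>s \<subseteq> Irr G"
  shows "real (length \<theta>s * card (carrier G))
    \<le> Re (\<Sum>g\<in>carrier G. (\<Sum>\<theta>\<leftarrow>\<theta>s. \<theta> g) * (\<Sum>\<theta>\<leftarrow>\<theta>s. \<theta> (inv g)))"
  using assms
proof (induction \<theta>s)
  case (Cons \<theta> \<theta>s)
  let ?S = "\<lambda>g. (\<Sum>\<theta>\<leftarrow>\<theta>s. \<theta> g)"
  have \<theta>: "\<theta> \<in> Irr G" "set \<theta>s \<subseteq> Irr G"
    using Cons.prems by auto
  have "(\<Sum>g\<in>carrier G. \<theta> g * ?S (inv g)) = (\<Sum>g\<in>carrier G. \<theta> (inv g) * ?S (inv (inv g)))"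
    by (rule sum_inv[where f = "\<lambda>g. \<theta> g * ?S (inv g)", symmetric])
  also have "\<dots> = (\<Sum>g\<in>carrier G. ?S g * \<theta> (inv g))"
    by (intro sum.cong) auto
  finally have "0 \<le> Re (\<Sum>g\<in>carrier G. \<theta> g * ?S (inv g))"
    using Irr_list_inner_nonneg[OF \<theta>(2,1)] by simp
  moreover have "Re (\<Sum>g\<in>carrier G. \<theta> g * \<theta> (inv g)) = real (card (carrier G))"
    unfolding Irr_norm[OF \<theta>(1)] by simp
  moreover have "(\<Sum>g\<in>carrier G. (\<Sum>\<theta>\<leftarrow>\<theta> # \<theta>s. \<theta> g) * (\<Sum>\<theta>\<leftarrow>\<theta> # \<theta>s. \<theta> (inv g)))
      = (\<Sum>g\<in>carrier G. \<theta> g * \<theta> (inv g)) + (\<Sum>g\<in>carrier G. \<theta> g * ?S (inv g))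
      + (\<Sum>g\<in>carrier G. ?S g * \<theta> (inv g)) + (\<Sum>g\<in>carrier G. ?S g * ?S (inv g))"
    by (simp add: ring_distribs sum.distrib)
  moreover have "real (length (\<theta> # \<theta>s) * card (carrier G))
      = real (card (carrier G)) + real (length \<theta>s * card (carrier G))"
    by (simp add: ring_distribs)
  ultimately show ?case
    using Cons.IH[OF \<theta>(2)] Irr_list_inner_nonneg[OF \<theta>(2,1)] by (simp only: plus_complex.sel)
qed simp

text \<open>By \<open>Irr_list_norm\<close> a decomposition of \<open>\<chi>\<close> has at most one
  member, and it is not empty because the norm is not 0. This is the criterion by which every later
  irreducibility claim is verified.\<close>

lemma character_norm_one_Irr:
  assumes "\<chi> \<in> characters G"
    and "(\<Sum>g\<in>carrier G. \<chi> g * \<chi> (inv g)) = of_nat (card (carrier G))"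
  shows "\<chi> \<in> Irr G"
proof -
  obtain \<theta>s where \<theta>s: "set \<theta>s \<subseteq> Irr G" "\<forall>g\<in>carrier G. \<chi> g = (\<Sum>\<theta>\<leftarrow>\<theta>s. \<theta> g)"
    using character_decomposition[OF assms(1)] .
  have "(\<Sum>g\<in>carrier G. (\<Sum>\<theta>\<leftarrow>\<theta>s. \<theta> g) * (\<Sum>\<theta>\<leftarrow>\<theta>s. \<theta> (inv g))) = of_nat (card (carrier G))"
    using \<theta>s(2) assms(2) by simp
  then have "real (length \<theta>s * card (carrier G)) \<le> real (card (carrier G))"
    using Irr_list_norm[OF \<theta>s(1)] by simp
  then have "length \<theta>s \<le> 1"
    using order_pos by (simp flip: of_nat_mult)
  moreover have "\<theta>s \<noteq> []"
    using assms(2) \<theta>s(2) order_pos by auto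
  ultimately obtain \<theta> where \<theta>: "\<theta>s = [\<theta>]"
    by (cases \<theta>s) auto
  then have "\<theta> \<in> Irr G" "\<forall>g\<in>carrier G. \<chi> g = \<theta> g"
    using \<theta>s by auto
  moreover have "\<theta> \<in> extensional (carrier G)"
    using \<open>\<theta> \<in> Irr G\<close> Irr_subset character_extensional by blast
  ultimately have "\<chi> = \<theta>"
    using character_extensional[OF assms(1)] by (intro extensionalityI[of _ "carrier G"]) auto
  with \<open>\<theta> \<in> Irr G\<close> show ?thesis
    by simp
qed

text \<open>The head of a decomposition will do: its own norm is positive and the other terms cannot
  cancel it.\<close>

lemma exists_Irr_constituent:
  assumes "\<chi> \<in> characters G" "\<chi> \<one> \<noteq> 0"
  obtains \<theta> where "\<theta> \<in> Irr G" "(\<Sum>g\<in>carrier G. \<chi> g * \<theta> (inv g)) \<noteq> 0"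
proof -
  obtain \<theta>s where \<theta>s: "set \<theta>s \<subseteq> Irr G" "\<forall>g\<in>carrier G. \<chi> g = (\<Sum>\<theta>\<leftarrow>\<theta>s. \<theta> g)"
    using character_decomposition[OF assms(1)] .
  then obtain \<theta> \<theta>s' where eq: "\<theta>s = \<theta> # \<theta>s'"
    using assms(2) by (cases \<theta>s) auto
  then have \<theta>: "\<theta> \<in> Irr G" "set \<theta>s' \<subseteq> Irr G"
    using \<theta>s by auto
  have "(\<Sum>g\<in>carrier G. \<chi> g * \<theta> (inv g)) = (\<Sum>g\<in>carrier G. \<theta> g * \<theta> (inv g))
      + (\<Sum>g\<in>carrier G. (\<Sum>\<theta>\<leftarrow>\<theta>s'. \<theta> g) * \<theta> (inv g))"
    using \<theta>s(2) by (simp add: eq ring_distribs sum.distrib)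
  moreover have "0 \<le> Re (\<Sum>g\<in>carrier G. (\<Sum>\<theta>\<leftarrow>\<theta>s'. \<theta> g) * \<theta> (inv g))"
    using Irr_list_inner_nonneg \<theta> by blast
  ultimately have "real (card (carrier G)) \<le> Re (\<Sum>g\<in>carrier G. \<chi> g * \<theta> (inv g))"
    by (simp add: Irr_norm[OF \<theta>(1)])
  then have "(\<Sum>g\<in>carrier G. \<chi> g * \<theta> (inv g)) \<noteq> 0"
    using order_pos by (metis leD of_nat_0_less_iff zero_complex.sel(1))
  with \<theta>(1) show thesis
    by (rule that)
qed

lemma linear_characters_Irr: "\<mu> \<in> linear_characters G \<Longrightarrow> \<mu> \<in> Irr G"
  using linear_charactersD by (intro character_norm_one_Irr) auto

text \<open>The convolution of two irreducible characters is a multiple of each of them.\<close>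

lemma Irr_proportional:
  assumes \<chi>: "\<chi> \<in> Irr G" and \<psi>: "\<psi> \<in> Irr G"
    and nz: "(\<Sum>y\<in>carrier G. \<psi> y * \<chi> (inv y)) \<noteq> 0" and g: "g \<in> carrier G"
  shows "\<psi> g * \<chi> \<one> = \<chi> g * \<psi> \<one>"
proof -
  have ch: "\<chi> \<in> characters G" "\<psi> \<in> characters G"
    using \<chi> \<psi> Irr_subset by auto
  have cls: "\<phi> (inv (x \<otimes> y \<otimes> inv x)) = \<phi> (inv y)"
    if "\<phi> \<in> characters G" "x \<in> carrier G" "y \<in> carrier G" for \<phi> x y
    using character_conj[OF that(1,2), of "inv y"] that by (simp add: inv_mult_group m_assoc)
  define a where "a = (\<Sum>y\<in>carrier G. \<psi> y * \<chi> (inv y))"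
  have a': "(\<Sum>y\<in>carrier G. \<psi> (inv y) * \<chi> y) = a"
    using sum_inv[of "\<lambda>y. \<psi> y * \<chi> (inv y)"] by (simp add: a_def)
  have 1: "(\<Sum>y\<in>carrier G. \<chi> (inv y) * \<psi> (g \<otimes> y)) * \<psi> \<one> = a * \<psi> g"
    using Irr_sum_class_function[OF \<psi> g, of "\<lambda>y. \<chi> (inv y)"] cls[OF ch(1)]
    by (simp add: a_def mult.commute)
  have 2: "(\<Sum>y\<in>carrier G. \<psi> (inv y) * \<chi> (g \<otimes> y)) * \<chi> \<one> = a * \<chi> g"
    using Irr_sum_class_function[OF \<chi> g, of "\<lambda>y. \<psi> (inv y)"] cls[OF ch(2)] a'
    by simp
  \<comment> \<open>The substitution of \<open>inv g \<otimes> inv y\<close> for \<open>y\<close>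
    exchanges the two ways of writing the convolution, one a multiple of \<open>\<chi>\<close> and
    the other of \<open>\<psi>\<close>.\<close>
  have "(\<Sum>y\<in>carrier G. \<psi> (inv y) * \<chi> (g \<otimes> y))
      = (\<Sum>y\<in>carrier G. \<psi> (inv (inv g \<otimes> inv y)) * \<chi> (g \<otimes> (inv g \<otimes> inv y)))"
    unfolding sum_inv[where f = "\<lambda>z. \<psi> (inv (inv g \<otimes> z)) * \<chi> (g \<otimes> (inv g \<otimes> z))"]
    by (rule sum_left_translate[OF inv_closed[OF g], symmetric])
  also have "\<dots> = (\<Sum>y\<in>carrier G. \<chi> (inv y) * \<psi> (g \<otimes> y))"
  proof (rule sum.cong[OF refl])
    fix y assume y: "y \<in> carrier G"
    have "inv (inv g \<otimes> inv y) = y \<otimes> g" "g \<otimes> (inv g \<otimes> inv y) = inv y"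
      using g y by (simp_all add: inv_mult_group m_assoc[symmetric])
    then show "\<psi> (inv (inv g \<otimes> inv y)) * \<chi> (g \<otimes> (inv g \<otimes> inv y)) = \<chi> (inv y) * \<psi> (g \<otimes> y)"
      using character_commute[OF ch(2) y g] by simp
  qed
  finally have "a * \<psi> g * \<chi> \<one> = a * \<chi> g * \<psi> \<one>"
    unfolding 1[symmetric] 2[symmetric] by simp
  then show ?thesis
    using nz by (simp add: a_def)
qed

end

text \<open>An isomorphism only reindexes the norm sum, so the norm criterion carries over.\<close>

lemma (in finite_group) Irr_pullback_iso:
  assumes H: "finite_group H" and hom: "\<iota> \<in> hom H G" and bij: "bij_betw \<iota> (carrier H) (carrier G)"
    and \<chi>: "\<chi> \<in> Irr G"
  shows "(\<lambda>h\<in>carrier H. \<chi> (\<iota> h)) \<in> Irr H"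
proof -
  interpret H: finite_group H by fact
  have "\<iota> (inv\<^bsub>H\<^esub> h) = inv \<iota> h" if "h \<in> carrier H" for h
    using group_hom.hom_inv[of H G \<iota> h] hom that H.group_axioms group_axioms
    by (simp add: group_hom_def group_hom_axioms_def)
  then have "(\<Sum>h\<in>carrier H. (\<lambda>h\<in>carrier H. \<chi> (\<iota> h)) h * (\<lambda>h\<in>carrier H. \<chi> (\<iota> h)) (inv\<^bsub>H\<^esub> h))
      = (\<Sum>h\<in>carrier H. \<chi> (\<iota> h) * \<chi> (inv \<iota> h))"
    by (intro sum.cong) auto
  also have "\<dots> = (\<Sum>g\<in>carrier G. \<chi> g * \<chi> (inv g))"
    by (rule sum.reindex_bij_betw[OF bij, where g = "\<lambda>g. \<chi> g * \<chi> (inv g)"])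
  also have "\<dots> = of_nat (card (carrier H))"
    using Irr_norm[OF \<chi>] bij_betw_same_card[OF bij] by simp
  finally show ?thesis
    using character_pullback[OF H hom] Irr_subset \<chi> by (intro H.character_norm_one_Irr) auto
qed

section \<open>Induction of linear characters\<close>

context finite_group
begin

lemma subgroup_finite_group: "subgroup H G \<Longrightarrow> finite_group (G\<lparr>carrier := H\<rparr>)"
  using subgroup.subgroup_is_group[OF _ group_axioms] finite_subset[OF subgroup.subset fin]
  by (simp add: finite_group_def finite_group_axioms_def)

lemma character_restrict:
  assumes "subgroup H G" "\<chi> \<in> characters G"
  shows "restrict \<chi> H \<in> characters (G\<lparr>carrier := H\<rparr>)"
  using character_pullback[OF subgroup_finite_group[OF assms(1)] _ assms(2), of "\<lambda>x. x"]
    subgroup.subset[OF assms(1)]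
  by (auto simp: hom_def)

lemma induced_character_eq:
  "g \<in> carrier G \<Longrightarrow> induced_character G H \<theta> g
    = (\<Sum>x\<in>carrier G. if x \<otimes> g \<otimes> inv x \<in> H then \<theta> (x \<otimes> g \<otimes> inv x) else 0) / of_nat (card H)"
  by (simp add: induced_character_def Let_def)

lemma sum_over_subgroup:
  assumes "subgroup H G"
  shows "(\<Sum>y\<in>carrier G. if y \<in> H then f y else 0) = (\<Sum>y\<in>H. f y)"
  using subgroup.subset[OF assms] fin
  by (intro sum.mono_neutral_cong_right) auto

text \<open>Frobenius reciprocity: pair the induced character with \<open>\<chi>\<close>; as
  \<open>\<chi>\<close> is a class function, the sum over conjugates folds back to a sum over
  \<open>H\<close>.\<close>

lemma induced_proportional_inner:
  assumes \<chi>: "\<chi> \<in> Irr G" and H: "subgroup H G"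
    and eq: "\<And>g. g \<in> carrier G \<Longrightarrow> induced_character G H \<mu> g = c * \<chi> g"
  shows "(\<Sum>h\<in>H. \<chi> h * \<mu> (inv h)) = c * of_nat (card H)"
proof -
  interpret H: finite_group "G\<lparr>carrier := H\<rparr>"
    by (rule subgroup_finite_group[OF H])
  have ch: "\<chi> \<in> characters G"
    using \<chi> Irr_subset by blast
  have invH: "inv\<^bsub>G\<lparr>carrier := H\<rparr>\<^esub> h = inv h" if "h \<in> H" for h
    using m_inv_consistent[OF H that] by simp
  have HG: "H \<subseteq> carrier G"
    using subgroup.subset[OF H] .
  have cardH: "card H > 0"
    using H.order_pos by simp
  define \<mu>0 where "\<mu>0 y = (if y \<in> H then \<mu> y else 0)" for y
  have "c * of_nat (card (carrier G)) = (\<Sum>g\<in>carrier G. induced_character G H \<mu> g * \<chi> (inv g))"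
    by (simp add: eq Irr_norm[OF \<chi>, symmetric] sum_distrib_left mult.assoc)
  also have "\<dots> = (\<Sum>g\<in>carrier G. (\<Sum>x\<in>carrier G. \<mu>0 (x \<otimes> g \<otimes> inv x)
      * \<chi> (inv (x \<otimes> g \<otimes> inv x)))) / of_nat (card H)"
    unfolding sum_divide_distrib
  proof (rule sum.cong[OF refl])
    fix g assume g: "g \<in> carrier G"
    have "\<chi> (inv (x \<otimes> g \<otimes> inv x)) = \<chi> (inv g)" if "x \<in> carrier G" for x
      using character_conj[OF ch that, of "inv g"] that g by (simp add: inv_mult_group m_assoc)
    then show "induced_character G H \<mu> g * \<chi> (inv g)
      = (\<Sum>x\<in>carrier G. \<mu>0 (x \<otimes> g \<otimes> inv x) * \<chi> (inv (x \<otimes> g \<otimes> inv x)) / of_nat (card H))"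
      using g by (simp add: induced_character_eq \<mu>0_def sum_distrib_right sum_divide_distrib)
  qed
  also have "\<dots> = (\<Sum>x\<in>carrier G. \<Sum>g\<in>carrier G. \<mu>0 (x \<otimes> g \<otimes> inv x)
      * \<chi> (inv (x \<otimes> g \<otimes> inv x))) / of_nat (card H)"
    by (subst sum.swap) simp
  also have "\<dots> = of_nat (card (carrier G)) * (\<Sum>g\<in>carrier G. \<mu>0 g * \<chi> (inv g)) / of_nat (card H)"
    by (simp add: sum_conj[where f = "\<lambda>g. \<mu>0 g * \<chi> (inv g)"])
  also have "(\<Sum>g\<in>carrier G. \<mu>0 g * \<chi> (inv g)) = (\<Sum>h\<in>H. \<mu> h * \<chi> (inv h))"
    unfolding sum_over_subgroup[OF H, symmetric] by (intro sum.cong) (auto simp: \<mu>0_def)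
  finally have c: "c * of_nat (card H) = (\<Sum>h\<in>H. \<mu> h * \<chi> (inv h))"
    using order_pos cardH by (simp add: field_simps)
  have "(\<Sum>h\<in>H. \<mu> h * \<chi> (inv h)) = (\<Sum>h\<in>H. \<mu> (inv h) * \<chi> h)"
    using H.sum_inv[of "\<lambda>h. \<mu> h * \<chi> (inv h)"] invH HG
    by (simp add: subset_iff cong: sum.cong)
  then show ?thesis
    using c by (simp add: mult.commute)
qed

lemma induced_proportional_quasi_monomial:
  assumes \<chi>: "\<chi> \<in> Irr G" and H: "subgroup H G" and \<mu>: "\<mu> \<in> linear_characters (G\<lparr>carrier := H\<rparr>)"
    and eq: "\<And>g. g \<in> carrier G \<Longrightarrow> induced_character G H \<mu> g = c * \<chi> g"
  shows "quasi_monomial_character G \<chi>"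
proof -
  interpret H: finite_group "G\<lparr>carrier := H\<rparr>"
    by (rule subgroup_finite_group[OF H])
  have ch: "\<chi> \<in> characters G"
    using \<chi> Irr_subset by blast
  have invH: "inv\<^bsub>G\<lparr>carrier := H\<rparr>\<^esub> h = inv h" if "h \<in> H" for h
    using m_inv_consistent[OF H that] by simp
  have HG: "\<one> \<in> H"
    using subgroup.one_closed[OF H] .
  have cardH: "card H > 0"
    using H.order_pos by simp
  obtain m :: nat where m: "(\<Sum>h\<in>H. restrict \<chi> H h * \<mu> (inv\<^bsub>G\<lparr>carrier := H\<rparr>\<^esub> h)) * \<mu> \<one> = of_nat (m * card H)"
    using H.character_inner_Irr_Nats[OF character_restrict[OF H ch] H.linear_characters_Irr[OF \<mu>]] by auto
  have \<mu>1: "\<mu> \<one> = 1"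
    using H.linear_charactersD(1)[OF \<mu>] by simp
  have "(\<Sum>h\<in>H. \<chi> h * \<mu> (inv h)) = of_nat (m * card H)"
    using m invH by (simp add: \<mu>1 cong: sum.cong)
  then have "c * of_nat (card H) = of_nat (m * card H)"
    using induced_proportional_inner[OF \<chi> H eq] by simp
  then have cm: "c = of_nat m"
    using cardH by simp
  \<comment> \<open>The value at the identity is the index of \<open>H\<close>, which excludes
    \<open>c = 0\<close> and thus makes the multiple positive.\<close>
  have "induced_character G H \<mu> \<one> = of_nat (card (carrier G)) / of_nat (card H)"
    using HG by (simp add: induced_character_eq \<mu>1)
  then have "c \<noteq> 0"
    using eq[of \<one>] order_pos cardH by auto
  then have "0 < m"
    using cm by simp
  moreover have "induced_character G H \<mu> = (\<lambda>g\<in>carrier G. of_nat m * \<chi> g)"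
    using eq cm by (intro extensionalityI[of _ "carrier G"]) (auto simp: induced_character_def)
  ultimately show ?thesis
    using H \<mu> unfolding quasi_monomial_character_def by blast
qed

end

text \<open>The order of \<open>z\<close> divides both \<open>j\<close> and \<open>p\<close>, which
  are coprime.\<close>

lemma root_of_unity_prime:
  assumes "prime p" "(z :: complex) ^ p = 1" "z ^ j = 1" "0 < j" "j < p"
  shows "z = 1"
proof -
  have "coprime j p"
    using assms(1,4,5) by (metis coprime_commute nat_dvd_not_less prime_imp_coprime)
  then obtain x y where xy: "j * x = p * y + 1"
    using bezout_nat[of j p] assms(4) by (auto simp: coprime_iff_gcd_eq_1)
  have "z ^ (j * x) = 1" "z ^ (p * y + 1) = z"
    using assms(2,3) by (simp_all add: power_mult)
  then show ?thesis
    using xy by simp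
qed

lemma root_of_unity_sum:
  assumes "(z :: complex) ^ p = 1"
  shows "(\<Sum>j<p. z ^ j) = (if z = 1 then of_nat p else 0)"
  using one_diff_power_eq[of z p] assms by auto

section \<open>Characters induced from subgroups of small index\<close>

context finite_group
begin

lemma double_sum_translate:
  "(\<Sum>k\<in>carrier G. \<Sum>l\<in>carrier G. f (inv l \<otimes> k)) = of_nat (card (carrier G)) * (\<Sum>k\<in>carrier G. (f k :: complex))"
proof -
  have "(\<Sum>k\<in>carrier G. \<Sum>l\<in>carrier G. f (inv l \<otimes> k)) = (\<Sum>l\<in>carrier G. \<Sum>k\<in>carrier G. f (inv l \<otimes> k))"
    by (rule sum.swap)
  also have "\<dots> = (\<Sum>l\<in>carrier G. \<Sum>k\<in>carrier G. f k)"
    by (intro sum.cong refl sum_left_translate) auto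
  finally show ?thesis by simp
qed

text \<open>If \<open>|G : K| \<le> \<chi>(1)\<close>, the function \<open>\<mu>\<close> extended by zero coincides with its projection \<open>R\<close>
  onto the isotypic component of \<open>\<chi>\<close> in the group algebra: the squared norm of the difference is
  \<open>|K| (1 - m \<chi>(1) |K| / |G|)\<close>, where \<open>m \<ge> 1\<close> is the multiplicity of \<open>\<mu>\<close> in \<open>\<chi>\<close>.\<close>

lemma quasi_monomial_of_degree:
  assumes \<chi>: "\<chi> \<in> Irr G" and K: "subgroup K G" and \<mu>: "\<mu> \<in> linear_characters (G\<lparr>carrier := K\<rparr>)"
    and nz: "(\<Sum>k\<in>K. \<mu> (inv k) * \<chi> k) \<noteq> 0"
    and deg: "\<chi> \<one> = of_nat n" "card (carrier G) \<le> n * card K"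
  shows "quasi_monomial_character G \<chi>"
proof -
  interpret K: finite_group "G\<lparr>carrier := K\<rparr>"
    by (rule subgroup_finite_group[OF K])
  have ch: "\<chi> \<in> characters G"
    using \<chi> Irr_subset by blast
  have KG: "K \<subseteq> carrier G"
    using subgroup.subset[OF K] .
  have Kc: "k \<otimes> l \<in> K" "inv k \<in> K" if "k \<in> K" "l \<in> K" for k l
    using subgroup.m_closed[OF K] subgroup.m_inv_closed[OF K] that by auto
  have invK: "inv\<^bsub>G\<lparr>carrier := K\<rparr>\<^esub> k = inv k" if "k \<in> K" for k
    using m_inv_consistent[OF K that] by simp
  note L = K.linear_charactersD[OF \<mu>]
  have \<mu>_mult: "\<mu> (k \<otimes> l) = \<mu> k * \<mu> l" if "k \<in> K" "l \<in> K" for k l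
    using L(3) that by simp
  have \<mu>_inv: "\<mu> k * \<mu> (inv k) = 1" "\<mu> (inv k) = cnj (\<mu> k)" if "k \<in> K" for k
    using L(4) K.character_inv[OF L(2)] invK that by auto
  define N where "N = real (card (carrier G))"
  define M where "M = real (card K)"
  have N: "N > 0" and M: "M > 0"
    using order_pos K.order_pos by (simp_all add: N_def M_def)
  have n: "n > 0"
    using Irr_degree[OF \<chi>] deg(1) by (metis of_nat_eq_iff)
  define T where "T = (\<Sum>k\<in>K. \<mu> (inv k) * \<chi> k)"
  obtain m :: nat where m: "T = of_nat m * of_real M"
  proof -
    obtain m :: nat where "(\<Sum>h\<in>K. restrict \<chi> K h * \<mu> (inv\<^bsub>G\<lparr>carrier := K\<rparr>\<^esub> h)) * \<mu> \<one> = of_nat (m * card K)"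
      using K.character_inner_Irr_Nats[OF character_restrict[OF K ch] K.linear_characters_Irr[OF \<mu>]]
      by auto
    then have "T = of_nat (m * card K)"
      using L(1) invK by (simp add: T_def mult.commute cong: sum.cong)
    then show thesis
      by (intro that[of m]) (simp add: M_def)
  qed
  have m1: "m \<ge> 1"
    using nz m by (cases m) (auto simp: T_def)
  \<comment> \<open>Degree over group order, the factor that makes convolution with
    \<open>\<chi>\<close> idempotent.\<close>
  define q where "q = real n / N"
  define S where "S g = (if g \<in> K then \<mu> g else 0)" for g
  \<comment> \<open>\<open>R\<close> is the convolution of \<open>S\<close> with
    \<open>\<chi>\<close>, scaled by \<open>q\<close>; the sum is written over inverses of elements
    of \<open>K\<close>.\<close>
  define R where "R g = of_real q * (\<Sum>k\<in>K. \<mu> (inv k) * \<chi> (g \<otimes> k))" for g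
  \<comment> \<open>The summand depends only on \<open>inv l \<otimes> k\<close>, which meets each
    element of \<open>K\<close> exactly \<open>card K\<close> times.\<close>
  have KT: "(\<Sum>k\<in>K. \<Sum>l\<in>K. \<mu> (inv (inv l \<otimes> k)) * \<chi> (inv l \<otimes> k)) = of_real M * T"
  proof -
    have "(\<Sum>k\<in>K. \<Sum>l\<in>K. \<mu> (inv (inv l \<otimes> k)) * \<chi> (inv l \<otimes> k))
        = (\<Sum>k\<in>K. \<Sum>l\<in>K. \<mu> (inv (inv\<^bsub>G\<lparr>carrier := K\<rparr>\<^esub> l \<otimes> k)) * \<chi> (inv\<^bsub>G\<lparr>carrier := K\<rparr>\<^esub> l \<otimes> k))"
      by (simp add: invK cong: sum.cong)
    also have "\<dots> = of_real M * T"
      using K.double_sum_translate[of "\<lambda>k. \<mu> (inv k) * \<chi> k"] by (simp add: T_def M_def)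
    finally show ?thesis .
  qed
  have SS: "(\<Sum>g\<in>carrier G. S g * cnj (S g)) = of_real M"
  proof -
    have "(\<Sum>g\<in>carrier G. S g * cnj (S g)) = (\<Sum>g\<in>K. \<mu> g * cnj (\<mu> g))"
      unfolding sum_over_subgroup[OF K, symmetric] by (intro sum.cong) (auto simp: S_def)
    also have "\<dots> = (\<Sum>g\<in>K. 1)"
      using \<mu>_inv by (intro sum.cong) auto
    finally show ?thesis
      by (simp add: M_def)
  qed
  have RS: "(\<Sum>g\<in>carrier G. R g * cnj (S g)) = of_real q * (of_real M * T)"
  proof -
    have "(\<Sum>g\<in>carrier G. R g * cnj (S g)) = (\<Sum>g\<in>K. R g * \<mu> (inv g))"
      unfolding sum_over_subgroup[OF K, symmetric] using \<mu>_inv(2) by (intro sum.cong) (auto simp: S_def)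
    also have "\<dots> = of_real q * (\<Sum>g\<in>K. \<Sum>k\<in>K. \<mu> (inv g) * \<mu> (inv k) * \<chi> (g \<otimes> k))"
      by (simp add: R_def sum_distrib_left mult_ac)
    also have "(\<Sum>g\<in>K. \<Sum>k\<in>K. \<mu> (inv g) * \<mu> (inv k) * \<chi> (g \<otimes> k))
        = (\<Sum>k\<in>K. \<Sum>g\<in>K. \<mu> (inv (g \<otimes> k)) * \<chi> (g \<otimes> k))"
    proof (subst sum.swap, intro sum.cong refl)
      fix k g assume "k \<in> K" "g \<in> K"
      then show "\<mu> (inv g) * \<mu> (inv k) * \<chi> (g \<otimes> k) = \<mu> (inv (g \<otimes> k)) * \<chi> (g \<otimes> k)"
        using KG Kc by (simp add: \<mu>_mult inv_mult_group subset_iff)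
    qed
    also have "\<dots> = (\<Sum>k\<in>K. \<Sum>l\<in>K. \<mu> (inv (inv l \<otimes> k)) * \<chi> (inv l \<otimes> k))"
    proof (rule sum.cong[OF refl])
      fix k assume "k \<in> K"
      show "(\<Sum>g\<in>K. \<mu> (inv (g \<otimes> k)) * \<chi> (g \<otimes> k)) = (\<Sum>l\<in>K. \<mu> (inv (inv l \<otimes> k)) * \<chi> (inv l \<otimes> k))"
        using K.sum_inv[of "\<lambda>g. \<mu> (inv (g \<otimes> k)) * \<chi> (g \<otimes> k)"] by (simp add: invK cong: sum.cong)
    qed
    finally show ?thesis
      unfolding KT .
  qed
  \<comment> \<open>The same value as for \<open>R\<close> against \<open>S\<close>, as expected of
    an orthogonal projection. The source is \<open>conv\<close>: convolving \<open>\<chi>\<close>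
    with itself gives \<open>\<chi>\<close> times group order over degree.\<close>
  have RR: "(\<Sum>g\<in>carrier G. R g * cnj (R g)) = of_real q * (of_real M * T)"
  proof -
    have conv: "(\<Sum>g\<in>carrier G. \<chi> (g \<otimes> k) * \<chi> (inv (g \<otimes> l))) = of_real (N / real n) * \<chi> (inv l \<otimes> k)"
      if "k \<in> K" "l \<in> K" for k l
    proof -
      have kl: "k \<in> carrier G" "l \<in> carrier G"
        using that KG by auto
      have "(\<Sum>g\<in>carrier G. \<chi> (g \<otimes> k) * \<chi> (inv (g \<otimes> l)))
          = (\<Sum>g\<in>carrier G. \<chi> (g \<otimes> inv l \<otimes> k) * \<chi> (inv (g \<otimes> inv l \<otimes> l)))"
        using sum_right_translate[of "inv l" "\<lambda>g. \<chi> (g \<otimes> k) * \<chi> (inv (g \<otimes> l))"] kl by simp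
      also have "\<dots> = (\<Sum>g\<in>carrier G. \<chi> (inv g) * \<chi> (inv l \<otimes> k \<otimes> g))"
      proof (rule sum.cong[OF refl])
        fix g assume g: "g \<in> carrier G"
        have "g \<otimes> inv l \<otimes> l = g" "g \<otimes> inv l \<otimes> k = g \<otimes> (inv l \<otimes> k)"
          using g kl by (simp_all add: m_assoc)
        then show "\<chi> (g \<otimes> inv l \<otimes> k) * \<chi> (inv (g \<otimes> inv l \<otimes> l)) = \<chi> (inv g) * \<chi> (inv l \<otimes> k \<otimes> g)"
          using character_commute[OF ch g, of "inv l \<otimes> k"] g kl by simp
      qed
      finally have eq: "(\<Sum>g\<in>carrier G. \<chi> (g \<otimes> k) * \<chi> (inv (g \<otimes> l)))
          = (\<Sum>g\<in>carrier G. \<chi> (inv g) * \<chi> (inv l \<otimes> k \<otimes> g))" .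
      have "(\<Sum>g\<in>carrier G. \<chi> (inv g) * \<chi> (inv l \<otimes> k \<otimes> g)) * \<chi> \<one>
          = (\<Sum>g\<in>carrier G. \<chi> (inv g) * \<chi> g) * \<chi> (inv l \<otimes> k)"
      proof (rule Irr_sum_class_function[OF \<chi>])
        fix x y assume "x \<in> carrier G" "y \<in> carrier G"
        then show "\<chi> (inv (x \<otimes> y \<otimes> inv x)) = \<chi> (inv y)"
          using character_conj[OF ch, of x "inv y"] by (simp add: inv_mult_group m_assoc)
      qed (use kl in simp)
      also have "(\<Sum>g\<in>carrier G. \<chi> (inv g) * \<chi> g) = of_real N"
        using Irr_norm[OF \<chi>] by (simp add: mult.commute N_def)
      finally show ?thesis
        using n by (simp add: eq deg(1) field_simps)
    qed
    have cnjR: "cnj (R g) = of_real q * (\<Sum>l\<in>K. \<mu> l * \<chi> (inv (g \<otimes> l)))" if "g \<in> carrier G" for g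
    proof -
      have "cnj (\<mu> (inv l) * \<chi> (g \<otimes> l)) = \<mu> l * \<chi> (inv (g \<otimes> l))" if l: "l \<in> K" for l
        using l KG \<open>g \<in> carrier G\<close> \<mu>_inv(2)[OF l] character_inv[OF ch, of "g \<otimes> l"]
        by (simp add: subset_iff)
      then show ?thesis
        by (simp add: R_def cong: sum.cong)
    qed
    have "(\<Sum>g\<in>carrier G. R g * cnj (R g))
        = (\<Sum>g\<in>carrier G. (of_real q)\<^sup>2 * (\<Sum>k\<in>K. \<Sum>l\<in>K. \<mu> (inv k) * \<mu> l * (\<chi> (g \<otimes> k) * \<chi> (inv (g \<otimes> l)))))"
    proof (rule sum.cong[OF refl])
      fix g assume g: "g \<in> carrier G"
      have "R g * cnj (R g) = (of_real q)\<^sup>2 * ((\<Sum>k\<in>K. \<mu> (inv k) * \<chi> (g \<otimes> k)) * (\<Sum>l\<in>K. \<mu> l * \<chi> (inv (g \<otimes> l))))"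
        unfolding cnjR[OF g] by (simp add: R_def power2_eq_square mult_ac)
      then show "R g * cnj (R g) = (of_real q)\<^sup>2 * (\<Sum>k\<in>K. \<Sum>l\<in>K. \<mu> (inv k) * \<mu> l * (\<chi> (g \<otimes> k) * \<chi> (inv (g \<otimes> l))))"
        unfolding sum_product by (simp only: mult_ac)
    qed
    also have "\<dots> = (of_real q)\<^sup>2 * (\<Sum>k\<in>K. \<Sum>l\<in>K. \<mu> (inv k) * \<mu> l
        * (\<Sum>g\<in>carrier G. \<chi> (g \<otimes> k) * \<chi> (inv (g \<otimes> l))))"
      by (simp add: sum_distrib_left sum.swap[of _ _ "carrier G"])
    also have "(\<Sum>k\<in>K. \<Sum>l\<in>K. \<mu> (inv k) * \<mu> l * (\<Sum>g\<in>carrier G. \<chi> (g \<otimes> k) * \<chi> (inv (g \<otimes> l))))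
        = (\<Sum>k\<in>K. \<Sum>l\<in>K. of_real (N / real n) * (\<mu> (inv (inv l \<otimes> k)) * \<chi> (inv l \<otimes> k)))"
    proof (intro sum.cong refl)
      fix k l assume kl: "k \<in> K" "l \<in> K"
      have "inv (inv l \<otimes> k) = inv k \<otimes> l"
        using kl KG by (simp add: inv_mult_group subset_iff)
      then show "\<mu> (inv k) * \<mu> l * (\<Sum>g\<in>carrier G. \<chi> (g \<otimes> k) * \<chi> (inv (g \<otimes> l)))
          = of_real (N / real n) * (\<mu> (inv (inv l \<otimes> k)) * \<chi> (inv l \<otimes> k))"
        using kl Kc by (simp add: conv \<mu>_mult)
    qed
    also have "\<dots> = of_real (N / real n) * (of_real M * T)"
      unfolding sum_distrib_left[symmetric] KT ..
    finally show ?thesis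
      using N n by (simp add: q_def power2_eq_square)
  qed
  have SR: "(\<Sum>g\<in>carrier G. S g * cnj (R g)) = of_real q * (of_real M * T)"
  proof -
    have "(\<Sum>g\<in>carrier G. S g * cnj (R g)) = cnj (\<Sum>g\<in>carrier G. R g * cnj (S g))"
      by (simp add: mult.commute)
    then show ?thesis
      unfolding RS by (simp add: m)
  qed
  have "(\<Sum>g\<in>carrier G. (S g - R g) * cnj (S g - R g)) = of_real (M - q * M * real m * M)"
  proof -
    have "(\<Sum>g\<in>carrier G. (S g - R g) * cnj (S g - R g))
        = (\<Sum>g\<in>carrier G. S g * cnj (S g)) - (\<Sum>g\<in>carrier G. S g * cnj (R g))
        - (\<Sum>g\<in>carrier G. R g * cnj (S g)) + (\<Sum>g\<in>carrier G. R g * cnj (R g))"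
      by (simp add: ring_distribs sum.distrib sum_subtractf)
    then show ?thesis
      unfolding SS SR RS RR by (simp add: m)
  qed
  moreover have "(\<Sum>g\<in>carrier G. (S g - R g) * cnj (S g - R g)) = of_real (\<Sum>g\<in>carrier G. (cmod (S g - R g))\<^sup>2)"
    by (simp only: of_real_sum complex_norm_square)
  ultimately have "(\<Sum>g\<in>carrier G. (cmod (S g - R g))\<^sup>2) = M - q * M * real m * M"
    by (simp only: of_real_eq_iff)
  \<comment> \<open>The bound on the index gives \<open>1 \<le> q * M\<close>, and \<open>m\<close>
    is at least 1; so the squared distance, a priori nonnegative, is 0.\<close>
  also have "\<dots> \<le> 0"
  proof -
    have "N \<le> real n * M"
      using deg(2) unfolding N_def M_def by (simp flip: of_nat_mult)
    then have "1 \<le> q * M"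
      using N by (simp add: q_def field_simps)
    then have "1 \<le> q * M * real m"
      using m1 by (metis mult_mono' mult_1 of_nat_1 of_nat_mono zero_le_one)
    then have "M * 1 \<le> M * (q * M * real m)"
      using M by (intro mult_left_mono) auto
    then show ?thesis
      by (simp add: mult_ac)
  qed
  finally have "(\<Sum>g\<in>carrier G. (cmod (S g - R g))\<^sup>2) = 0"
    by (simp add: sum_nonneg order_antisym)
  then have SeqR: "S g = R g" if "g \<in> carrier G" for g
    using that fin by (subst (asm) sum_nonneg_eq_0_iff) auto
  show ?thesis
  proof (rule induced_proportional_quasi_monomial[OF \<chi> K \<mu>])
    fix g assume g: "g \<in> carrier G"
    \<comment> \<open>Once \<open>S\<close> is replaced by \<open>R\<close>, the sum over conjugates
      can be evaluated by \<open>Irr_functional_equation\<close>.\<close>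
    have "induced_character G K \<mu> g * of_real M = (\<Sum>x\<in>carrier G. R (x \<otimes> g \<otimes> inv x))"
      using g M SeqR by (simp add: induced_character_eq M_def flip: S_def)
    also have "\<dots> = of_real q * (\<Sum>k\<in>K. \<mu> (inv k) * (\<Sum>x\<in>carrier G. \<chi> (x \<otimes> g \<otimes> inv x \<otimes> k)))"
      by (simp add: R_def sum_distrib_left sum.swap[of _ _ "carrier G"])
    also have "(\<Sum>k\<in>K. \<mu> (inv k) * (\<Sum>x\<in>carrier G. \<chi> (x \<otimes> g \<otimes> inv x \<otimes> k)))
        = (\<Sum>k\<in>K. \<mu> (inv k) * (of_real N * \<chi> g * \<chi> k / of_nat n))"
      using g KG by (intro sum.cong refl) (auto simp: Irr_functional_equation[OF \<chi>] N_def deg(1))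
    also have "\<dots> = T * (of_real (N / real n) * \<chi> g)"
      by (simp add: T_def sum_distrib_left sum_distrib_right sum_divide_distrib mult_ac)
    finally show "induced_character G K \<mu> g = (T / of_real M) * \<chi> g"
      using N n M by (simp add: q_def field_simps)
  qed
qed

text \<open>Inducing in stages: \<open>ind\<close> says that \<open>\<mu>\<close> induces to a
  multiple of \<open>\<theta>\<close> on \<open>N\<close>, with the order of \<open>H\<close>
  absorbed into \<open>d\<close>. Inducing further to \<open>G\<close> sums the conjugates of
  \<open>\<theta>\<close>, which on \<open>N\<close> is a multiple of \<open>\<chi>\<close> by
  Clifford's theorem; off \<open>N\<close> both sides vanish.\<close>

lemma quasi_monomial_of_vanishing:
  assumes \<chi>: "\<chi> \<in> Irr G" and N: "subgroup N G"
    and normal: "\<And>x y. x \<in> carrier G \<Longrightarrow> y \<in> N \<Longrightarrow> x \<otimes> y \<otimes> inv x \<in> N"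
    and vanish: "\<And>g. g \<in> carrier G \<Longrightarrow> g \<notin> N \<Longrightarrow> \<chi> g = 0"
    and \<theta>: "\<theta> \<in> Irr (G\<lparr>carrier := N\<rparr>)" and nz: "(\<Sum>y\<in>N. \<chi> y * \<theta> (inv y)) \<noteq> 0"
    and H: "subgroup H G" "H \<subseteq> N" and \<mu>: "\<mu> \<in> linear_characters (G\<lparr>carrier := H\<rparr>)"
    and ind: "\<And>g. g \<in> N \<Longrightarrow> (\<Sum>b\<in>N. if b \<otimes> g \<otimes> inv b \<in> H then \<mu> (b \<otimes> g \<otimes> inv b) else 0) = d * \<theta> g"
  shows "quasi_monomial_character G \<chi>"
proof -
  interpret N: finite_group "G\<lparr>carrier := N\<rparr>"
    by (rule subgroup_finite_group[OF N])
  have ch: "\<chi> \<in> characters G"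
    using \<chi> Irr_subset by blast
  have NG: "N \<subseteq> carrier G"
    using subgroup.subset[OF N] .
  have invN: "inv\<^bsub>G\<lparr>carrier := N\<rparr>\<^esub> y = inv y" if "y \<in> N" for y
    using m_inv_consistent[OF N that] by simp
  have invNN: "inv y \<in> N" if "y \<in> N" for y
    using subgroup.m_inv_closed[OF N that] .
  have normal_iff: "x \<otimes> y \<otimes> inv x \<in> N \<longleftrightarrow> y \<in> N" if x: "x \<in> carrier G" and y: "y \<in> carrier G" for x y
  proof
    assume "x \<otimes> y \<otimes> inv x \<in> N"
    then have "inv x \<otimes> (x \<otimes> y \<otimes> inv x) \<otimes> inv (inv x) \<in> N"
      using normal x by blast
    also have "inv x \<otimes> (x \<otimes> y \<otimes> inv x) \<otimes> inv (inv x) = y"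
      using x y by (simp add: m_assoc) (simp add: m_assoc[symmetric])
    finally show "y \<in> N" .
  qed (use normal x in blast)
  define \<theta>0 where "\<theta>0 y = (if y \<in> N then \<theta> y else 0)" for y
  have class_inv: "\<chi> (inv (x \<otimes> y \<otimes> inv x)) = \<chi> (inv y)" if "x \<in> carrier G" "y \<in> carrier G" for x y
    using character_conj[OF ch that(1), of "inv y"] that by (simp add: inv_mult_group m_assoc)
  \<comment> \<open>The scalar by which convolution with \<open>\<theta>\<close> turns the
    restriction of \<open>\<chi>\<close> to \<open>N\<close> into a multiple of
    \<open>\<theta>\<close>; it is nonzero because \<open>\<theta>\<close> is a constituent.\<close>
  define k where "k = (\<Sum>y\<in>N. \<chi> (inv y) * \<theta> y) / \<theta> \<one>"
  have k: "k \<noteq> 0"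
  proof -
    have "(\<Sum>y\<in>N. \<chi> (inv y) * \<theta> y) = (\<Sum>y\<in>N. \<chi> y * \<theta> (inv y))"
      using N.sum_inv[of "\<lambda>y. \<chi> y * \<theta> (inv y)"] NG by (simp add: invN subset_iff cong: sum.cong)
    moreover have "\<theta> \<one> \<noteq> 0"
      by (rule N.Irr_degree[OF \<theta>]) simp
    ultimately show ?thesis
      using nz by (simp add: k_def)
  qed
  have convN: "(\<Sum>y\<in>N. \<theta> (inv y) * \<chi> (z \<otimes> y)) = k * \<theta> z" if z: "z \<in> N" for z
  proof -
    have zc: "inv z \<in> N" "z \<in> carrier G"
      using z invNN NG by auto
    have "(\<Sum>y\<in>N. \<theta> (inv y) * \<chi> (z \<otimes> y)) = (\<Sum>y\<in>N. \<theta> (inv (inv z \<otimes> y)) * \<chi> (z \<otimes> (inv z \<otimes> y)))"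
      using N.sum_left_translate[of "inv z" "\<lambda>y. \<theta> (inv y) * \<chi> (z \<otimes> y)"] zc by simp
    also have "\<dots> = (\<Sum>y\<in>N. \<theta> (inv (inv z \<otimes> inv y)) * \<chi> (z \<otimes> (inv z \<otimes> inv y)))"
      using N.sum_inv[of "\<lambda>y. \<theta> (inv (inv z \<otimes> y)) * \<chi> (z \<otimes> (inv z \<otimes> y))"] by (simp add: invN cong: sum.cong)
    also have "\<dots> = (\<Sum>y\<in>N. \<chi> (inv y) * \<theta> (z \<otimes> y))"
    proof (rule sum.cong[OF refl])
      fix y assume y: "y \<in> N"
      then have "inv (inv z \<otimes> inv y) = y \<otimes> z" "z \<otimes> (inv z \<otimes> inv y) = inv y"
        using zc NG by (auto simp: inv_mult_group m_assoc[symmetric] subset_iff)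
      moreover have "\<theta> (y \<otimes> z) = \<theta> (z \<otimes> y)"
        using N.character_commute[OF _, of \<theta> y z] N.Irr_subset \<theta> y z by auto
      ultimately show "\<theta> (inv (inv z \<otimes> inv y)) * \<chi> (z \<otimes> (inv z \<otimes> inv y)) = \<chi> (inv y) * \<theta> (z \<otimes> y)"
        by simp
    qed
    finally have eq: "(\<Sum>y\<in>N. \<theta> (inv y) * \<chi> (z \<otimes> y)) = (\<Sum>y\<in>N. \<chi> (inv y) * \<theta> (z \<otimes> y))" .
    have "(\<Sum>y\<in>N. \<chi> (inv y) * \<theta> (z \<otimes> y)) * \<theta> \<one> = (\<Sum>y\<in>N. \<chi> (inv y) * \<theta> y) * \<theta> z"
      using N.Irr_sum_class_function[OF \<theta>, of z "\<lambda>y. \<chi> (inv y)"] z class_inv NG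
      by (auto simp: invN subset_iff)
    then show ?thesis
      using k eq by (auto simp: k_def field_simps)
  qed
  have clifford: "(\<Sum>x\<in>carrier G. \<theta> (x \<otimes> g \<otimes> inv x)) = \<omega> * \<chi> g"
    if "g \<in> N" and \<omega>: "\<omega> = (\<Sum>y\<in>carrier G. (\<Sum>x\<in>carrier G. \<theta>0 (inv (x \<otimes> y \<otimes> inv x))) * \<chi> y) / (k * \<chi> \<one>)" for g \<omega>
  proof -
    have g: "g \<in> carrier G"
      using that NG by auto
    \<comment> \<open>The sum of the conjugates of \<open>\<theta>\<close>, extended by zero and
      read at inverses, is a class function of \<open>G\<close>. Its convolution with
      \<open>\<chi>\<close> is a multiple of \<open>\<chi>\<close> by irreducibility
      (\<open>A\<close>) and, conjugate by conjugate, \<open>k\<close> times the sum of conjugates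
      of \<open>\<theta>\<close> (\<open>B\<close>).\<close>
    define c where "c y = (\<Sum>x\<in>carrier G. \<theta>0 (inv (x \<otimes> y \<otimes> inv x)))" for y
    have "c (z \<otimes> y \<otimes> inv z) = c y" if zy: "z \<in> carrier G" "y \<in> carrier G" for z y
    proof -
      have "c (z \<otimes> y \<otimes> inv z) = (\<Sum>x\<in>carrier G. \<theta>0 (inv ((x \<otimes> z) \<otimes> y \<otimes> inv (x \<otimes> z))))"
        unfolding c_def using zy by (intro sum.cong refl) (simp add: inv_mult_group m_assoc)
      also have "\<dots> = c y"
        unfolding c_def using zy(1) by (rule sum_right_translate)
      finally show ?thesis .
    qed
    then have A: "(\<Sum>y\<in>carrier G. c y * \<chi> (g \<otimes> y)) * \<chi> \<one> = (\<Sum>y\<in>carrier G. c y * \<chi> y) * \<chi> g"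
      by (rule Irr_sum_class_function[OF \<chi> g])
    have "(\<Sum>y\<in>carrier G. c y * \<chi> (g \<otimes> y))
        = (\<Sum>x\<in>carrier G. \<Sum>y\<in>carrier G. \<theta>0 (inv (x \<otimes> y \<otimes> inv x)) * \<chi> (g \<otimes> y))"
      unfolding c_def sum_distrib_right by (rule sum.swap)
    also have "\<dots> = (\<Sum>x\<in>carrier G. k * \<theta> (x \<otimes> g \<otimes> inv x))"
    proof (rule sum.cong[OF refl])
      fix x assume x: "x \<in> carrier G"
      have "(\<Sum>y\<in>carrier G. \<theta>0 (inv (x \<otimes> y \<otimes> inv x)) * \<chi> (g \<otimes> y))
          = (\<Sum>y\<in>carrier G. \<theta>0 (inv (x \<otimes> y \<otimes> inv x)) * \<chi> ((x \<otimes> g \<otimes> inv x) \<otimes> (x \<otimes> y \<otimes> inv x)))"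
      proof (rule sum.cong[OF refl])
        fix y assume y: "y \<in> carrier G"
        have "(x \<otimes> g \<otimes> inv x) \<otimes> (x \<otimes> y \<otimes> inv x) = x \<otimes> (g \<otimes> y) \<otimes> inv x"
          using x y g by (simp add: m_assoc) (simp add: m_assoc[symmetric])
        then show "\<theta>0 (inv (x \<otimes> y \<otimes> inv x)) * \<chi> (g \<otimes> y)
            = \<theta>0 (inv (x \<otimes> y \<otimes> inv x)) * \<chi> ((x \<otimes> g \<otimes> inv x) \<otimes> (x \<otimes> y \<otimes> inv x))"
          using character_conj[OF ch x, of "g \<otimes> y"] g y by simp
      qed
      also have "\<dots> = (\<Sum>y\<in>carrier G. \<theta>0 (inv y) * \<chi> ((x \<otimes> g \<otimes> inv x) \<otimes> y))"
        by (rule sum_conj[OF x])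
      also have "\<dots> = (\<Sum>y\<in>N. \<theta> (inv y) * \<chi> ((x \<otimes> g \<otimes> inv x) \<otimes> y))"
        unfolding sum_over_subgroup[OF N, symmetric]
      proof (rule sum.cong[OF refl])
        fix y assume y: "y \<in> carrier G"
        have "inv y \<in> N \<longleftrightarrow> y \<in> N"
          using invNN y by (metis inv_inv)
        then show "\<theta>0 (inv y) * \<chi> ((x \<otimes> g \<otimes> inv x) \<otimes> y)
            = (if y \<in> N then \<theta> (inv y) * \<chi> ((x \<otimes> g \<otimes> inv x) \<otimes> y) else 0)"
          by (simp add: \<theta>0_def)
      qed
      also have "\<dots> = k * \<theta> (x \<otimes> g \<otimes> inv x)"
        using convN normal[OF x \<open>g \<in> N\<close>] by simp
      finally show "(\<Sum>y\<in>carrier G. \<theta>0 (inv (x \<otimes> y \<otimes> inv x)) * \<chi> (g \<otimes> y)) = k * \<theta> (x \<otimes> g \<otimes> inv x)" .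
    qed
    finally have B: "(\<Sum>y\<in>carrier G. c y * \<chi> (g \<otimes> y)) = k * (\<Sum>x\<in>carrier G. \<theta> (x \<otimes> g \<otimes> inv x))"
      by (simp add: sum_distrib_left)
    have "\<chi> \<one> \<noteq> 0"
      using Irr_degree[OF \<chi>] by (metis of_nat_eq_0_iff less_irrefl)
    then show ?thesis
      using A k unfolding B \<omega> c_def[symmetric] by (simp add: field_simps)
  qed
  define \<omega> where "\<omega> = (\<Sum>y\<in>carrier G. (\<Sum>x\<in>carrier G. \<theta>0 (inv (x \<otimes> y \<otimes> inv x))) * \<chi> y) / (k * \<chi> \<one>)"
  define M where "M = (of_nat (card N) :: complex)"
  have M: "M \<noteq> 0"
    using N.order_pos by (simp add: M_def)
  define \<mu>0 where "\<mu>0 y = (if y \<in> H then \<mu> y else 0)" for y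
  show ?thesis
  proof (rule induced_proportional_quasi_monomial[OF \<chi> H(1) \<mu>])
    fix g assume g: "g \<in> carrier G"
    show "induced_character G H \<mu> g = (d * \<omega> / (M * of_nat (card H))) * \<chi> g"
    proof (cases "g \<in> N")
      case False
      then have "x \<otimes> g \<otimes> inv x \<notin> H" if "x \<in> carrier G" for x
        using normal_iff[OF that g] H(2) by blast
      then have "induced_character G H \<mu> g = 0"
        using g by (simp add: induced_character_eq)
      then show ?thesis
        using vanish[OF g False] by simp
    next
      case True
      \<comment> \<open>Replacing \<open>x\<close> by \<open>b \<otimes> x\<close> for every
        \<open>b\<close> in \<open>N\<close> and swapping the sums exposes the inner sum over
        \<open>N\<close> that \<open>ind\<close> evaluates.\<close>
      have "M * (\<Sum>x\<in>carrier G. \<mu>0 (x \<otimes> g \<otimes> inv x))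
          = (\<Sum>b\<in>N. \<Sum>x\<in>carrier G. \<mu>0 ((b \<otimes> x) \<otimes> g \<otimes> inv (b \<otimes> x)))"
        using sum_left_translate[where f = "\<lambda>x. \<mu>0 (x \<otimes> g \<otimes> inv x)"] NG
        by (simp add: M_def subset_iff)
      also have "\<dots> = (\<Sum>x\<in>carrier G. \<Sum>b\<in>N. \<mu>0 (b \<otimes> (x \<otimes> g \<otimes> inv x) \<otimes> inv b))"
        using g NG by (subst sum.swap) (auto intro!: sum.cong simp: inv_mult_group m_assoc subset_iff)
      also have "\<dots> = (\<Sum>x\<in>carrier G. d * \<theta> (x \<otimes> g \<otimes> inv x))"
        using ind normal True by (intro sum.cong refl) (simp add: \<mu>0_def)
      also have "\<dots> = d * (\<omega> * \<chi> g)"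
        using clifford[OF True \<omega>_def] by (simp flip: sum_distrib_left)
      finally have "(\<Sum>x\<in>carrier G. \<mu>0 (x \<otimes> g \<otimes> inv x)) = d * \<omega> * \<chi> g / M"
        using M by (simp add: nonzero_eq_divide_eq mult_ac)
      then show ?thesis
        using g by (simp add: induced_character_eq \<mu>0_def)
    qed
  qed
qed

text \<open>If \<open>\<chi>\<close> does not vanish off \<open>N\<close>, it is orthogonal to its
  twists by the powers \<beta>^j with 0 < j < p. Summing all inner products over j < p leaves the
  norm of \<open>\<chi>\<close> on one side and, because the powers of \<open>\<beta> g\<close>
  cancel for g outside \<open>N\<close>, \<open>p\<close> times the sum over \<open>N\<close> on the
  other. So the restriction has norm one.\<close>

lemma Irr_restrict_prime_index:
  assumes \<chi>: "\<chi> \<in> Irr G" and N: "subgroup N G" and p: "prime p" "p * card N = card (carrier G)"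
    and \<beta>: "\<beta> \<in> linear_characters G" "\<And>g. g \<in> carrier G \<Longrightarrow> \<beta> g ^ p = 1"
      "\<And>g. g \<in> carrier G \<Longrightarrow> \<beta> g = 1 \<longleftrightarrow> g \<in> N"
    and not_vanish: "\<exists>g\<in>carrier G - N. \<chi> g \<noteq> 0"
  shows "restrict \<chi> N \<in> Irr (G\<lparr>carrier := N\<rparr>)"
proof -
  interpret N: finite_group "G\<lparr>carrier := N\<rparr>"
    by (rule subgroup_finite_group[OF N])
  have ch: "\<chi> \<in> characters G"
    using \<chi> Irr_subset by blast
  have NG: "N \<subseteq> carrier G"
    using subgroup.subset[OF N] .
  have invN: "inv\<^bsub>G\<lparr>carrier := N\<rparr>\<^esub> y = inv y" "inv y \<in> N" if "y \<in> N" for y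
    using m_inv_consistent[OF N that] subgroup.m_inv_closed[OF N that] by simp_all
  note B = linear_charactersD[OF \<beta>(1)]
  have zero: "(\<Sum>g\<in>carrier G. \<chi> g * \<beta> g ^ j * \<chi> (inv g)) = 0" if j: "0 < j" "j < p" for j
  proof (rule ccontr)
    assume nz: "(\<Sum>g\<in>carrier G. \<chi> g * \<beta> g ^ j * \<chi> (inv g)) \<noteq> 0"
    define \<mu> where "\<mu> = (\<lambda>g\<in>carrier G. \<beta> g ^ j)"
    have \<mu>: "\<mu> \<in> linear_characters G"
      by (rule linear_charactersI) (auto simp: \<mu>_def B(1,3) power_mult_distrib)
    define \<psi> where "\<psi> = (\<lambda>g\<in>carrier G. \<chi> g * \<mu> g)"
    have "(\<Sum>g\<in>carrier G. \<psi> g * \<psi> (inv g)) = (\<Sum>g\<in>carrier G. \<chi> g * \<chi> (inv g))"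
      using linear_charactersD(4)[OF \<mu>]
      by (intro sum.cong refl) (simp add: \<psi>_def mult_ac)
    then have \<psi>: "\<psi> \<in> Irr G"
      using Irr_norm[OF \<chi>] character_mult_linear[OF ch \<mu>]
      by (intro character_norm_one_Irr) (simp_all add: \<psi>_def)
    have "(\<Sum>y\<in>carrier G. \<psi> y * \<chi> (inv y)) \<noteq> 0"
      using nz by (simp add: \<psi>_def \<mu>_def cong: sum.cong)
    then have propor: "\<psi> g * \<chi> \<one> = \<chi> g * \<psi> \<one>" if "g \<in> carrier G" for g
      using Irr_proportional[OF \<chi> \<psi> _ that] by blast
    have "\<chi> \<one> \<noteq> 0"
      by (rule Irr_degree[OF \<chi>]) simp
    moreover have "\<psi> \<one> = \<chi> \<one>"
      by (simp add: \<psi>_def \<mu>_def B(1))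
    ultimately have "\<chi> g * \<beta> g ^ j = \<chi> g" if "g \<in> carrier G" for g
      using propor[OF that] that by (simp add: \<psi>_def \<mu>_def)
    \<comment> \<open>Off \<open>N\<close> the value \<open>\<beta> g\<close> is a nontrivial root
      of unity of prime order \<open>p\<close>. A twist that equals \<open>\<chi>\<close> therefore
      forces \<open>\<chi> g = 0\<close> there.\<close>
    moreover have "\<beta> g ^ j \<noteq> 1" if "g \<in> carrier G - N" for g
      using root_of_unity_prime[OF p(1) \<beta>(2) _ j, of g] \<beta>(3)[of g] that by blast
    ultimately have "\<chi> g = 0" if "g \<in> carrier G - N" for g
      using that by force
    then show False
      using not_vanish by blast
  qed
  have geo: "(\<Sum>j<p. \<beta> g ^ j) = (if g \<in> N then of_nat p else 0)" if "g \<in> carrier G" for g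
    using root_of_unity_sum[OF \<beta>(2)[OF that]] \<beta>(3)[OF that] by simp
  have "(\<Sum>j<p. \<Sum>g\<in>carrier G. \<chi> g * \<beta> g ^ j * \<chi> (inv g)) = (\<Sum>j<p. if j = 0 then of_nat (card (carrier G)) else 0)"
    using zero Irr_norm[OF \<chi>] by (intro sum.cong refl) auto
  also have "\<dots> = of_nat (card (carrier G))"
    using prime_gt_0_nat[OF p(1)] by simp
  finally have "of_nat (card (carrier G)) = (\<Sum>g\<in>carrier G. \<Sum>j<p. \<chi> g * \<beta> g ^ j * \<chi> (inv g))"
    by (subst sum.swap) simp
  also have "\<dots> = (\<Sum>g\<in>carrier G. \<chi> g * \<chi> (inv g) * (\<Sum>j<p. \<beta> g ^ j))"
    by (simp add: sum_distrib_left mult_ac)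
  also have "\<dots> = (\<Sum>g\<in>carrier G. if g \<in> N then of_nat p * (\<chi> g * \<chi> (inv g)) else 0)"
    by (intro sum.cong refl) (simp add: geo)
  also have "\<dots> = of_nat p * (\<Sum>g\<in>N. \<chi> g * \<chi> (inv g))"
    by (simp add: sum_over_subgroup[OF N] sum_distrib_left)
  finally have "of_nat p * (\<Sum>g\<in>N. \<chi> g * \<chi> (inv g)) = of_nat p * (of_nat (card N) :: complex)"
    by (metis of_nat_mult p(2))
  then have norm: "(\<Sum>g\<in>N. \<chi> g * \<chi> (inv g)) = of_nat (card N)"
    using prime_gt_0_nat[OF p(1)] by simp
  show ?thesis
    by (rule N.character_norm_one_Irr[OF character_restrict[OF N ch]])
      (use norm in \<open>simp add: invN cong: sum.cong\<close>)
qed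

end

section \<open>Irreducible characters of direct powers\<close>

context finite_group
begin

text \<open>Equal norms give \<open>c\<^sup>2 = 1\<close>, and positive degrees exclude
  \<open>c = -1\<close>.\<close>

lemma Irr_eqI:
  assumes \<chi>: "\<chi> \<in> Irr G" and \<psi>: "\<psi> \<in> Irr G"
    and eq: "\<And>g. g \<in> carrier G \<Longrightarrow> \<chi> g = c * \<psi> g"
  shows "\<chi> = \<psi>"
proof -
  obtain n m where n: "0 < n" "\<chi> \<one> = of_nat n" and m: "0 < m" "\<psi> \<one> = of_nat m"
    using Irr_degree[OF \<chi>] Irr_degree[OF \<psi>] by metis
  have "(\<Sum>x\<in>carrier G. \<chi> x * \<chi> (inv x)) = c\<^sup>2 * (\<Sum>x\<in>carrier G. \<psi> x * \<psi> (inv x))"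
    by (simp add: eq sum_distrib_left power2_eq_square mult_ac)
  then have c: "c\<^sup>2 = 1"
    unfolding Irr_norm[OF \<chi>] Irr_norm[OF \<psi>] using order_pos by simp
  have cm: "of_nat n = c * of_nat m"
    using eq[of \<one>] n(2) m(2) by simp
  then have "(of_nat n :: complex)\<^sup>2 = (of_nat m)\<^sup>2"
    by (simp add: power_mult_distrib c)
  then have "n\<^sup>2 = m\<^sup>2"
    by (metis of_nat_eq_iff of_nat_power)
  then have "c = 1"
    using cm n m by simp
  then show ?thesis
    using eq \<chi> \<psi> Irr_subset character_extensional
    by (intro extensionalityI[of _ "carrier G"]) auto
qed

text \<open>The element of the group algebra given by \<open>\<phi>\<close> on the embedded factor \<open>A\<close> is central, hence
  acts as a scalar in the representation affording \<open>\<theta>\<close>.\<close>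

lemma Irr_split_factor:
  assumes A: "finite_group A" and hom: "\<iota> \<in> hom A G" and inj: "inj_on \<iota> (carrier A)"
    and inner: "\<And>x. x \<in> carrier G \<Longrightarrow> \<exists>u\<in>carrier A. \<forall>a\<in>carrier A.
      x \<otimes> \<iota> a \<otimes> inv x = \<iota> (u \<otimes>\<^bsub>A\<^esub> a \<otimes>\<^bsub>A\<^esub> inv\<^bsub>A\<^esub> u)"
    and \<theta>: "\<theta> \<in> Irr G" and \<phi>: "\<phi> \<in> Irr A"
    and nz: "(\<Sum>a\<in>carrier A. \<theta> (\<iota> a) * \<phi> (inv\<^bsub>A\<^esub> a)) \<noteq> 0"
    and g: "g \<in> carrier G" and comm: "\<And>a. a \<in> carrier A \<Longrightarrow> g \<otimes> \<iota> a = \<iota> a \<otimes> g"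
    and n: "n \<in> carrier A"
  shows "\<theta> (g \<otimes> \<iota> n) * \<phi> \<one>\<^bsub>A\<^esub> = \<phi> n * \<theta> g"
proof -
  interpret A: finite_group A by fact
  have ch: "\<theta> \<in> characters G" "\<phi> \<in> characters A"
    using \<theta> \<phi> Irr_subset A.Irr_subset by auto
  have \<iota>: "\<iota> a \<in> carrier G" if "a \<in> carrier A" for a
    using hom that by (auto simp: hom_def)
  have \<iota>_mult: "\<iota> (a \<otimes>\<^bsub>A\<^esub> b) = \<iota> a \<otimes> \<iota> b" if "a \<in> carrier A" "b \<in> carrier A" for a b
    using hom_mult[OF hom that] .
  have \<iota>_inv: "\<iota> (inv\<^bsub>A\<^esub> a) = inv \<iota> a" if "a \<in> carrier A" for a
    using group_hom.hom_inv[of A G \<iota> a] hom that A.group_axioms group_axioms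
    by (simp add: group_hom_def group_hom_axioms_def)
  have \<iota>_one: "\<iota> \<one>\<^bsub>A\<^esub> = \<one>"
    using hom_one[OF hom A.group_axioms group_axioms] .
  \<comment> \<open>\<phi> at inverses, transported to the image of \<open>\<iota>\<close> and
    extended by zero. By \<open>inner\<close>, conjugation in \<open>G\<close> acts on this image as
    inner automorphisms of \<open>A\<close>, so \<open>c\<close> is a class function on
    \<open>G\<close>.\<close>
  define c where "c y = (if y \<in> \<iota> ` carrier A then \<phi> (inv\<^bsub>A\<^esub> (the_inv_into (carrier A) \<iota> y)) else 0)" for y
  have c\<iota>: "c (\<iota> a) = \<phi> (inv\<^bsub>A\<^esub> a)" if "a \<in> carrier A" for a
    using that inj by (simp add: c_def the_inv_into_f_f)
  have c_class: "c (x \<otimes> y \<otimes> inv x) = c y" if x: "x \<in> carrier G" and y: "y \<in> carrier G" for x y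
  proof (cases "y \<in> \<iota> ` carrier A")
    case True
    then obtain a where a: "a \<in> carrier A" "y = \<iota> a" by blast
    obtain u where u: "u \<in> carrier A" "x \<otimes> \<iota> a \<otimes> inv x = \<iota> (u \<otimes>\<^bsub>A\<^esub> a \<otimes>\<^bsub>A\<^esub> inv\<^bsub>A\<^esub> u)"
      using inner[OF x] a(1) by blast
    have "\<phi> (inv\<^bsub>A\<^esub> (u \<otimes>\<^bsub>A\<^esub> a \<otimes>\<^bsub>A\<^esub> inv\<^bsub>A\<^esub> u)) = \<phi> (inv\<^bsub>A\<^esub> a)"
      using A.character_conj[OF ch(2) u(1), of "inv\<^bsub>A\<^esub> a"] u(1) a(1) by (simp add: A.inv_mult_group A.m_assoc)
    then show ?thesis
      using a u by (simp add: c\<iota>)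
  next
    case False
    have "x \<otimes> y \<otimes> inv x \<notin> \<iota> ` carrier A"
    proof
      assume "x \<otimes> y \<otimes> inv x \<in> \<iota> ` carrier A"
      then obtain a where a: "a \<in> carrier A" "x \<otimes> y \<otimes> inv x = \<iota> a" by blast
      obtain u where u: "u \<in> carrier A"
        "inv x \<otimes> \<iota> a \<otimes> inv (inv x) = \<iota> (u \<otimes>\<^bsub>A\<^esub> a \<otimes>\<^bsub>A\<^esub> inv\<^bsub>A\<^esub> u)"
        using inner[OF inv_closed[OF x]] a(1) by blast
      have "inv x \<otimes> \<iota> a \<otimes> inv (inv x) = y"
        unfolding a(2)[symmetric] using x y by (simp add: m_assoc) (simp add: m_assoc[symmetric])
      then show False
        using False u a(1) by auto
    qed
    with False show ?thesis
      by (simp add: c_def)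
  qed
  have sumc: "(\<Sum>y\<in>carrier G. c y * f y) = (\<Sum>a\<in>carrier A. \<phi> (inv\<^bsub>A\<^esub> a) * f (\<iota> a))" for f
  proof -
    have "(\<Sum>y\<in>carrier G. c y * f y) = (\<Sum>y\<in>\<iota> ` carrier A. c y * f y)"
      using \<iota> fin by (intro sum.mono_neutral_right) (auto simp: c_def)
    also have "\<dots> = (\<Sum>a\<in>carrier A. \<phi> (inv\<^bsub>A\<^esub> a) * f (\<iota> a))"
      by (subst sum.reindex[OF inj]) (auto simp: c\<iota> intro!: sum.cong)
    finally show ?thesis .
  qed
  define \<omega> where "\<omega> = (\<Sum>a\<in>carrier A. \<phi> (inv\<^bsub>A\<^esub> a) * \<theta> (\<iota> a))"
  have \<omega>: "\<omega> \<noteq> 0"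
    using nz by (simp add: \<omega>_def mult.commute)
  have 1: "(\<Sum>a\<in>carrier A. \<phi> (inv\<^bsub>A\<^esub> a) * \<theta> (z \<otimes> \<iota> a)) * \<theta> \<one> = \<omega> * \<theta> z" if "z \<in> carrier G" for z
    using Irr_sum_class_function[OF \<theta> that c_class] unfolding sumc \<omega>_def .
  \<comment> \<open>Because \<open>g\<close> commutes with the image of \<open>\<iota>\<close>, this
    is a class function on \<open>A\<close>; the sum in fact \<open>1\<close> can thus also be
    evaluated inside \<open>A\<close>, as a multiple of \<open>\<phi>\<close>.\<close>
  define d where "d a = \<theta> (g \<otimes> \<iota> (inv\<^bsub>A\<^esub> a))" for a
  have d_class: "d (x \<otimes>\<^bsub>A\<^esub> y \<otimes>\<^bsub>A\<^esub> inv\<^bsub>A\<^esub> x) = d y" if x: "x \<in> carrier A" and y: "y \<in> carrier A" for x y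
  proof -
    have "g \<otimes> \<iota> (inv\<^bsub>A\<^esub> (x \<otimes>\<^bsub>A\<^esub> y \<otimes>\<^bsub>A\<^esub> inv\<^bsub>A\<^esub> x)) = g \<otimes> \<iota> x \<otimes> (\<iota> (inv\<^bsub>A\<^esub> y) \<otimes> inv \<iota> x)"
      using x y g \<iota> by (simp add: A.inv_mult_group \<iota>_mult \<iota>_inv m_assoc)
    also have "\<dots> = \<iota> x \<otimes> (g \<otimes> \<iota> (inv\<^bsub>A\<^esub> y)) \<otimes> inv \<iota> x"
      unfolding comm[OF x] using x y g \<iota> by (simp add: m_assoc)
    finally show ?thesis
      unfolding d_def using character_conj[OF ch(1)] x y g \<iota> by simp
  qed
  have 2: "(\<Sum>a\<in>carrier A. \<phi> (inv\<^bsub>A\<^esub> a) * \<theta> (g \<otimes> \<iota> z \<otimes> \<iota> a)) * \<phi> \<one>\<^bsub>A\<^esub>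
      = (\<Sum>a\<in>carrier A. d a * \<phi> a) * \<phi> z" if z: "z \<in> carrier A" for z
  proof -
    have "(\<Sum>a\<in>carrier A. \<phi> (inv\<^bsub>A\<^esub> a) * \<theta> (g \<otimes> \<iota> z \<otimes> \<iota> a))
        = (\<Sum>a\<in>carrier A. \<phi> (inv\<^bsub>A\<^esub> (inv\<^bsub>A\<^esub> z \<otimes>\<^bsub>A\<^esub> (z \<otimes>\<^bsub>A\<^esub> a))) * \<theta> (g \<otimes> \<iota> (z \<otimes>\<^bsub>A\<^esub> a)))"
      using z g \<iota> by (intro sum.cong refl) (simp add: \<iota>_mult m_assoc A.m_assoc[symmetric])
    also have "\<dots> = (\<Sum>a\<in>carrier A. \<phi> (inv\<^bsub>A\<^esub> (inv\<^bsub>A\<^esub> z \<otimes>\<^bsub>A\<^esub> a)) * \<theta> (g \<otimes> \<iota> a))"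
      by (rule A.sum_left_translate[OF z])
    also have "\<dots> = (\<Sum>a\<in>carrier A. \<phi> (inv\<^bsub>A\<^esub> (inv\<^bsub>A\<^esub> z \<otimes>\<^bsub>A\<^esub> inv\<^bsub>A\<^esub> a)) * \<theta> (g \<otimes> \<iota> (inv\<^bsub>A\<^esub> a)))"
      by (rule A.sum_inv[symmetric])
    also have "\<dots> = (\<Sum>a\<in>carrier A. d a * \<phi> (z \<otimes>\<^bsub>A\<^esub> a))"
      using z by (intro sum.cong refl)
        (simp add: d_def A.inv_mult_group A.character_commute[OF ch(2), of z] mult.commute)
    finally show ?thesis
      using A.Irr_sum_class_function[OF \<phi> z d_class] by simp
  qed
  have nz': "\<theta> \<one> \<noteq> 0" "\<phi> \<one>\<^bsub>A\<^esub> \<noteq> 0"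
    by (rule Irr_degree[OF \<theta>], simp) (rule A.Irr_degree[OF \<phi>], simp)
  define D where "D = (\<Sum>a\<in>carrier A. d a * \<phi> a)"
  \<comment> \<open>The two evaluations compared. Taking \<open>z\<close> to be the identity
    determines \<open>D\<close>, and \<open>z = n\<close> then gives the claim.\<close>
  have *: "\<omega> * \<theta> (g \<otimes> \<iota> z) * \<phi> \<one>\<^bsub>A\<^esub> = D * \<phi> z * \<theta> \<one>" if "z \<in> carrier A" for z
    unfolding D_def 2[OF that, symmetric] using that g \<iota> by (subst 1[symmetric]) simp_all
  have "\<omega> * \<theta> g * \<phi> \<one>\<^bsub>A\<^esub> = D * \<phi> \<one>\<^bsub>A\<^esub> * \<theta> \<one>"
    using *[of "\<one>\<^bsub>A\<^esub>"] g by (simp add: \<iota>_one)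
  then have "\<omega> * \<theta> g = D * \<theta> \<one>"
    using nz' by simp
  then have "\<omega> * (\<theta> (g \<otimes> \<iota> n) * \<phi> \<one>\<^bsub>A\<^esub>) = \<omega> * (\<phi> n * \<theta> g)"
    using *[OF n] by (simp add: mult_ac)
  then show ?thesis
    using \<omega> by simp
qed

lemma carrier_direct_power: "carrier (direct_power G p) = ({..<p} \<rightarrow>\<^sub>E carrier G)"
  by (simp add: direct_power_def)

lemma mult_direct_power: "x \<otimes>\<^bsub>direct_power G p\<^esub> y = (\<lambda>i\<in>{..<p}. x i \<otimes> y i)"
  by (simp add: direct_power_def)

lemma one_direct_power: "\<one>\<^bsub>direct_power G p\<^esub> = (\<lambda>i\<in>{..<p}. \<one>)"
  by (simp add: direct_power_def)

lemma inv_direct_power: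
  "x \<in> carrier (direct_power G p) \<Longrightarrow> inv\<^bsub>direct_power G p\<^esub> x = (\<lambda>i\<in>{..<p}. inv x i)"
  by (simp add: direct_power_def group_axioms)

lemma finite_group_direct_power: "finite_group (direct_power G p)"
  unfolding finite_group_def finite_group_axioms_def
  using fin by (auto simp: direct_power_def group_axioms intro!: finite_PiE)

lemma sum_PiE_prod:
  fixes p :: nat
  assumes "\<And>i. i < p \<Longrightarrow> S i \<subseteq> carrier G"
  shows "(\<Sum>b\<in>PiE {..<p} S. \<Prod>i<p. f i (b i)) = (\<Prod>i<p. \<Sum>a\<in>S i. (f i a :: complex))"
  using assms finite_subset[OF _ fin] by (subst prod_sum_PiE) auto

definition coordinate_embedding :: "nat \<Rightarrow> nat \<Rightarrow> 'a \<Rightarrow> nat \<Rightarrow> 'a" where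
  "coordinate_embedding p i a = (\<lambda>j\<in>{..<p}. if j = i then a else \<one>)"

lemma coordinate_embedding_hom: "coordinate_embedding p i \<in> hom G (direct_power G p)"
  by (auto simp: hom_def carrier_direct_power mult_direct_power coordinate_embedding_def)

text \<open>Each \<open>\<phi> i\<close> is a constituent of the restriction of
  \<open>\<theta>\<close> to the embedded factor \<open>i\<close>. Splitting off the factors one by
  one shows that \<open>\<theta>\<close> is proportional to the product of the
  \<open>\<phi> i\<close>, and comparing norms shows that the two agree.\<close>

lemma Irr_direct_power:
  assumes \<theta>: "\<theta> \<in> Irr (direct_power G p)"
  obtains \<phi> where "\<forall>i<p. \<phi> i \<in> Irr G" "\<theta> = outer_product G p \<phi>"
proof -
  define B where "B = direct_power G p"
  interpret B: finite_group B
    unfolding B_def by (rule finite_group_direct_power)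
  note defs = B_def carrier_direct_power mult_direct_power one_direct_power coordinate_embedding_def
  let ?\<iota> = "coordinate_embedding p"
  have \<theta>B: "\<theta> \<in> Irr B"
    using \<theta> by (simp add: B_def)
  then have \<theta>c: "\<theta> \<in> characters B"
    using B.Irr_subset by blast
  obtain N where N: "0 < N" "\<theta> \<one>\<^bsub>B\<^esub> = of_nat N"
    using B.Irr_degree[OF \<theta>B] .
  have \<iota>_hom: "?\<iota> i \<in> hom G B" for i
    unfolding B_def by (rule coordinate_embedding_hom)
  have "\<exists>\<phi>. \<phi> \<in> Irr G \<and> (\<Sum>a\<in>carrier G. \<theta> (?\<iota> i a) * \<phi> (inv a)) \<noteq> 0" for i
  proof -
    let ?\<chi> = "\<lambda>a\<in>carrier G. \<theta> (?\<iota> i a)"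
    have "?\<chi> \<in> characters G"
      by (rule B.character_pullback[OF finite_group_axioms \<iota>_hom \<theta>c])
    moreover have "?\<chi> \<one> \<noteq> 0"
      using N hom_one[OF \<iota>_hom group_axioms B.group_axioms] by simp
    ultimately obtain \<phi> where "\<phi> \<in> Irr G" "(\<Sum>a\<in>carrier G. ?\<chi> a * \<phi> (inv a)) \<noteq> 0"
      by (rule exists_Irr_constituent)
    then show ?thesis
      by (auto cong: sum.cong)
  qed
  then obtain \<phi> where \<phi>: "\<And>i. \<phi> i \<in> Irr G"
    "\<And>i. (\<Sum>a\<in>carrier G. \<theta> (?\<iota> i a) * \<phi> i (inv a)) \<noteq> 0"
    by metis
  define P where "P = (\<Prod>i<p. \<phi> i \<one>)"
  have step: "\<theta> b * \<phi> i \<one> = \<phi> i (b i) * \<theta> (b(i := \<one>))" if i: "i < p" and b: "b \<in> carrier B" for i b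
  proof -
    have bi: "b j \<in> carrier G" if "j < p" for j
      using b that by (auto simp: defs)
    have b': "b(i := \<one>) \<in> carrier B"
      using b i by (auto simp: defs PiE_iff extensional_def)
    have "b = b(i := \<one>) \<otimes>\<^bsub>B\<^esub> ?\<iota> i (b i)"
    proof (rule extensionalityI[of _ "{..<p}"])
      show "b j = (b(i := \<one>) \<otimes>\<^bsub>B\<^esub> ?\<iota> i (b i)) j" if "j \<in> {..<p}" for j
        using that i bi[of i] bi[of j] by (simp add: defs)
    qed (use b in \<open>auto simp: defs PiE_iff\<close>)
    \<comment> \<open>With coordinate \<open>i\<close> reset to the identity the remaining element
      commutes with the embedded factor, on which conjugation by \<open>x\<close> is conjugation by
      \<open>x i\<close>.\<close>
    moreover have "\<theta> (b(i := \<one>) \<otimes>\<^bsub>B\<^esub> ?\<iota> i (b i)) * \<phi> i \<one> = \<phi> i (b i) * \<theta> (b(i := \<one>))"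
    proof (rule B.Irr_split_factor[OF finite_group_axioms \<iota>_hom _ _ \<theta>B \<phi> b' _ bi[OF i]])
      show "inj_on (?\<iota> i) (carrier G)"
        using i by (intro inj_onI) (auto simp: coordinate_embedding_def dest: fun_cong[of _ _ i])
      show "\<exists>u\<in>carrier G. \<forall>a\<in>carrier G. x \<otimes>\<^bsub>B\<^esub> ?\<iota> i a \<otimes>\<^bsub>B\<^esub> inv\<^bsub>B\<^esub> x = ?\<iota> i (u \<otimes> a \<otimes> inv u)"
        if x: "x \<in> carrier B" for x
      proof (intro bexI ballI)
        show "x i \<in> carrier G"
          using x i by (auto simp: defs)
        have xj: "x j \<in> carrier G" if "j < p" for j
          using x that by (auto simp: defs)
        show "x \<otimes>\<^bsub>B\<^esub> ?\<iota> i a \<otimes>\<^bsub>B\<^esub> inv\<^bsub>B\<^esub> x = ?\<iota> i (x i \<otimes> a \<otimes> inv (x i))" if "a \<in> carrier G" for a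
          using x xj that by (auto simp: B_def mult_direct_power inv_direct_power coordinate_embedding_def fun_eq_iff)
      qed
      show "b(i := \<one>) \<otimes>\<^bsub>B\<^esub> ?\<iota> i a = ?\<iota> i a \<otimes>\<^bsub>B\<^esub> b(i := \<one>)" if "a \<in> carrier G" for a
        using that bi by (auto simp: defs fun_eq_iff)
    qed
    ultimately show ?thesis
      by simp
  qed
  \<comment> \<open>The coordinates below \<open>k\<close> have been split off and replaced by the
    identity.\<close>
  have iter: "\<theta> b * (\<Prod>i<k. \<phi> i \<one>) = (\<Prod>i<k. \<phi> i (b i)) * \<theta> (\<lambda>i\<in>{..<p}. if i < k then \<one> else b i)"
    if "k \<le> p" and b: "b \<in> carrier B" for k b
    using \<open>k \<le> p\<close>
  proof (induction k)
    case 0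
    have "(\<lambda>i\<in>{..<p}. b i) = b"
      using b by (auto simp: defs PiE_iff extensional_def fun_eq_iff)
    then show ?case
      by simp
  next
    case (Suc k)
    define b' where "b' = (\<lambda>i\<in>{..<p}. if i < k then \<one> else b i)"
    have bi: "b i \<in> carrier G" if "i < p" for i
      using b that by (auto simp: B_def carrier_direct_power)
    have b': "b' \<in> carrier B"
      unfolding B_def carrier_direct_power b'_def using bi by auto
    have b'k: "b' k = b k"
      using Suc.prems by (simp add: b'_def)
    have b'': "b'(k := \<one>) = (\<lambda>i\<in>{..<p}. if i < Suc k then \<one> else b i)"
    proof
      fix i show "(b'(k := \<one>)) i = (\<lambda>i\<in>{..<p}. if i < Suc k then \<one> else b i) i"
        using Suc.prems by (cases "i = k") (auto simp: b'_def)
    qed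
    have IH: "\<theta> b * (\<Prod>i<k. \<phi> i \<one>) = (\<Prod>i<k. \<phi> i (b i)) * \<theta> b'"
      unfolding b'_def by (rule Suc.IH) (use Suc.prems in simp)
    have "\<theta> b * (\<Prod>i<Suc k. \<phi> i \<one>) = (\<theta> b * (\<Prod>i<k. \<phi> i \<one>)) * \<phi> k \<one>"
      by simp
    also have "\<dots> = (\<Prod>i<k. \<phi> i (b i)) * (\<theta> b' * \<phi> k \<one>)"
      unfolding IH by simp
    also have "\<theta> b' * \<phi> k \<one> = \<phi> k (b k) * \<theta> (b'(k := \<one>))"
      using step[OF _ b', of k] Suc.prems b'k by simp
    also have "(\<Prod>i<k. \<phi> i (b i)) * (\<phi> k (b k) * \<theta> (b'(k := \<one>)))
        = (\<Prod>i<Suc k. \<phi> i (b i)) * \<theta> (b'(k := \<one>))"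
      by simp
    finally show ?case
      unfolding b'' .
  qed
  have full: "\<theta> b * P = (\<Prod>i<p. \<phi> i (b i)) * of_nat N" if b: "b \<in> carrier B" for b
  proof -
    have "(\<lambda>i\<in>{..<p}. if i < p then \<one> else b i) = \<one>\<^bsub>B\<^esub>"
      by (auto simp: defs fun_eq_iff)
    then show ?thesis
      using iter[OF order_refl b] N(2) by (simp add: P_def)
  qed
  have "\<exists>m>0. P = of_nat m"
  proof -
    have "\<exists>m>0. \<phi> i \<one> = of_nat m" for i
      using Irr_degree[OF \<phi>(1)] by metis
    then obtain m where m: "\<And>i. m i > 0" "\<And>i. \<phi> i \<one> = of_nat (m i)"
      by metis
    then show ?thesis
      by (intro exI[of _ "\<Prod>i<p. m i"]) (simp add: P_def prod_pos)
  qed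
  then obtain m where m: "0 < m" "P = of_nat m"
    by blast
  let ?M = "of_nat (card (carrier G)) ^ p :: complex"
  have "of_nat (card (carrier B)) = ?M"
    by (simp add: defs card_PiE)
  \<comment> \<open>Both \<theta> and the product of the \<open>\<phi> i\<close> have norm one, so
    the positive integers \<open>P\<close> and \<open>N\<close> have equal squares.\<close>
  then have "P\<^sup>2 * ?M = P\<^sup>2 * (\<Sum>b\<in>carrier B. \<theta> b * \<theta> (inv\<^bsub>B\<^esub> b))"
    by (simp add: B.Irr_norm[OF \<theta>B])
  also have "\<dots> = (\<Sum>b\<in>carrier B. (\<theta> b * P) * (\<theta> (inv\<^bsub>B\<^esub> b) * P))"
    by (simp add: sum_distrib_left power2_eq_square mult_ac)
  also have "\<dots> = (of_nat N)\<^sup>2 * (\<Sum>b\<in>carrier B. \<Prod>i<p. \<phi> i (b i) * \<phi> i (inv (b i)))"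
    unfolding sum_distrib_left
  proof (rule sum.cong[OF refl])
    fix b assume b: "b \<in> carrier B"
    have "(\<Prod>i<p. \<phi> i ((inv\<^bsub>B\<^esub> b) i)) = (\<Prod>i<p. \<phi> i (inv (b i)))"
      using b by (intro prod.cong) (auto simp: B_def inv_direct_power)
    then show "(\<theta> b * P) * (\<theta> (inv\<^bsub>B\<^esub> b) * P) = (of_nat N)\<^sup>2 * (\<Prod>i<p. \<phi> i (b i) * \<phi> i (inv (b i)))"
      using full[OF b] full[OF B.inv_closed[OF b]] by (simp add: power2_eq_square prod.distrib mult_ac)
  qed
  also have "(\<Sum>b\<in>carrier B. \<Prod>i<p. \<phi> i (b i) * \<phi> i (inv (b i)))
      = (\<Prod>i<p. \<Sum>a\<in>carrier G. \<phi> i a * \<phi> i (inv a))"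
    unfolding B_def carrier_direct_power by (rule sum_PiE_prod) simp
  also have "\<dots> = ?M"
    by (simp add: Irr_norm[OF \<phi>(1)])
  finally have "P\<^sup>2 = (of_nat N)\<^sup>2"
    using order_pos by simp
  then have "m\<^sup>2 = N\<^sup>2"
    unfolding m(2) by (metis of_nat_eq_iff of_nat_power)
  then have "P = of_nat N"
    using m N by simp
  then have "\<theta> b = (\<Prod>i<p. \<phi> i (b i))" if "b \<in> carrier B" for b
    using full[OF that] N(1) by simp
  then have eq: "\<theta> = outer_product G p \<phi>"
    using B.character_extensional[OF \<theta>c]
    by (intro extensionalityI[of _ "carrier B"]) (auto simp: outer_product_def B_def)
  show thesis
    by (rule that[OF _ eq]) (simp add: \<phi>(1))
qed

text \<open>The restriction of \<open>\<theta>\<close> to factor \<open>i\<close> is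
  \<open>\<phi> i\<close> times the product of the other degrees. Equal restrictions make the
  \<open>\<phi> i\<close> proportional, hence equal by \<open>Irr_eqI\<close>.\<close>

lemma Irr_direct_power_invariant:
  assumes \<theta>: "\<theta> \<in> Irr (direct_power G p)" and "0 < p"
    and inv: "\<And>i a. i < p \<Longrightarrow> a \<in> carrier G
      \<Longrightarrow> \<theta> (coordinate_embedding p i a) = \<theta> (coordinate_embedding p 0 a)"
  obtains \<phi> where "\<phi> \<in> Irr G" "\<theta> = outer_product G p (\<lambda>_. \<phi>)"
proof -
  obtain \<phi> where Irr: "\<forall>i<p. \<phi> i \<in> Irr G" and eq: "\<theta> = outer_product G p \<phi>"
    using Irr_direct_power[OF \<theta>] .
  then have \<phi>: "\<phi> i \<in> Irr G" if "i < p" for i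
    using that by blast
  have nz: "\<phi> i \<one> \<noteq> 0" if "i < p" for i
    by (rule Irr_degree[OF \<phi>[OF that]]) simp
  have \<theta>_coord: "\<theta> (coordinate_embedding p i a) = \<phi> i a * (\<Prod>j\<in>{..<p} - {i}. \<phi> j \<one>)"
    if i: "i < p" and a: "a \<in> carrier G" for i a
  proof -
    have "\<theta> (coordinate_embedding p i a) = (\<Prod>j<p. \<phi> j (if j = i then a else \<one>))"
      using a by (auto simp: eq outer_product_def carrier_direct_power coordinate_embedding_def intro!: prod.cong)
    also have "\<dots> = \<phi> i a * (\<Prod>j\<in>{..<p} - {i}. \<phi> j \<one>)"
      using i by (subst prod.remove[of _ i]) auto
    finally show ?thesis .
  qed
  have "\<phi> i = \<phi> 0" if i: "i < p" for i
  proof (rule Irr_eqI[OF \<phi>[OF i] \<phi>[OF \<open>0 < p\<close>]])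
    fix a assume a: "a \<in> carrier G"
    have "(\<Prod>j\<in>{..<p} - {i}. \<phi> j \<one>) \<noteq> 0"
      using nz by simp
    then show "\<phi> i a = ((\<Prod>j\<in>{..<p} - {0}. \<phi> j \<one>) / (\<Prod>j\<in>{..<p} - {i}. \<phi> j \<one>)) * \<phi> 0 a"
      using inv[OF i a] unfolding \<theta>_coord[OF i a] \<theta>_coord[OF \<open>0 < p\<close> a] by (simp add: nonzero_eq_divide_eq mult_ac)
  qed
  note \<phi>0 = this
  have "outer_product G p \<phi> = outer_product G p (\<lambda>_. \<phi> 0)"
    unfolding outer_product_def
  proof (intro restrict_ext prod.cong refl)
    fix a :: "nat \<Rightarrow> 'a" and i assume "i \<in> {..<p}"
    then show "\<phi> i (a i) = \<phi> 0 (a i)"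
      using \<phi>0[of i] by (metis lessThan_iff)
  qed
  then show thesis
    using that[OF \<phi>[OF \<open>0 < p\<close>]] eq by metis
qed

end

section \<open>The wreath product with a cyclic group of prime order\<close>

locale prime_wreath = finite_group A for A (structure) +
  fixes p :: nat
  assumes prime: "prime p" and nontrivial: "carrier A \<noteq> {\<one>}"
begin

abbreviation "B \<equiv> direct_power A p"
abbreviation "T \<equiv> shift_group A p"
abbreviation "W \<equiv> semidirect_product B T"

sublocale B: finite_group B
  by (rule finite_group_direct_power)

lemma p_pos: "0 < p"
  using prime_gt_0_nat[OF prime] .

text \<open>Since \<open>p - 1 \<equiv> -1\<close> modulo \<open>p\<close>, this is the \<open>k\<close>-th power of the cyclic shift.\<close>

definition rotation :: "nat \<Rightarrow> (nat \<Rightarrow> 'a) \<Rightarrow> nat \<Rightarrow> 'a" where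
  "rotation k = (\<lambda>a\<in>carrier B. \<lambda>i\<in>{..<p}. a ((i + (p - Suc 0) * k) mod p))"

lemma base_mem: "a \<in> carrier B \<Longrightarrow> i < p \<Longrightarrow> a i \<in> carrier A"
  by (auto simp: carrier_direct_power)

lemma base_eqI:
  assumes "a \<in> carrier B" "b \<in> carrier B" "\<And>i. i < p \<Longrightarrow> a i = b i"
  shows "a = b"
  by (rule PiE_ext[OF assms(1,2)[unfolded carrier_direct_power]]) (use assms(3) in simp)

lemma rotation_apply:
  "a \<in> carrier B \<Longrightarrow> i < p \<Longrightarrow> rotation k a i = a ((i + (p - Suc 0) * k) mod p)"
  by (simp add: rotation_def)

lemma rotation_closed:
  assumes "a \<in> carrier B"
  shows "rotation k a \<in> carrier B"
proof -
  have "a (j mod p) \<in> carrier A" for j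
    using base_mem[OF assms] p_pos by simp
  then have "(\<lambda>i\<in>{..<p}. a ((i + (p - Suc 0) * k) mod p)) \<in> {..<p} \<rightarrow>\<^sub>E carrier A"
    by (intro restrict_PiE_iff[THEN iffD2] ballI)
  then show ?thesis
    using assms by (simp only: rotation_def restrict_apply if_True carrier_direct_power)
qed

lemma rotation_extensional: "rotation k \<in> extensional (carrier B)"
  by (simp add: rotation_def)

lemma rotation_rotation:
  assumes "a \<in> carrier B"
  shows "rotation k (rotation l a) = rotation (k + l) a"
proof (rule base_eqI)
  fix i assume i: "i < p"
  have "((i + (p - Suc 0) * k) mod p + (p - Suc 0) * l) mod p = (i + (p - Suc 0) * (k + l)) mod p"
    by (simp add: mod_add_left_eq distrib_left add.assoc)
  then show "rotation k (rotation l a) i = rotation (k + l) a i"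
    using assms i p_pos by (simp add: rotation_apply rotation_closed)
qed (use assms rotation_closed in auto)

lemma rotation_mod: "rotation (k mod p) = rotation k"
proof -
  have "(i + (p - Suc 0) * (k mod p)) mod p = (i + (p - Suc 0) * k) mod p" for i
    by (metis mod_add_right_eq mod_mult_right_eq)
  then show ?thesis
    by (simp add: rotation_def)
qed

lemma rotation_id: "a \<in> carrier B \<Longrightarrow> p dvd k \<Longrightarrow> rotation k a = a"
proof (rule base_eqI)
  fix i assume "a \<in> carrier B" "p dvd k" "i < p"
  moreover from this have "(i + (p - Suc 0) * k) mod p = i"
    by (metis dvd_mult mod_add_right_eq mod_eq_0_iff_dvd add.right_neutral mod_less)
  ultimately show "rotation k a i = a i"
    by (simp add: rotation_apply)
qed (auto simp: rotation_closed)

text \<open>The exponent \<open>(p - Suc 0) * k\<close> gives the inverse of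
  \<open>rotation k\<close>, so that exponents stay natural numbers.\<close>

lemma pred_mult_add: "(p - Suc 0) * k + k = p * k"
  using p_pos by (cases p) auto

lemma rotation_cancel:
  assumes "a \<in> carrier B"
  shows "rotation ((p - Suc 0) * k) (rotation k a) = a" "rotation k (rotation ((p - Suc 0) * k) a) = a"
  unfolding rotation_rotation[OF assms]
  by (rule rotation_id[OF assms], use pred_mult_add in \<open>simp add: add.commute\<close>)+

lemma rotation_mult:
  assumes "a \<in> carrier B" "b \<in> carrier B"
  shows "rotation k (a \<otimes>\<^bsub>B\<^esub> b) = rotation k a \<otimes>\<^bsub>B\<^esub> rotation k b"
proof (rule base_eqI)
  fix i assume "i < p"
  then show "rotation k (a \<otimes>\<^bsub>B\<^esub> b) i = (rotation k a \<otimes>\<^bsub>B\<^esub> rotation k b) i"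
    using assms p_pos B.m_closed[OF assms] by (simp add: rotation_apply mult_direct_power)
qed (use assms rotation_closed in auto)

lemma rotation_one: "rotation k \<one>\<^bsub>B\<^esub> = \<one>\<^bsub>B\<^esub>"
proof (rule base_eqI)
  fix i assume "i < p"
  then show "rotation k \<one>\<^bsub>B\<^esub> i = \<one>\<^bsub>B\<^esub> i"
    unfolding rotation_apply[OF B.one_closed \<open>i < p\<close>] using p_pos by (simp add: one_direct_power)
qed (simp_all add: rotation_closed)

lemma rotation_auto: "rotation k \<in> auto B"
proof -
  have "rotation k \<in> hom B B"
    by (auto simp: hom_def rotation_closed rotation_mult)
  moreover have "bij_betw (rotation k) (carrier B) (carrier B)"
    by (rule bij_betw_byWitness[where f' = "rotation ((p - Suc 0) * k)"])
      (auto simp: rotation_closed rotation_cancel)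
  ultimately show ?thesis
    by (simp add: auto_def Bij_def rotation_extensional)
qed

section \<open>The shift group as the group of rotations\<close>

lemma AutoGroup_simps:
  "carrier (AutoGroup B) = auto B" "\<one>\<^bsub>AutoGroup B\<^esub> = rotation 0"
  "rotation k \<otimes>\<^bsub>AutoGroup B\<^esub> rotation l = rotation (k + l)"
proof -
  show "carrier (AutoGroup B) = auto B"
    by (simp add: AutoGroup_def)
  show "\<one>\<^bsub>AutoGroup B\<^esub> = rotation 0"
    by (rule extensionalityI[of _ "carrier B"])
      (auto simp: AutoGroup_def BijGroup_def rotation_extensional rotation_id)
  have "rotation k \<in> Bij (carrier B)" for k
    using rotation_auto by (simp add: auto_def)
  then have "rotation k \<otimes>\<^bsub>AutoGroup B\<^esub> rotation l = compose (carrier B) (rotation k) (rotation l)"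
    by (simp add: AutoGroup_def BijGroup_def)
  also have "\<dots> = rotation (k + l)"
    by (rule extensionalityI[of _ "carrier B"])
      (auto simp: rotation_extensional rotation_rotation compose_eq)
  finally show "rotation k \<otimes>\<^bsub>AutoGroup B\<^esub> rotation l = rotation (k + l)" .
qed

lemma cyclic_shift_rotation: "cyclic_shift A p = rotation 1"
proof -
  have "(if i = 0 then p - 1 else i - 1) = (i + (p - Suc 0)) mod p" if "i < p" for i
    using that by (cases i) (auto simp: mod_if)
  then show ?thesis
    by (auto simp: cyclic_shift_def rotation_def fun_eq_iff)
qed

lemma carrier_T: "carrier T = range rotation"
proof -
  interpret Aut: group "AutoGroup B"
    by (rule B.AutoGroup)
  have "subgroup (range rotation) (AutoGroup B)"
  proof (rule Aut.subgroupI)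
    fix s assume "s \<in> range rotation"
    then obtain k where k: "s = rotation k" by blast
    have "rotation ((p - Suc 0) * k) \<otimes>\<^bsub>AutoGroup B\<^esub> rotation k = \<one>\<^bsub>AutoGroup B\<^esub>"
      unfolding AutoGroup_simps
      by (rule extensionalityI[of _ "carrier B"])
        (auto simp: rotation_extensional rotation_cancel rotation_id simp flip: rotation_rotation)
    then show "inv\<^bsub>AutoGroup B\<^esub> s \<in> range rotation"
      unfolding k using Aut.inv_equality rotation_auto by (simp add: AutoGroup_simps(1))
  qed (auto simp: AutoGroup_simps rotation_auto)
  then have "generate (AutoGroup B) {rotation 1} \<subseteq> range rotation"
    by (intro Aut.generate_subgroup_incl) auto
  moreover have "rotation k \<in> generate (AutoGroup B) {rotation 1}" for k
  proof (induction k)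
    case 0
    then show ?case
      using generate.one[of "AutoGroup B"] by (simp add: AutoGroup_simps)
  next
    case (Suc k)
    then show ?case
      using generate.eng[OF Suc generate.incl[of "rotation 1"]] by (simp add: AutoGroup_simps)
  qed
  ultimately show ?thesis
    using rotation_auto by (auto simp: shift_group_def subgroup_generated_def cyclic_shift_rotation AutoGroup_simps(1))
qed

lemma T_simps:
  "\<one>\<^bsub>T\<^esub> = rotation 0" "rotation k \<otimes>\<^bsub>T\<^esub> rotation l = rotation (k + l)"
  by (simp_all add: shift_group_def subgroup_generated_def AutoGroup_simps)

lemma coordinate_embedding_closed: "a \<in> carrier A \<Longrightarrow> coordinate_embedding p i a \<in> carrier B"
  by (auto simp: coordinate_embedding_def carrier_direct_power)

lemma rotation_coordinate_embedding:
  assumes "a \<in> carrier A"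
  shows "rotation k (coordinate_embedding p 0 a) = coordinate_embedding p (k mod p) a"
proof (rule base_eqI)
  fix i assume i: "i < p"
  have "(i + (p - Suc 0) * k) mod p = 0 \<longleftrightarrow> i = k mod p"
  proof -
    have "(i + (p - Suc 0) * k + k) mod p = i"
    proof -
      show ?thesis
        unfolding add.assoc pred_mult_add using i by simp
    qed
    then have "i = ((i + (p - Suc 0) * k) mod p + k) mod p"
      by (simp add: mod_add_left_eq)
    moreover have "(k mod p + (p - Suc 0) * k) mod p = 0"
    proof -
      have "(k mod p + (p - Suc 0) * k) mod p = (k + (p - Suc 0) * k) mod p"
        by (simp add: mod_add_left_eq)
      also have "k + (p - Suc 0) * k = p * k"
        using pred_mult_add by (simp add: add.commute)
      finally show ?thesis
        by simp
    qed
    ultimately show ?thesis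
      by auto
  qed
  then show "rotation k (coordinate_embedding p 0 a) i = coordinate_embedding p (k mod p) a i"
    using assms i p_pos by (simp add: rotation_apply coordinate_embedding_closed) (simp add: coordinate_embedding_def)
qed (use assms in \<open>auto simp: rotation_closed coordinate_embedding_closed\<close>)

text \<open>A nontrivial element in coordinate 0 is moved to coordinate \<open>k mod p\<close>,
  which reveals \<open>k\<close> modulo \<open>p\<close>. Here \<open>nontrivial\<close> gives the
  shift its exact order.\<close>

lemma rotation_eq_iff: "rotation k = rotation l \<longleftrightarrow> k mod p = l mod p"
proof
  assume eq: "rotation k = rotation l"
  obtain a where a: "a \<in> carrier A" "a \<noteq> \<one>"
    using nontrivial one_closed by blast
  have "coordinate_embedding p (k mod p) a = coordinate_embedding p (l mod p) a"
    using eq rotation_coordinate_embedding[OF a(1)] by metis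
  then have "coordinate_embedding p (k mod p) a (k mod p) = coordinate_embedding p (l mod p) a (k mod p)"
    by simp
  then show "k mod p = l mod p"
    using a(2) p_pos by (simp add: coordinate_embedding_def split: if_splits)
next
  assume "k mod p = l mod p"
  then show "rotation k = rotation l"
    by (metis rotation_mod)
qed

lemma card_T: "card (carrier T) = p" and carrier_T': "carrier T = rotation ` {..<p}"
proof -
  show 1: "carrier T = rotation ` {..<p}"
  proof -
    have "rotation k \<in> rotation ` {..<p}" for k
      using p_pos rotation_mod[of k] by (metis image_eqI lessThan_iff mod_less_divisor)
    then show ?thesis
      unfolding carrier_T by blast
  qed
  have "inj_on rotation {..<p}"
    by (rule inj_onI) (simp add: rotation_eq_iff)
  then show "card (carrier T) = p"
    unfolding 1 by (simp add: card_image)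
qed

section \<open>The wreath product and its base group\<close>

lemma carrier_W: "carrier W = carrier B \<times> range rotation"
  by (simp add: semidirect_product_def carrier_T)

lemma mult_W: "(a, rotation k) \<otimes>\<^bsub>W\<^esub> (b, rotation l) = (a \<otimes>\<^bsub>B\<^esub> rotation k b, rotation (k + l))"
  by (simp add: semidirect_product_def T_simps)

lemma one_W: "\<one>\<^bsub>W\<^esub> = (\<one>\<^bsub>B\<^esub>, rotation 0)"
  by (simp add: semidirect_product_def T_simps)

lemma W_cases:
  assumes "x \<in> carrier W"
  obtains a k where "x = (a, rotation k)" "a \<in> carrier B"
  using assms unfolding carrier_W by blast

lemma W_mem: "a \<in> carrier B \<Longrightarrow> (a, rotation k) \<in> carrier W"
  by (simp add: carrier_W)

sublocale W: finite_group W
proof -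
  have "group W"
  proof (rule groupI)
    show "x \<otimes>\<^bsub>W\<^esub> y \<in> carrier W" if "x \<in> carrier W" "y \<in> carrier W" for x y
      using that by (elim W_cases) (simp add: mult_W W_mem rotation_closed)
    show "\<one>\<^bsub>W\<^esub> \<in> carrier W"
      by (simp add: one_W W_mem)
    show "(x \<otimes>\<^bsub>W\<^esub> y) \<otimes>\<^bsub>W\<^esub> z = x \<otimes>\<^bsub>W\<^esub> (y \<otimes>\<^bsub>W\<^esub> z)"
      if "x \<in> carrier W" "y \<in> carrier W" "z \<in> carrier W" for x y z
      using that by (elim W_cases)
        (simp add: mult_W rotation_closed rotation_mult rotation_rotation B.m_assoc add.assoc)
    show "\<one>\<^bsub>W\<^esub> \<otimes>\<^bsub>W\<^esub> x = x" if "x \<in> carrier W" for x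
      using that by (elim W_cases) (simp add: one_W mult_W rotation_id)
    show "\<exists>y\<in>carrier W. y \<otimes>\<^bsub>W\<^esub> x = \<one>\<^bsub>W\<^esub>" if xW: "x \<in> carrier W" for x
    proof -
      obtain a k where x: "x = (a, rotation k)" "a \<in> carrier B"
        using xW by (rule W_cases)
      let ?l = "(p - Suc 0) * k"
      have "rotation (?l + k) = rotation 0"
        unfolding pred_mult_add rotation_eq_iff by simp
      then have "(inv\<^bsub>B\<^esub> rotation ?l a, rotation ?l) \<otimes>\<^bsub>W\<^esub> x = \<one>\<^bsub>W\<^esub>"
        using x by (simp add: mult_W one_W rotation_closed)
      then show ?thesis
        using x W_mem rotation_closed by (intro bexI[of _ "(inv\<^bsub>B\<^esub> rotation ?l a, rotation ?l)"]) auto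
    qed
  qed
  then show "finite_group W"
    using B.fin card_T p_pos
    by (auto simp: finite_group_def finite_group_axioms_def semidirect_product_def carrier_T' intro!: finite_cartesian_product)
qed

lemma inv_W: "a \<in> carrier B \<Longrightarrow>
    inv\<^bsub>W\<^esub> (a, rotation k) = (rotation ((p - Suc 0) * k) (inv\<^bsub>B\<^esub> a), rotation ((p - Suc 0) * k))"
proof (rule W.inv_equality)
  assume a: "a \<in> carrier B"
  have "rotation ((p - Suc 0) * k + k) = rotation 0"
    unfolding pred_mult_add rotation_eq_iff by simp
  moreover have "rotation ((p - Suc 0) * k) (inv\<^bsub>B\<^esub> a) \<otimes>\<^bsub>B\<^esub> rotation ((p - Suc 0) * k) a = \<one>\<^bsub>B\<^esub>"
    using a by (simp add: rotation_one flip: rotation_mult)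
  ultimately show "(rotation ((p - Suc 0) * k) (inv\<^bsub>B\<^esub> a), rotation ((p - Suc 0) * k)) \<otimes>\<^bsub>W\<^esub> (a, rotation k) = \<one>\<^bsub>W\<^esub>"
    by (simp add: mult_W one_W)
qed (auto simp: W_mem rotation_closed)

lemma conj_W:
  assumes a: "a \<in> carrier B" and b: "b \<in> carrier B"
  shows "(a, rotation k) \<otimes>\<^bsub>W\<^esub> (b, rotation 0) \<otimes>\<^bsub>W\<^esub> inv\<^bsub>W\<^esub> (a, rotation k)
    = (a \<otimes>\<^bsub>B\<^esub> rotation k b \<otimes>\<^bsub>B\<^esub> inv\<^bsub>B\<^esub> a, rotation 0)"
proof -
  have rb: "rotation k b \<in> carrier B"
    using b by (rule rotation_closed)
  have "(a, rotation k) \<otimes>\<^bsub>W\<^esub> (b, rotation 0) = (a \<otimes>\<^bsub>B\<^esub> rotation k b \<otimes>\<^bsub>B\<^esub> inv\<^bsub>B\<^esub> a, rotation 0) \<otimes>\<^bsub>W\<^esub> (a, rotation k)"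
    using a rb by (simp add: mult_W rotation_id B.m_assoc)
  then show ?thesis
    using a b rb by (simp add: W.m_assoc W_mem)
qed

definition "base = carrier B \<times> {rotation 0}"

lemma base_subgroup: "subgroup base W"
proof (rule W.subgroupI)
  show "base \<noteq> {}"
    by (auto simp: base_def intro: B.one_closed)
qed (auto simp: base_def carrier_W mult_W inv_W rotation_closed rotation_id)

lemma base_normal: "x \<in> carrier W \<Longrightarrow> y \<in> base \<Longrightarrow> x \<otimes>\<^bsub>W\<^esub> y \<otimes>\<^bsub>W\<^esub> inv\<^bsub>W\<^esub> x \<in> base"
  by (elim W_cases) (auto simp: base_def conj_W rotation_closed)

lemma base_embedding_hom: "(\<lambda>b. (b, rotation 0)) \<in> hom B (W\<lparr>carrier := base\<rparr>)"
  by (auto simp: hom_def base_def mult_W rotation_id)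

lemma base_embedding_bij: "bij_betw (\<lambda>b. (b, rotation 0)) (carrier B) base"
  by (auto simp: bij_betw_def inj_on_def base_def)

lemma sum_base: "(\<Sum>y\<in>base. f y) = (\<Sum>b\<in>carrier B. f (b, rotation 0))"
  by (rule sum.reindex_bij_betw[OF base_embedding_bij, symmetric])

lemma card_W: "card (carrier W) = card (carrier A) ^ p * p"
  by (simp add: semidirect_product_def card_cartesian_product card_T carrier_direct_power card_PiE)

lemma card_base: "p * card base = card (carrier W)"
  by (simp add: base_def card_W carrier_direct_power card_PiE card_cartesian_product)

end

section \<open>Linear characters trivial on the base group, and the two cases\<close>

context prime_wreath
begin

text \<open>A generator of the linear characters of W that are trivial on the base group.
  \<open>SOME\<close> picks an exponent of the rotation; only its residue modulo \<open>p\<close>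
  affects the value.\<close>

definition phase :: "(nat \<Rightarrow> 'a) \<times> ((nat \<Rightarrow> 'a) \<Rightarrow> nat \<Rightarrow> 'a) \<Rightarrow> complex" where
  "phase = (\<lambda>x\<in>carrier W. cis (2 * pi / p) ^ (SOME k. snd x = rotation k))"

lemma root_power_mod: "cis (2 * pi / p) ^ k = cis (2 * pi / p) ^ (k mod p)"
proof -
  have "cis (2 * pi / p) ^ p = 1"
    using p_pos by (simp add: DeMoivre)
  moreover have "cis (2 * pi / p) ^ k = (cis (2 * pi / p) ^ p) ^ (k div p) * cis (2 * pi / p) ^ (k mod p)"
    by (simp flip: power_mult power_add)
  ultimately show ?thesis
    by simp
qed

lemma root_power_eq_1_iff: "cis (2 * pi / p) ^ k = 1 \<longleftrightarrow> p dvd k"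
proof
  assume "cis (2 * pi / p) ^ k = 1"
  then have "cis (2 * pi * real (k mod p) / p) = cis (2 * pi * real 0 / p)"
    using root_power_mod[of k] by (simp add: DeMoivre mult_ac)
  then have "k mod p = 0"
    using bij_betw_imp_inj_on[OF bij_betw_roots_unity[OF p_pos]] p_pos
    by (auto simp: inj_on_def)
  then show "p dvd k"
    by (simp add: dvd_eq_mod_eq_0)
next
  assume "p dvd k"
  then show "cis (2 * pi / p) ^ k = 1"
    using root_power_mod[of k] by (simp add: dvd_eq_mod_eq_0)
qed

lemma phase_apply:
  assumes "a \<in> carrier B"
  shows "phase (a, rotation k) = cis (2 * pi / p) ^ k"
proof -
  define l where "l = (SOME l. rotation k = rotation l)"
  have "rotation k = rotation l"
    unfolding l_def by (rule someI) (rule refl)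
  then have "k mod p = l mod p"
    by (simp add: rotation_eq_iff)
  then have "cis (2 * pi / p) ^ l = cis (2 * pi / p) ^ k"
    by (metis root_power_mod)
  then show ?thesis
    using assms by (simp add: phase_def W_mem l_def)
qed

lemma phase_linear: "phase \<in> linear_characters W"
proof (rule W.linear_charactersI)
  show "phase \<in> extensional (carrier W)"
    by (simp add: phase_def)
  show "phase \<one>\<^bsub>W\<^esub> = 1"
    by (simp add: one_W phase_apply)
  show "phase (x \<otimes>\<^bsub>W\<^esub> y) = phase x * phase y" if "x \<in> carrier W" "y \<in> carrier W" for x y
    using that by (elim W_cases) (simp add: mult_W phase_apply rotation_closed power_add)
qed

lemma phase_power: "x \<in> carrier W \<Longrightarrow> phase x ^ p = 1"
  by (elim W_cases) (simp add: phase_apply root_power_eq_1_iff flip: power_mult)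

lemma phase_eq_1_iff: "x \<in> carrier W \<Longrightarrow> phase x = 1 \<longleftrightarrow> x \<in> base"
  by (elim W_cases) (auto simp: phase_apply root_power_eq_1_iff base_def rotation_eq_iff dvd_eq_mod_eq_0)

lemma quasi_monomial_vanishing_off_base:
  assumes A: "quasi_monomial_group A" and \<chi>: "\<chi> \<in> Irr W"
    and vanish: "\<And>x. x \<in> carrier W \<Longrightarrow> x \<notin> base \<Longrightarrow> \<chi> x = 0"
  shows "quasi_monomial_character W \<chi>"
proof -
  let ?N = "W\<lparr>carrier := base\<rparr>"
  interpret N: finite_group ?N
    by (rule W.subgroup_finite_group[OF base_subgroup])
  have invN: "inv\<^bsub>?N\<^esub> y = inv\<^bsub>W\<^esub> y" "inv\<^bsub>W\<^esub> y \<in> base" if "y \<in> base" for y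
    using W.m_inv_consistent[OF base_subgroup that] subgroup.m_inv_closed[OF base_subgroup that] by simp_all
  have one_base: "\<one>\<^bsub>W\<^esub> \<in> base"
    by (rule subgroup.one_closed[OF base_subgroup])
  have "\<chi> \<one>\<^bsub>W\<^esub> \<noteq> 0"
    by (rule W.Irr_degree[OF \<chi>]) simp
  then have res1: "restrict \<chi> base \<one>\<^bsub>?N\<^esub> \<noteq> 0"
    using one_base by simp
  have res: "restrict \<chi> base \<in> characters ?N"
    using W.character_restrict[OF base_subgroup] \<chi> W.Irr_subset by blast
  obtain \<theta>' where \<theta>': "\<theta>' \<in> Irr ?N"
    "(\<Sum>y\<in>carrier ?N. restrict \<chi> base y * \<theta>' (inv\<^bsub>?N\<^esub> y)) \<noteq> 0"
    by (rule N.exists_Irr_constituent[OF res res1])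
  have nz: "(\<Sum>y\<in>base. \<chi> y * \<theta>' (inv\<^bsub>W\<^esub> y)) \<noteq> 0"
    using \<theta>'(2) by (simp add: invN cong: sum.cong)
  define \<theta> where "\<theta> = (\<lambda>b\<in>carrier B. \<theta>' (b, rotation 0))"
  have "\<theta> \<in> Irr B"
    unfolding \<theta>_def using N.Irr_pullback_iso[OF B.finite_group_axioms base_embedding_hom _ \<theta>'(1)]
      base_embedding_bij by simp
  then obtain \<phi> where \<phi>: "\<forall>i<p. \<phi> i \<in> Irr A" and \<theta>: "\<theta> = outer_product A p \<phi>"
    by (rule Irr_direct_power)
  have "\<forall>i. \<exists>H \<eta> d. i < p \<longrightarrow> subgroup H A \<and> \<eta> \<in> linear_characters (A\<lparr>carrier := H\<rparr>) \<and>
      induced_character A H \<eta> = (\<lambda>g\<in>carrier A. of_nat d * \<phi> i g)"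
    using A \<phi> unfolding quasi_monomial_group_def quasi_monomial_character_def by blast
  then obtain H \<eta> d where H: "\<And>i. i < p \<Longrightarrow> subgroup (H i) A"
    and \<eta>: "\<And>i. i < p \<Longrightarrow> \<eta> i \<in> linear_characters (A\<lparr>carrier := H i\<rparr>)"
    and ind: "\<And>i. i < p \<Longrightarrow> induced_character A (H i) (\<eta> i) = (\<lambda>g\<in>carrier A. of_nat (d i :: nat) * \<phi> i g)"
    by metis
  define S where "S = PiE {..<p} H"
  have S: "subgroup S B"
    unfolding S_def direct_power_def using H PiE_subgroup_product_group[of "{..<p}" "\<lambda>_. A" H] group_axioms by simp
  have SB: "S \<subseteq> carrier B"
    by (rule subgroup.subset[OF S])
  have S_mem: "s \<in> S \<longleftrightarrow> (\<forall>i<p. s i \<in> H i)" if "s \<in> carrier B" for s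
    using that by (auto simp: S_def carrier_direct_power PiE_iff)
  define L where "L = S \<times> {rotation 0}"
  have L: "subgroup L W"
  proof (rule W.subgroupI)
    show "L \<subseteq> carrier W"
      using SB by (auto simp: L_def carrier_W)
    show "L \<noteq> {}"
      using subgroup.one_closed[OF S] by (auto simp: L_def)
    show "inv\<^bsub>W\<^esub> x \<in> L" if "x \<in> L" for x
      using that SB subgroup.m_inv_closed[OF S] by (auto simp: L_def inv_W rotation_id subset_iff)
    show "x \<otimes>\<^bsub>W\<^esub> y \<in> L" if "x \<in> L" "y \<in> L" for x y
      using that SB subgroup.m_closed[OF S] by (auto simp: L_def mult_W rotation_id subset_iff)
  qed
  interpret L: finite_group "W\<lparr>carrier := L\<rparr>"
    by (rule W.subgroup_finite_group[OF L])
  have \<eta>D: "\<eta> i \<one> = 1" "x \<in> H i \<Longrightarrow> y \<in> H i \<Longrightarrow> \<eta> i (x \<otimes> y) = \<eta> i x * \<eta> i y" if "i < p" for i x y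
    using finite_group.linear_charactersD(1,3)[OF subgroup_finite_group[OF H[OF that]] \<eta>[OF that]] by auto
  define \<mu> where "\<mu> = (\<lambda>x\<in>L. \<Prod>i<p. \<eta> i (fst x i))"
  have \<mu>: "\<mu> \<in> linear_characters (W\<lparr>carrier := L\<rparr>)"
  proof (rule L.linear_charactersI)
    show "\<mu> \<in> extensional (carrier (W\<lparr>carrier := L\<rparr>))"
      by (simp add: \<mu>_def)
    show "\<mu> \<one>\<^bsub>W\<lparr>carrier := L\<rparr>\<^esub> = 1"
      using subgroup.one_closed[OF L] by (simp add: \<mu>_def one_W one_direct_power \<eta>D)
    show "\<mu> (x \<otimes>\<^bsub>W\<lparr>carrier := L\<rparr>\<^esub> y) = \<mu> x * \<mu> y"
      if xy: "x \<in> carrier (W\<lparr>carrier := L\<rparr>)" "y \<in> carrier (W\<lparr>carrier := L\<rparr>)" for x y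
    proof -
      obtain s t where st: "x = (s, rotation 0)" "y = (t, rotation 0)" "s \<in> S" "t \<in> S"
        using xy by (auto simp: L_def)
      have "x \<otimes>\<^bsub>W\<^esub> y \<in> L"
        using subgroup.m_closed[OF L] xy by simp
      moreover have "fst (x \<otimes>\<^bsub>W\<^esub> y) = s \<otimes>\<^bsub>B\<^esub> t"
        using st SB by (simp add: mult_W rotation_id subset_iff)
      moreover have "s i \<in> H i" "t i \<in> H i" if "i < p" for i
        using st S_mem SB that by auto
      ultimately show ?thesis
        using xy st(1,2) by (simp add: \<mu>_def mult_direct_power \<eta>D prod.distrib)
    qed
  qed
  \<comment> \<open>\<open>induced_character\<close> divides by the order of the subgroup, whereas
    \<open>quasi_monomial_of_vanishing\<close> expects the plain sum over conjugates; hence the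
    factors \<open>card (H i)\<close>.\<close>
  define D where "D = (\<Prod>i<p. of_nat (d i * card (H i)) :: complex)"
  show ?thesis
  proof (rule W.quasi_monomial_of_vanishing[OF \<chi> base_subgroup base_normal vanish \<theta>'(1) nz L _ \<mu>, where d = D])
    show "L \<subseteq> base"
      using SB by (auto simp: L_def base_def)
    fix g assume "g \<in> base"
    then obtain b where g: "g = (b, rotation 0)" and b: "b \<in> carrier B"
      by (auto simp: base_def)
    define \<eta>0 where "\<eta>0 i z = (if z \<in> H i then \<eta> i z else 0)" for i z
    have "(\<Sum>x\<in>base. if x \<otimes>\<^bsub>W\<^esub> g \<otimes>\<^bsub>W\<^esub> inv\<^bsub>W\<^esub> x \<in> L then \<mu> (x \<otimes>\<^bsub>W\<^esub> g \<otimes>\<^bsub>W\<^esub> inv\<^bsub>W\<^esub> x) else 0)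
        = (\<Sum>y\<in>carrier B. \<Prod>i<p. \<eta>0 i (y i \<otimes> b i \<otimes> inv (y i)))"
      unfolding sum_base
    proof (rule sum.cong[OF refl])
      fix y assume y: "y \<in> carrier B"
      define z where "z = y \<otimes>\<^bsub>B\<^esub> b \<otimes>\<^bsub>B\<^esub> inv\<^bsub>B\<^esub> y"
      have z: "z \<in> carrier B"
        using y b by (simp add: z_def)
      have zi: "z i = y i \<otimes> b i \<otimes> inv (y i)" if "i < p" for i
        using that y by (simp add: z_def mult_direct_power inv_direct_power)
      have conj: "(y, rotation 0) \<otimes>\<^bsub>W\<^esub> g \<otimes>\<^bsub>W\<^esub> inv\<^bsub>W\<^esub> (y, rotation 0) = (z, rotation 0)"
        unfolding g z_def using conj_W[OF y b] b by (simp add: rotation_id)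
      \<comment> \<open>One coordinate outside its \<open>H i\<close> annihilates the product, so
        extension by zero is compatible with the product.\<close>
      have "(\<Prod>i<p. \<eta>0 i (z i)) = (if z \<in> S then \<Prod>i<p. \<eta> i (z i) else 0)"
      proof (cases "z \<in> S")
        case True
        then show ?thesis
          using S_mem[OF z] by (auto simp: \<eta>0_def intro!: prod.cong)
      next
        case False
        then obtain i where "i < p" "z i \<notin> H i"
          using S_mem[OF z] by blast
        then have "(\<Prod>i<p. \<eta>0 i (z i)) = 0"
          by (intro prod_zero) (auto simp: \<eta>0_def)
        with False show ?thesis
          by simp
      qed
      then show "(if (y, rotation 0) \<otimes>\<^bsub>W\<^esub> g \<otimes>\<^bsub>W\<^esub> inv\<^bsub>W\<^esub> (y, rotation 0) \<in> L
          then \<mu> ((y, rotation 0) \<otimes>\<^bsub>W\<^esub> g \<otimes>\<^bsub>W\<^esub> inv\<^bsub>W\<^esub> (y, rotation 0)) else 0)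
          = (\<Prod>i<p. \<eta>0 i (y i \<otimes> b i \<otimes> inv (y i)))"
        unfolding conj by (simp add: L_def \<mu>_def flip: zi)
    qed
    \<comment> \<open>The conjugating element ranges over all coordinates independently, so the sum
      of products is a product of sums.\<close>
    also have "\<dots> = (\<Prod>i<p. \<Sum>a\<in>carrier A. \<eta>0 i (a \<otimes> b i \<otimes> inv a))"
      unfolding carrier_direct_power
      by (rule sum_PiE_prod[where f = "\<lambda>i a. \<eta>0 i (a \<otimes> b i \<otimes> inv a)"]) simp
    also have "\<dots> = (\<Prod>i<p. of_nat (d i * card (H i)) * \<phi> i (b i))"
    proof (rule prod.cong[OF refl])
      fix i assume "i \<in> {..<p}"
      then have i: "i < p" by simp
      have bi: "b i \<in> carrier A"
        using base_mem[OF b i] .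
      have "card (H i) > 0"
        using finite_group.order_pos[OF subgroup_finite_group[OF H[OF i]]] by simp
      then have "(\<Sum>a\<in>carrier A. \<eta>0 i (a \<otimes> b i \<otimes> inv a)) = induced_character A (H i) (\<eta> i) (b i) * of_nat (card (H i))"
        unfolding induced_character_eq[OF bi] by (simp add: \<eta>0_def)
      then show "(\<Sum>a\<in>carrier A. \<eta>0 i (a \<otimes> b i \<otimes> inv a)) = of_nat (d i * card (H i)) * \<phi> i (b i)"
        using bi ind[OF i] by simp
    qed
    also have "\<dots> = D * \<theta> b"
      using b by (simp add: prod.distrib D_def \<theta> outer_product_def)
    also have "\<theta> b = \<theta>' g"
      using b by (simp add: \<theta>_def g)
    finally show "(\<Sum>x\<in>base. if x \<otimes>\<^bsub>W\<^esub> g \<otimes>\<^bsub>W\<^esub> inv\<^bsub>W\<^esub> x \<in> L then \<mu> (x \<otimes>\<^bsub>W\<^esub> g \<otimes>\<^bsub>W\<^esub> inv\<^bsub>W\<^esub> x) else 0)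
        = D * \<theta>' g" .
  qed
qed

text \<open>A rotation permutes the coordinates. This invariance lets the product character of H^p
  extend to H wr C.\<close>

lemma prod_rotation:
  assumes "a \<in> carrier B"
  shows "(\<Prod>i<p. f (rotation k a i)) = (\<Prod>i<p. (f (a i) :: complex))"
proof (rule prod.reindex_bij_witness[of _ "\<lambda>i. (i + k) mod p" "\<lambda>i. (i + (p - Suc 0) * k) mod p"])
  fix i assume "i \<in> {..<p}"
  then have i: "i < p" by simp
  have e: "(p - Suc 0) * k + k = p * k"
    using pred_mult_add .
  have "((i + (p - Suc 0) * k) mod p + k) mod p = (i + ((p - Suc 0) * k + k)) mod p"
    by (simp add: mod_add_left_eq add.assoc)
  then show "((i + (p - Suc 0) * k) mod p + k) mod p = i"
    unfolding e using i by simp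
  have "((i + k) mod p + (p - Suc 0) * k) mod p = (i + ((p - Suc 0) * k + k)) mod p"
    by (simp add: mod_add_left_eq add_ac)
  then show "((i + k) mod p + (p - Suc 0) * k) mod p = i"
    unfolding e using i by simp
  show "(i + (p - Suc 0) * k) mod p \<in> {..<p}" "(i + k) mod p \<in> {..<p}"
    using p_pos by simp_all
  show "f (a ((i + (p - Suc 0) * k) mod p)) = f (rotation k a i)"
    by (simp only: rotation_apply[OF assms i])
qed

text \<open>The character \<open>\<eta> \<times> \<dots> \<times> \<eta>\<close> of \<open>H\<^sup>p\<close> extends to \<open>H \<wr> C\<close>, and its \<open>p\<close> extensions differ by
  the powers of \<open>phase\<close>. Their multiplicities in \<open>\<chi>\<close> add up to that of \<open>\<eta> \<times> \<dots> \<times> \<eta>\<close> in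
  \<open>\<chi>\<close> restricted to \<open>H\<^sup>p\<close>, which is positive.\<close>

lemma quasi_monomial_irreducible_on_base:
  assumes \<chi>: "\<chi> \<in> Irr W" and irr: "restrict \<chi> base \<in> Irr (W\<lparr>carrier := base\<rparr>)"
    and mono: "\<And>\<phi>. \<phi> \<in> Irr A \<Longrightarrow> (\<lambda>b\<in>carrier B. \<chi> (b, rotation 0)) = outer_product A p (\<lambda>_. \<phi>)
      \<Longrightarrow> (\<lambda>b\<in>carrier B. \<chi> (b, rotation 0)) \<in> Irr B \<Longrightarrow> monomial_character A \<phi>"
  shows "quasi_monomial_character W \<chi>"
proof -
  let ?N = "W\<lparr>carrier := base\<rparr>"
  interpret N: finite_group ?N
    by (rule W.subgroup_finite_group[OF base_subgroup])
  have ch: "\<chi> \<in> characters W"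
    using \<chi> W.Irr_subset by blast
  define \<theta> where "\<theta> = (\<lambda>b\<in>carrier B. \<chi> (b, rotation 0))"
  have "(\<lambda>b\<in>carrier B. restrict \<chi> base (b, rotation 0)) \<in> Irr B"
    using N.Irr_pullback_iso[OF B.finite_group_axioms base_embedding_hom _ irr] base_embedding_bij by simp
  moreover have "(\<lambda>b\<in>carrier B. restrict \<chi> base (b, rotation 0)) = \<theta>"
    by (auto simp: \<theta>_def base_def)
  ultimately have \<theta>B: "\<theta> \<in> Irr B"
    by simp
  have \<theta>_rotation: "\<theta> (rotation k b) = \<theta> b" if b: "b \<in> carrier B" for k b
  proof -
    have "\<chi> ((\<one>\<^bsub>B\<^esub>, rotation k) \<otimes>\<^bsub>W\<^esub> (b, rotation 0) \<otimes>\<^bsub>W\<^esub> inv\<^bsub>W\<^esub> (\<one>\<^bsub>B\<^esub>, rotation k)) = \<chi> (b, rotation 0)"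
      using b by (intro W.character_conj[OF ch]) (auto simp: W_mem)
    then show ?thesis
      using b by (simp add: conj_W rotation_closed \<theta>_def)
  qed
  have "\<theta> (coordinate_embedding p i a) = \<theta> (coordinate_embedding p 0 a)" if "i < p" "a \<in> carrier A" for i a
    using \<theta>_rotation[OF coordinate_embedding_closed[OF that(2)], of i 0] rotation_coordinate_embedding[OF that(2), of i] that(1)
    by simp
  then obtain \<phi> where \<phi>: "\<phi> \<in> Irr A" and \<theta>: "\<theta> = outer_product A p (\<lambda>_. \<phi>)"
    using Irr_direct_power_invariant[OF \<theta>B p_pos] by metis
  have "monomial_character A \<phi>"
    using mono[OF \<phi>] \<theta> \<theta>B by (simp add: \<theta>_def)
  then obtain H \<eta> where H: "subgroup H A" and \<eta>: "\<eta> \<in> linear_characters (A\<lparr>carrier := H\<rparr>)"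
    and ind: "induced_character A H \<eta> = \<phi>"
    unfolding monomial_character_def by blast
  interpret H: finite_group "A\<lparr>carrier := H\<rparr>"
    by (rule subgroup_finite_group[OF H])
  have HA: "H \<subseteq> carrier A" "\<one> \<in> H"
    using subgroup.subset[OF H] subgroup.one_closed[OF H] by auto
  have cardH: "card H > 0"
    using H.order_pos by simp
  have \<eta>D: "\<eta> \<one> = 1" "x \<in> H \<Longrightarrow> y \<in> H \<Longrightarrow> \<eta> (x \<otimes> y) = \<eta> x * \<eta> y" for x y
    using H.linear_charactersD(1,3)[OF \<eta>] by auto
  \<comment> \<open>Reciprocity with factor 1: \<open>\<eta>\<close> occurs in \<open>\<phi>\<close>
    exactly once.\<close>
  have inner: "(\<Sum>h\<in>H. \<phi> h * \<eta> (inv h)) = of_nat (card H)"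
    using induced_proportional_inner[OF \<phi> H, of \<eta> 1] ind by simp
  obtain m where m: "0 < m" "\<phi> \<one> = of_nat m"
    using Irr_degree[OF \<phi>] .
  \<comment> \<open>Monomiality enters here: \<open>\<phi>\<close> itself is induced from
    \<open>H\<close>, so its degree is the index of \<open>H\<close>.\<close>
  have mH: "m * card H = card (carrier A)"
  proof -
    have "of_nat m = of_nat (card (carrier A)) / (of_nat (card H) :: complex)"
      unfolding m(2)[symmetric] ind[symmetric] using HA by (simp add: induced_character_eq \<eta>D)
    then have "of_nat (m * card H) = (of_nat (card (carrier A)) :: complex)"
      using cardH by (simp add: field_simps)
    then show ?thesis
      by (simp only: of_nat_eq_iff)
  qed
  define S where "S = ({..<p} \<rightarrow>\<^sub>E H)"
  have S: "subgroup S B"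
    unfolding S_def direct_power_def using H PiE_subgroup_product_group[of "{..<p}" "\<lambda>_. A" "\<lambda>_. H"] group_axioms by simp
  have SB: "S \<subseteq> carrier B"
    by (rule subgroup.subset[OF S])
  have S_mem: "s i \<in> H" if "s \<in> S" "i < p" for s i
    using that by (auto simp: S_def)
  have S_rotation: "rotation k s \<in> S" if "s \<in> S" for s k
  proof -
    have "(\<lambda>i\<in>{..<p}. s ((i + (p - Suc 0) * k) mod p)) \<in> {..<p} \<rightarrow>\<^sub>E H"
      using S_mem[OF that] p_pos by (intro restrict_PiE_iff[THEN iffD2] ballI) simp
    then show ?thesis
      using that SB by (simp add: S_def rotation_def subset_iff)
  qed
  define K where "K = S \<times> range rotation"
  have K: "subgroup K W"
  proof (rule W.subgroupI)
    show "K \<subseteq> carrier W"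
      using SB by (auto simp: K_def carrier_W)
    show "K \<noteq> {}"
      using subgroup.one_closed[OF S] by (auto simp: K_def)
    show "inv\<^bsub>W\<^esub> x \<in> K" if "x \<in> K" for x
      using that SB subgroup.m_inv_closed[OF S] S_rotation by (auto simp: K_def inv_W subset_iff)
    show "x \<otimes>\<^bsub>W\<^esub> y \<in> K" if "x \<in> K" "y \<in> K" for x y
      using that SB subgroup.m_closed[OF S] S_rotation by (auto simp: K_def mult_W subset_iff)
  qed
  interpret K: finite_group "W\<lparr>carrier := K\<rparr>"
    by (rule W.subgroup_finite_group[OF K])
  have KW: "K \<subseteq> carrier W"
    by (rule subgroup.subset[OF K])
  define \<Lambda> where "\<Lambda> s = (\<Prod>i<p. \<eta> (s i))" for s
  define \<mu> where "\<mu> j = (\<lambda>x\<in>K. \<Lambda> (fst x) * phase x ^ j)" for j :: nat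
  note P = W.linear_charactersD[OF phase_linear]
  have \<mu>: "\<mu> j \<in> linear_characters (W\<lparr>carrier := K\<rparr>)" for j
  proof (rule K.linear_charactersI)
    show "\<mu> j \<in> extensional (carrier (W\<lparr>carrier := K\<rparr>))"
      by (simp add: \<mu>_def)
    have "\<Lambda> \<one>\<^bsub>B\<^esub> = 1"
      by (simp add: \<Lambda>_def one_direct_power \<eta>D)
    then show "\<mu> j \<one>\<^bsub>W\<lparr>carrier := K\<rparr>\<^esub> = 1"
      using subgroup.one_closed[OF K] P(1) by (simp add: \<mu>_def) (simp add: one_W)
    show "\<mu> j (x \<otimes>\<^bsub>W\<lparr>carrier := K\<rparr>\<^esub> y) = \<mu> j x * \<mu> j y"
      if xy: "x \<in> carrier (W\<lparr>carrier := K\<rparr>)" "y \<in> carrier (W\<lparr>carrier := K\<rparr>)" for x y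
    proof -
      obtain s k t l where st: "x = (s, rotation k)" "y = (t, rotation l)" "s \<in> S" "t \<in> S"
        using xy by (auto simp: K_def)
      have xyK: "x \<in> K" "y \<in> K"
        using xy by auto
      have "x \<otimes>\<^bsub>W\<^esub> y \<in> K"
        using subgroup.m_closed[OF K xyK] .
      moreover have "phase (x \<otimes>\<^bsub>W\<^esub> y) = phase x * phase y"
        using P(3) xyK KW by blast
      moreover have "\<Lambda> (fst (x \<otimes>\<^bsub>W\<^esub> y)) = \<Lambda> s * \<Lambda> t"
      proof -
        have "\<Lambda> (fst (x \<otimes>\<^bsub>W\<^esub> y)) = (\<Prod>i<p. \<eta> (s i) * \<eta> (rotation k t i))"
          using S_mem[OF st(3)] S_mem[OF S_rotation[OF st(4)]]
          by (simp add: st(1,2) mult_W \<Lambda>_def mult_direct_power \<eta>D)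
        also have "\<dots> = \<Lambda> s * \<Lambda> t"
          using prod_rotation[of t \<eta> k] st(4) SB by (auto simp: prod.distrib \<Lambda>_def)
        finally show ?thesis .
      qed
      ultimately show ?thesis
        using xyK st(1,2) by (simp add: \<mu>_def power_mult_distrib)
    qed
  qed
  \<comment> \<open>Summing over all \<open>p\<close> extensions cancels every term off the base
    group. What remains factorises over the coordinates into powers of \<open>inner\<close> and is
    nonzero, so some \<open>j\<close> has a nonzero inner product with
    \<open>\<chi>\<close>.\<close>
  have "(\<Sum>j<p. \<Sum>x\<in>K. \<mu> j (inv\<^bsub>W\<^esub> x) * \<chi> x) = (\<Sum>x\<in>K. \<Lambda> (fst (inv\<^bsub>W\<^esub> x)) * \<chi> x * (\<Sum>j<p. phase (inv\<^bsub>W\<^esub> x) ^ j))"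
    using subgroup.m_inv_closed[OF K]
    by (subst sum.swap) (simp add: \<mu>_def sum_distrib_left mult_ac cong: sum.cong)
  also have "\<dots> = (\<Sum>x\<in>K. if x \<in> base then \<Lambda> (fst (inv\<^bsub>W\<^esub> x)) * \<chi> x * of_nat p else 0)"
  proof (rule sum.cong[OF refl])
    fix x assume "x \<in> K"
    then have x: "x \<in> carrier W" "inv\<^bsub>W\<^esub> x \<in> carrier W"
      using KW by auto
    have "inv\<^bsub>W\<^esub> x \<in> base \<longleftrightarrow> x \<in> base"
      using subgroup.m_inv_closed[OF base_subgroup] x(1) by (metis W.inv_inv)
    then show "\<Lambda> (fst (inv\<^bsub>W\<^esub> x)) * \<chi> x * (\<Sum>j<p. phase (inv\<^bsub>W\<^esub> x) ^ j)
        = (if x \<in> base then \<Lambda> (fst (inv\<^bsub>W\<^esub> x)) * \<chi> x * of_nat p else 0)"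
      using root_of_unity_sum[OF phase_power[OF x(2)]] phase_eq_1_iff[OF x(2)] by simp
  qed
  also have "\<dots> = (\<Sum>x\<in>S \<times> {rotation 0}. \<Lambda> (fst (inv\<^bsub>W\<^esub> x)) * \<chi> x * of_nat p)"
    using K.fin SB by (intro sum.mono_neutral_cong_right) (auto simp: K_def base_def)
  also have "\<dots> = (\<Sum>s\<in>S. (\<Prod>i<p. \<phi> (s i) * \<eta> (inv (s i))) * of_nat p)"
  proof (rule sum.reindex_bij_witness[of _ "\<lambda>s. (s, rotation 0)" fst])
    fix x assume "x \<in> S \<times> {rotation 0}"
    then obtain s where s: "x = (s, rotation 0)" "s \<in> S"
      by auto
    have sB: "s \<in> carrier B"
      using s SB by blast
    have "\<Lambda> (fst (inv\<^bsub>W\<^esub> x)) = (\<Prod>i<p. \<eta> (inv (s i)))"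
      using rotation_id[OF B.inv_closed[OF sB], of 0] sB
      by (simp add: s(1) inv_W \<Lambda>_def) (simp add: inv_direct_power)
    moreover have "\<chi> x = (\<Prod>i<p. \<phi> (s i))"
      using fun_cong[OF \<theta>, of s] sB by (simp add: \<theta>_def outer_product_def s(1))
    ultimately show "(\<Prod>i<p. \<phi> (fst x i) * \<eta> (inv (fst x i))) * of_nat p = \<Lambda> (fst (inv\<^bsub>W\<^esub> x)) * \<chi> x * of_nat p"
      by (simp add: s(1) prod.distrib mult_ac)
  qed auto
  also have "\<dots> = (\<Prod>i<p. \<Sum>h\<in>H. \<phi> h * \<eta> (inv h)) * of_nat p"
    unfolding sum_distrib_right[symmetric] S_def using HA(1)
    by (subst sum_PiE_prod[where f = "\<lambda>i h. \<phi> h * \<eta> (inv h)"]) simp_all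
  also have "\<dots> \<noteq> 0"
    using cardH p_pos by (simp add: inner)
  finally obtain j where j: "(\<Sum>x\<in>K. \<mu> j (inv\<^bsub>W\<^esub> x) * \<chi> x) \<noteq> 0"
    by (meson sum.not_neutral_contains_not_neutral)
  have one0: "\<chi> \<one>\<^bsub>W\<^esub> = of_nat (m ^ p)"
    using fun_cong[OF \<theta>, of "\<one>\<^bsub>B\<^esub>"] m(2) by (simp add: \<theta>_def outer_product_def one_W) (simp add: one_direct_power)
  \<comment> \<open>The factor \<open>p\<close> of the rotations cancels, so the index of
    \<open>K\<close> is \<open>m ^ p\<close>, the degree of \<open>\<chi>\<close>: the case of
    equality in the bound of \<open>quasi_monomial_of_degree\<close>.\<close>
  have "card (carrier W) = m ^ p * card K"
  proof -
    have "card K = card H ^ p * p"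
      using card_T by (simp add: K_def S_def card_cartesian_product card_PiE carrier_T)
    then show ?thesis
      by (simp add: card_W mH[symmetric] power_mult_distrib)
  qed
  then show ?thesis
    using W.quasi_monomial_of_degree[OF \<chi> K \<mu> j one0] by simp
qed

lemma quasi_monomial_wreath:
  assumes A: "quasi_monomial_group A"
    and mono: "\<And>\<chi> \<phi>. \<chi> \<in> Irr W \<Longrightarrow> \<phi> \<in> Irr A \<Longrightarrow> (\<lambda>b\<in>carrier B. \<chi> (b, \<one>\<^bsub>T\<^esub>)) = outer_product A p (\<lambda>_. \<phi>)
      \<Longrightarrow> (\<lambda>b\<in>carrier B. \<chi> (b, \<one>\<^bsub>T\<^esub>)) \<in> Irr B \<Longrightarrow> monomial_character A \<phi>"
  shows "quasi_monomial_group W"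
proof -
  have "quasi_monomial_character W \<chi>" if \<chi>: "\<chi> \<in> Irr W" for \<chi>
  proof (cases "\<exists>x\<in>carrier W - base. \<chi> x \<noteq> 0")
    case True
    have "restrict \<chi> base \<in> Irr (W\<lparr>carrier := base\<rparr>)"
      by (rule W.Irr_restrict_prime_index[OF \<chi> base_subgroup prime card_base phase_linear phase_power phase_eq_1_iff True])
    then show ?thesis
      using mono[OF \<chi>] unfolding T_simps by (intro quasi_monomial_irreducible_on_base[OF \<chi>]) auto
  next
    case False
    then show ?thesis
      by (intro quasi_monomial_vanishing_off_base[OF A \<chi>]) blast
  qed
  then show ?thesis
    using W.group_axioms W.fin by (simp add: quasi_monomial_group_def)
qed

end

theorem proposition2p6:
  fixes A :: "('a, 'b) monoid_scheme" and C :: "('c, 'd) monoid_scheme" and p :: nat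
  assumes "group C" and "cyclic_group C" and "Coset.order C = p" and "prime p"
    and "group A" and "finite (carrier A)" and "carrier A \<noteq> {\<one>\<^bsub>A\<^esub>}"
    and "quasi_monomial_group A"
    and "\<And>\<chi> \<phi>. \<lbrakk>\<chi> \<in> Irr (wreath_product A C); \<phi> \<in> Irr A;
           restrict_base A C \<chi> = outer_product A p (\<lambda>_. \<phi>);
           restrict_base A C \<chi> \<in> Irr (direct_power A p)\<rbrakk> \<Longrightarrow> monomial_character A \<phi>"
  shows "quasi_monomial_group (wreath_product A C)"
proof -
  interpret prime_wreath A p
    using assms(4-7) by (simp add: prime_wreath_def prime_wreath_axioms_def finite_group_def finite_group_axioms_def)
  show ?thesis
    using quasi_monomial_wreath[OF assms(8)] assms(9)
    unfolding wreath_product_def restrict_base_def assms(3) by blast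
qed

end
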